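(* Let $[a,b]\subset\mathbb{R}$ be a finite interval, $n\in\mathbb{N}\cup\{0\}$, $m,r\in\mathbb{N}$, $1\leq p\leq\infty$. Let $A_{r-\ell}\in(W_p^n)^{m\times m}$ for $\ell\in\{1,\dots,r\}$, let $B\colon(W_p^{n+r})^m\to\mathbb{C}^{rm}$ be an arbitrary continuous linear operator, and let $$(Ly)(t)=y^{(r)}(t)+\sum_{\ell=1}^{r}A_{r-\ell}(t)\,y^{(r-\ell)}(t),\qquad t\in(a,b).$$ Let $M(L,B)\in\mathbb{C}^{rm\times rm}$ be the characteristic matrix defined in the context. Then the dimensions of the kernel and of the cokernel of the bounded linear operator $$(L,B)\colon(W_p^{n+r})^m\to(W_p^n)^m\oplus\mathbb{C}^{rm},\qquad y\mapsto(Ly,By),$$ are equal to the dimensions of the kernel and of the cokernel of the matrix $M(L,B)$, respectively.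
   Context: For $l\in\mathbb{N}$, $W_p^{l}=W_p^l([a,b];\mathbb{C})$ is the space of $y\in C^{l-1}([a,b];\mathbb{C})$ with $y^{(l-1)}$ absolutely continuous and $y^{(l)}\in L_p[a,b]$, with norm $\|y\|_{l,p}=\sum_{s=0}^{l}\|y^{(s)}\|_p$; $W_p^0:=L_p$. $(W_p^{l})^m$ and $(W_p^l)^{m\times m}$ are the spaces of $\mathbb{C}^m$-valued (column) and $\mathbb{C}^{m\times m}$-valued functions with entries in $W_p^l$, normed by the sum of the norms of the entries. For each $i\in\{1,\dots,r\}$, let $Y_i\in(W_p^{n+r})^{m\times m}$ be the unique solution of the matrix Cauchy problem $$Y_i^{(r)}(t)+\sum_{j=1}^{r}A_{r-j}(t)Y_i^{(r-j)}(t)=O_m,\ t\in(a,b),\qquad Y_i^{(j-1)}(a)=\delta_{i,j}I_m,\ j\in\{1,\dots,r\},$$ where $O_m$ and $I_m$ are the zero and identity $m\times m$ matrices and $\delta_{i,j}$ is the Kronecker delta (the equation is understood almost everywhere if $n=0$). Let $[BY_i]\in\mathbb{C}^{rm\times m}$ be the matrix whose $j$-th column is the result of applying $B$ to the $j$-th column of $Y_i$. The characteristic matrix is the block matrix $M(L,B):=\big([BY_1],\dots,[BY_r]\big)\in\mathbb{C}^{rm\times rm}$. Kernel and cokernel of a matrix in $\mathbb{C}^{rm\times rm}$ are those of the induced linear map $\mathbb{C}^{rm}\to\mathbb{C}^{rm}$. *)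

theory Defs
  imports
    "HOL-Analysis.Analysis"
    "HOL-Probability.Essential_Supremum"
    "HOL-Algebra.AbelCoset"
    "Jordan_Normal_Form.VS_Connect"
begin

unbundle no vec_syntax
hide_type (open) Finite_Cartesian_Product.vec
hide_const (open) Finite_Cartesian_Product.vec Finite_Cartesian_Product.mat

section \<open>Kernels, quotients and cokernels of module homomorphisms\<close>

text \<open>The fields \<open>mult\<close> and \<open>one\<close> that a module record inherits from the ring record carry no
  meaning.\<close>

definition quotient_module :: "('a, 'c) module \<Rightarrow> 'c set \<Rightarrow> ('a, 'c set) module" where
  "quotient_module V H = \<lparr>carrier = a_rcosets\<^bsub>V\<^esub> H, mult = (\<lambda>X Y. H), one = H, zero = H,
     add = set_add V, smult = (\<lambda>c X. \<Union>x\<in>X. a_r_coset V H (c \<odot>\<^bsub>V\<^esub> x))\<rparr>"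

definition kernel_module :: "('a, 'c) module \<Rightarrow> ('a, 'd) module \<Rightarrow> ('c \<Rightarrow> 'd) \<Rightarrow> ('a, 'c) module" where
  "kernel_module V W T = V\<lparr>carrier := mod_hom.ker V W T\<rparr>"

definition cokernel_module :: "('a, 'c) module \<Rightarrow> ('a, 'd) module \<Rightarrow> ('c \<Rightarrow> 'd) \<Rightarrow> ('a, 'd set) module" where
  "cokernel_module V W T = quotient_module W (mod_hom.im V T)"

section \<open>Sobolev spaces on a compact interval\<close>

definition in_Lp :: "real \<Rightarrow> real \<Rightarrow> ereal \<Rightarrow> (real \<Rightarrow> complex) \<Rightarrow> bool" where
  "in_Lp a b p f \<longleftrightarrow> f \<in> borel_measurable (lebesgue_on {a..b}) \<and>
     (if p = \<infinity> then esssup (lebesgue_on {a..b}) (\<lambda>t. ereal (cmod (f t))) < \<infinity>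
      else integrable (lebesgue_on {a..b}) (\<lambda>t. cmod (f t) powr real_of_ereal p))"

definition Lp_norm :: "real \<Rightarrow> real \<Rightarrow> ereal \<Rightarrow> (real \<Rightarrow> complex) \<Rightarrow> real" where
  "Lp_norm a b p f =
     (if p = \<infinity> then real_of_ereal (esssup (lebesgue_on {a..b}) (\<lambda>t. ereal (cmod (f t))))
      else (\<integral>t. cmod (f t) powr real_of_ereal p \<partial>lebesgue_on {a..b}) powr (1 / real_of_ereal p))"

text \<open>Derivatives are relative to \<open>{a..b}\<close>, hence one-sided at the endpoints. At points where
  the derivative does not exist, \<^const>\<open>vector_derivative\<close> has an unspecified value; below this
  concerns only the top-order derivative, on a null set.\<close>

primrec nderiv :: "real \<Rightarrow> real \<Rightarrow> nat \<Rightarrow> (real \<Rightarrow> complex) \<Rightarrow> real \<Rightarrow> complex" where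
  "nderiv a b 0 f = f"
| "nderiv a b (Suc s) f = (\<lambda>t. vector_derivative (nderiv a b s f) (at t within {a..b}))"

definition abs_continuous :: "real \<Rightarrow> real \<Rightarrow> (real \<Rightarrow> complex) \<Rightarrow> bool" where
  "abs_continuous a b f \<longleftrightarrow>
     (\<forall>\<epsilon>>0. \<exists>\<delta>>0. \<forall>(N::nat) u v.
        (\<forall>i<N. a \<le> u i \<and> u i \<le> v i \<and> v i \<le> b) \<and>
        (\<forall>i<N. \<forall>j<N. i \<noteq> j \<longrightarrow> {u i<..<v i} \<inter> {u j<..<v j} = {}) \<and>
        (\<Sum>i<N. v i - u i) < \<delta> \<longrightarrow>
        (\<Sum>i<N. cmod (f (v i) - f (u i))) < \<epsilon>)"

definition Ck_fun :: "real \<Rightarrow> real \<Rightarrow> nat \<Rightarrow> (real \<Rightarrow> complex) \<Rightarrow> bool" where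
  "Ck_fun a b k f \<longleftrightarrow>
     (\<forall>s<k. nderiv a b s f differentiable_on {a..b}) \<and> continuous_on {a..b} (nderiv a b k f)"

definition sobolev_fun :: "real \<Rightarrow> real \<Rightarrow> ereal \<Rightarrow> nat \<Rightarrow> (real \<Rightarrow> complex) \<Rightarrow> bool" where
  "sobolev_fun a b p l f \<longleftrightarrow>
     (l > 0 \<longrightarrow> Ck_fun a b (l - 1) f \<and> abs_continuous a b (nderiv a b (l - 1) f)) \<and>
     in_Lp a b p (nderiv a b l f)"

definition sobolev_norm :: "real \<Rightarrow> real \<Rightarrow> ereal \<Rightarrow> nat \<Rightarrow> (real \<Rightarrow> complex) \<Rightarrow> real" where
  "sobolev_norm a b p l f = (\<Sum>s\<le>l. Lp_norm a b p (nderiv a b s f))"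

text \<open>A function on \<open>{a..b}\<close> is represented by the total function that vanishes outside
  \<open>{a..b}\<close>. Indices of vectors and matrices start at \<open>0\<close>.\<close>

definition sobolev_vecs :: "real \<Rightarrow> real \<Rightarrow> ereal \<Rightarrow> nat \<Rightarrow> nat \<Rightarrow> (real \<Rightarrow> complex vec) set" where
  "sobolev_vecs a b p l m = {y.
     (\<forall>t. y t \<in> carrier_vec m) \<and> (\<forall>t. t \<notin> {a..b} \<longrightarrow> y t = 0\<^sub>v m) \<and>
     (\<forall>k<m. sobolev_fun a b p l (\<lambda>t. y t $ k))}"

definition sobolev_mats :: "real \<Rightarrow> real \<Rightarrow> ereal \<Rightarrow> nat \<Rightarrow> nat \<Rightarrow> (real \<Rightarrow> complex mat) set" where
  "sobolev_mats a b p l m = {Y.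
     (\<forall>t. Y t \<in> carrier_mat m m) \<and> (\<forall>t. t \<notin> {a..b} \<longrightarrow> Y t = 0\<^sub>m m m) \<and>
     (\<forall>j<m. \<forall>k<m. sobolev_fun a b p l (\<lambda>t. Y t $$ (j, k)))}"

definition sobolev_vec_norm :: "real \<Rightarrow> real \<Rightarrow> ereal \<Rightarrow> nat \<Rightarrow> nat \<Rightarrow> (real \<Rightarrow> complex vec) \<Rightarrow> real" where
  "sobolev_vec_norm a b p l m y = (\<Sum>k<m. sobolev_norm a b p l (\<lambda>t. y t $ k))"

definition sobolev_funs :: "real \<Rightarrow> real \<Rightarrow> ereal \<Rightarrow> nat \<Rightarrow> nat \<Rightarrow> (complex, real \<Rightarrow> complex vec) module" where
  "sobolev_funs a b p l m = \<lparr>carrier = sobolev_vecs a b p l m,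
     mult = (\<lambda>f g t. 0\<^sub>v m), one = (\<lambda>t. 0\<^sub>v m), zero = (\<lambda>t. 0\<^sub>v m),
     add = (\<lambda>f g t. f t + g t), smult = (\<lambda>c f t. c \<cdot>\<^sub>v f t)\<rparr>"

definition null_funs :: "real \<Rightarrow> real \<Rightarrow> ereal \<Rightarrow> nat \<Rightarrow> nat \<Rightarrow> (real \<Rightarrow> complex vec) set" where
  "null_funs a b p l m =
     {f \<in> sobolev_vecs a b p l m. AE t in lebesgue_on {a..b}. f t = 0\<^sub>v m}"

text \<open>For \<open>l = 0\<close> the elements of the Sobolev space are classes of functions modulo equality
  almost everywhere. For \<open>l > 0\<close> they are functions, so that \<^const>\<open>sobolev_funs\<close> already is the
  Sobolev space; the quotient below then only replaces each function by its singleton, see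
  \<open>null_funs_trivial\<close>.\<close>

definition sobolev_space :: "real \<Rightarrow> real \<Rightarrow> ereal \<Rightarrow> nat \<Rightarrow> nat \<Rightarrow> (complex, (real \<Rightarrow> complex vec) set) module" where
  "sobolev_space a b p l m = quotient_module (sobolev_funs a b p l m) (null_funs a b p l m)"

definition sobolev_class ::
  "real \<Rightarrow> real \<Rightarrow> ereal \<Rightarrow> nat \<Rightarrow> nat \<Rightarrow> (real \<Rightarrow> complex vec) \<Rightarrow> (real \<Rightarrow> complex vec) set" where
  "sobolev_class a b p l m f = a_r_coset (sobolev_funs a b p l m) (null_funs a b p l m) f"

lemma continuous_AE_zero:
  fixes f :: "real \<Rightarrow> complex"
  assumes "a < b" "continuous_on {a..b} f" "AE t in lebesgue_on {a..b}. f t = 0" "t \<in> {a..b}"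
  shows "f t = 0"
proof -
  have cl: "closed {x \<in> {a..b}. f x = 0}"
    using continuous_closed_preimage[OF assms(2) closed_atLeastAtMost, of "{0}"]
    by (simp add: vimage_def Int_def)
  have ae: "AE x\<in>{a<..<b} in lebesgue. x \<in> {x \<in> {a..b}. f x = 0}"
    using assms(3) by (subst (asm) AE_restrict_space_iff) (simp_all, rule eventually_mono, auto)
  have "f x = 0" if "x \<in> {a<..<b}" for x
    using mem_closed_if_AE_lebesgue_open[OF open_greaterThanLessThan cl ae that] by simp
  moreover have "closure {a<..<b} = {a..b}"
    using assms(1) by simp
  ultimately show ?thesis
    using continuous_constant_on_closure[of "{a<..<b}" f 0 t] assms by auto
qed

lemma null_funs_trivial:
  assumes "a < b" "l > 0" "f \<in> null_funs a b p l m"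
  shows "f = (\<lambda>t. 0\<^sub>v m)"
proof
  fix t
  have f: "f \<in> sobolev_vecs a b p l m" and ae: "AE t in lebesgue_on {a..b}. f t = 0\<^sub>v m"
    using assms(3) by (auto simp: null_funs_def)
  show "f t = 0\<^sub>v m"
  proof (cases "t \<in> {a..b}")
    case True
    have "f t $ k = 0" if "k < m" for k
    proof (rule continuous_AE_zero[OF assms(1) _ _ True])
      have "Ck_fun a b (l - 1) (\<lambda>t. f t $ k)"
        using f that assms(2) by (auto simp: sobolev_vecs_def sobolev_fun_def)
      then show "continuous_on {a..b} (\<lambda>t. f t $ k)"
      proof (cases "l - 1")
        case (Suc s)
        then have "nderiv a b 0 (\<lambda>t. f t $ k) differentiable_on {a..b}"
          using \<open>Ck_fun a b (l - 1) (\<lambda>t. f t $ k)\<close> unfolding Ck_fun_def by (metis zero_less_Suc)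
        then show ?thesis
          using differentiable_imp_continuous_on by auto
      qed (auto simp: Ck_fun_def)
      show "AE t in lebesgue_on {a..b}. f t $ k = 0"
        using ae by (rule eventually_mono) (use that in simp)
    qed
    moreover have "f t \<in> carrier_vec m"
      using f by (simp add: sobolev_vecs_def)
    ultimately show ?thesis
      by (intro eq_vecI) simp_all
  qed (use f in \<open>simp add: sobolev_vecs_def\<close>)
qed

section \<open>The differential operator and the characteristic matrix\<close>

text \<open>The expression \<open>Ly\<close> is evaluated on all of \<open>{a..b}\<close>. The endpoints are null for \<open>n = 0\<close>,
  and for \<open>n > 0\<close> their values are the continuous extensions from \<open>{a<..<b}\<close>.\<close>

definition nderiv_vec :: "real \<Rightarrow> real \<Rightarrow> nat \<Rightarrow> nat \<Rightarrow> (real \<Rightarrow> complex vec) \<Rightarrow> real \<Rightarrow> complex vec" where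
  "nderiv_vec a b m s y t = vec m (\<lambda>k. nderiv a b s (\<lambda>u. y u $ k) t)"

definition nderiv_mat :: "real \<Rightarrow> real \<Rightarrow> nat \<Rightarrow> nat \<Rightarrow> (real \<Rightarrow> complex mat) \<Rightarrow> real \<Rightarrow> complex mat" where
  "nderiv_mat a b m s Y t = mat m m (\<lambda>(j, k). nderiv a b s (\<lambda>u. Y u $$ (j, k)) t)"

definition diff_op ::
  "real \<Rightarrow> real \<Rightarrow> nat \<Rightarrow> nat \<Rightarrow> (nat \<Rightarrow> real \<Rightarrow> complex mat) \<Rightarrow> (real \<Rightarrow> complex vec) \<Rightarrow> real \<Rightarrow> complex vec" where
  "diff_op a b m r A y t =
     (if t \<in> {a..b}
      then vec m (\<lambda>k. nderiv_vec a b m r y t $ k +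
             (\<Sum>l=1..r. (A (r - l) t *\<^sub>v nderiv_vec a b m (r - l) y t) $ k))
      else 0\<^sub>v m)"

definition diff_eq_mat ::
  "real \<Rightarrow> real \<Rightarrow> nat \<Rightarrow> nat \<Rightarrow> (nat \<Rightarrow> real \<Rightarrow> complex mat) \<Rightarrow> (real \<Rightarrow> complex mat) \<Rightarrow> real \<Rightarrow> bool" where
  "diff_eq_mat a b m r A Y t \<longleftrightarrow>
     mat m m (\<lambda>jk. nderiv_mat a b m r Y t $$ jk +
       (\<Sum>l=1..r. (A (r - l) t * nderiv_mat a b m (r - l) Y t) $$ jk)) = 0\<^sub>m m m"

definition cauchy_solution ::
  "real \<Rightarrow> real \<Rightarrow> ereal \<Rightarrow> nat \<Rightarrow> nat \<Rightarrow> nat \<Rightarrow> (nat \<Rightarrow> real \<Rightarrow> complex mat) \<Rightarrow> nat \<Rightarrow> (real \<Rightarrow> complex mat) \<Rightarrow> bool" where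
  "cauchy_solution a b p n m r A i Y \<longleftrightarrow>
     Y \<in> sobolev_mats a b p (n + r) m \<and>
     (if n = 0 then AE t in lebesgue_on {a<..<b}. diff_eq_mat a b m r A Y t
      else \<forall>t\<in>{a<..<b}. diff_eq_mat a b m r A Y t) \<and>
     (\<forall>j\<in>{1..r}. nderiv_mat a b m (j - 1) Y a = (if i = j then 1\<^sub>m m else 0\<^sub>m m m))"

definition fundamental_matrix ::
  "real \<Rightarrow> real \<Rightarrow> ereal \<Rightarrow> nat \<Rightarrow> nat \<Rightarrow> nat \<Rightarrow> (nat \<Rightarrow> real \<Rightarrow> complex mat) \<Rightarrow> nat \<Rightarrow> real \<Rightarrow> complex mat" where
  "fundamental_matrix a b p n m r A i = (THE Y. cauchy_solution a b p n m r A i Y)"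

definition apply_to_cols ::
  "nat \<Rightarrow> nat \<Rightarrow> ((real \<Rightarrow> complex vec) \<Rightarrow> complex vec) \<Rightarrow> (real \<Rightarrow> complex mat) \<Rightarrow> complex mat" where
  "apply_to_cols d m B Y = mat d m (\<lambda>(q, k). B (\<lambda>t. col (Y t) k) $ q)"

text \<open>The blocks are numbered from \<open>1\<close>, so column \<open>c\<close> is column \<open>c mod m\<close> of block
  \<open>c div m + 1\<close>.\<close>

definition characteristic_matrix ::
  "real \<Rightarrow> real \<Rightarrow> ereal \<Rightarrow> nat \<Rightarrow> nat \<Rightarrow> nat \<Rightarrow> (nat \<Rightarrow> real \<Rightarrow> complex mat) \<Rightarrow>
   ((real \<Rightarrow> complex vec) \<Rightarrow> complex vec) \<Rightarrow> complex mat" where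
  "characteristic_matrix a b p n m r A B = mat (r * m) (r * m) (\<lambda>(q, c).
     apply_to_cols (r * m) m B (fundamental_matrix a b p n m r A (c div m + 1)) $$ (q, c mod m))"

definition continuous_sobolev_op ::
  "real \<Rightarrow> real \<Rightarrow> ereal \<Rightarrow> nat \<Rightarrow> nat \<Rightarrow> nat \<Rightarrow> ((real \<Rightarrow> complex vec) \<Rightarrow> complex vec) \<Rightarrow> bool" where
  "continuous_sobolev_op a b p l m d B \<longleftrightarrow>
     (\<forall>y\<in>sobolev_vecs a b p l m. \<forall>\<epsilon>>0. \<exists>\<delta>>0. \<forall>z\<in>sobolev_vecs a b p l m.
        sobolev_vec_norm a b p l m (\<lambda>t. z t - y t) < \<delta> \<longrightarrow>
        (\<Sum>q<d. cmod (B z $ q - B y $ q)) < \<epsilon>)"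

definition boundary_op ::
  "real \<Rightarrow> real \<Rightarrow> ereal \<Rightarrow> nat \<Rightarrow> nat \<Rightarrow> nat \<Rightarrow> (nat \<Rightarrow> real \<Rightarrow> complex mat) \<Rightarrow>
   ((real \<Rightarrow> complex vec) \<Rightarrow> complex vec) \<Rightarrow> (real \<Rightarrow> complex vec) \<Rightarrow>
   (real \<Rightarrow> complex vec) set \<times> complex vec" where
  "boundary_op a b p n m r A B y = (sobolev_class a b p n m (diff_op a b m r A y), B y)"

end

theory Submission imports Defs
begin

hide_const (open) Polynomial.content

text \<open>The map that sends \<open>y\<close> to \<open>Ly\<close> together with the initial data \<open>(y(a), \<dots>, y\<^sup>(\<^sup>r\<^sup>-\<^sup>1\<^sup>)(a))\<close> is
  bijective: rewritten as a first-order system, the equation is a Volterra integral equation with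
  integrable coefficients, whose Picard map is a contraction in a weighted supremum norm. Hence the
  columns of \<open>Y\<^sub>1, \<dots>, Y\<^sub>r\<close> are a basis of the kernel of \<open>L\<close>. If \<open>\<Psi> v\<close> is the combination of these columns
  with coefficients \<open>v\<close>, then \<open>M(L, B) = B \<circ> \<Psi>\<close>, so \<open>\<Psi>\<close> maps the kernel of \<open>M(L, B)\<close> onto the kernel
  of \<open>(L, B)\<close>. Since \<open>L\<close> is onto, \<open>q \<mapsto> (0, q)\<close> induces a surjection onto the cokernel of \<open>(L, B)\<close>, and
  its kernel is the image of \<open>M(L, B)\<close>.

  Absolutely continuous functions have to be shown to be the indefinite integrals of integrable
  functions. They are differentiable almost everywhere because, by a Vitali covering argument, on a
  set where \<open>f\<close> has arbitrarily short intervals of slope at most \<open>p\<close> its increments are at most \<open>p\<close>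
  times the measure; such a set therefore cannot also carry slopes at least \<open>q > p\<close> unless it is
  null.\<close>

section \<open>Absolutely continuous functions\<close>

text \<open>The definition of \<open>sobolev_fun\<close> asks that the derivative of order
  \<open>l - 1\<close> be absolutely continuous and that its \<open>vector_derivative\<close>, whose
  value is unspecified where no derivative exists, lie in L_p. That integrating the latter recovers
  the former is a theorem; it turns the definition into the relation \<open>primitive\<close>, with
  which sums, products and solutions are then treated. Two further points shape the proof. For
  \<open>n = 0\<close> the coefficients are merely in L_p and the equation holds almost everywhere,
  for \<open>n > 0\<close> it holds at every point; \<open>sobolev_eq\<close> handles both cases at
  once. Moreover, the integral equation only yields continuous components. Smoothness up to order
  \<open>n + r\<close> is gained by bootstrapping: the highest derivative is \<open>f\<close> minus
  products of coefficients with lower derivatives, and these are always one degree smoother than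
  what is already known of the highest one, until the degree \<open>n\<close> of the coefficients is
  reached.\<close>

definition increment :: "(real \<Rightarrow> 'a::real_normed_vector) \<Rightarrow> real set \<Rightarrow> 'a" where
  "increment f K = f (Sup K) - f (Inf K)"

text \<open>Stated with \<open>division_of\<close> instead of indexed families so that facts about
  divisions apply directly: extension of a partial division, additivity of the content, tagged sums.
  Any set \<open>S\<close> inside the interval is allowed, hence the intervals need not fill
  \<open>{a..b}\<close>. The codomain is a general normed space because real parts, imaginary parts
  and a real weight are treated as well.\<close>

definition ac_on :: "real \<Rightarrow> real \<Rightarrow> (real \<Rightarrow> 'a::real_normed_vector) \<Rightarrow> bool" where
  "ac_on a b f \<longleftrightarrow> (\<forall>\<epsilon>>0. \<exists>\<delta>>0. \<forall>\<D> S. \<D> division_of S \<and> S \<subseteq> {a..b} \<and> sum content \<D> < \<delta> \<longrightarrow>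
     (\<Sum>K\<in>\<D>. norm (increment f K)) < \<epsilon>)"

lemma ac_onD:
  assumes "ac_on a b f" "\<epsilon> > 0"
  obtains \<delta> where "\<delta> > 0" "\<And>\<D> S. \<D> division_of S \<Longrightarrow> S \<subseteq> {a..b} \<Longrightarrow> sum content \<D> < \<delta> \<Longrightarrow>
    (\<Sum>K\<in>\<D>. norm (increment f K)) < \<epsilon>"
  using assms unfolding ac_on_def by meson

lemma ac_on_subset:
  assumes ac: "ac_on a b f" and "{c..d} \<subseteq> {a..b}"
  shows "ac_on c d f"
  unfolding ac_on_def
proof (intro allI impI)
  fix \<epsilon> :: real assume "\<epsilon> > 0"
  show "\<exists>\<delta>>0. \<forall>\<D> S. \<D> division_of S \<and> S \<subseteq> {c..d} \<and> sum content \<D> < \<delta> \<longrightarrow>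
     (\<Sum>K\<in>\<D>. norm (increment f K)) < \<epsilon>"
    using ac \<open>{c..d} \<subseteq> {a..b}\<close> \<open>\<epsilon> > 0\<close> unfolding ac_on_def by (meson order_trans)
qed

lemma division_interval:
  fixes K :: "real set"
  assumes "\<D> division_of S" "K \<in> \<D>"
  shows "Inf K \<le> Sup K" "K = {Inf K..Sup K}" "K \<subseteq> S" "Inf K \<in> S" "Sup K \<in> S"
proof -
  obtain u v where uv: "K = cbox u v" using assms by blast
  moreover have "K \<noteq> {}" using assms by blast
  ultimately have "u \<le> v" by auto
  then show "Inf K \<le> Sup K" "K = {Inf K..Sup K}" using uv by auto
  show "K \<subseteq> S" using assms by blast
  then show "Inf K \<in> S" "Sup K \<in> S" using uv \<open>u \<le> v\<close> by auto
qed

lemma abs_continuous_imp_ac_on: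
  assumes "abs_continuous a b f"
  shows "ac_on a b f"
  unfolding ac_on_def
proof (intro allI impI)
  fix \<epsilon> :: real assume "\<epsilon> > 0"
  then have "\<exists>\<delta>>0. \<forall>(N::nat) u v.
        (\<forall>i<N. a \<le> u i \<and> u i \<le> v i \<and> v i \<le> b) \<and>
        (\<forall>i<N. \<forall>j<N. i \<noteq> j \<longrightarrow> {u i<..<v i} \<inter> {u j<..<v j} = {}) \<and>
        (\<Sum>i<N. v i - u i) < \<delta> \<longrightarrow> (\<Sum>i<N. cmod (f (v i) - f (u i))) < \<epsilon>"
    using assms unfolding abs_continuous_def by simp
  then obtain \<delta> where \<delta>: "\<delta> > 0" and ac: "\<forall>(N::nat) u v.
        (\<forall>i<N. a \<le> u i \<and> u i \<le> v i \<and> v i \<le> b) \<and>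
        (\<forall>i<N. \<forall>j<N. i \<noteq> j \<longrightarrow> {u i<..<v i} \<inter> {u j<..<v j} = {}) \<and>
        (\<Sum>i<N. v i - u i) < \<delta> \<longrightarrow> (\<Sum>i<N. cmod (f (v i) - f (u i))) < \<epsilon>"
    by (elim exE conjE) (rule that)
  have "(\<Sum>K\<in>\<D>. norm (increment f K)) < \<epsilon>"
    if D: "\<D> division_of S" and S: "S \<subseteq> {a..b}" and small: "sum content \<D> < \<delta>" for \<D> S
  proof -
    obtain h where h: "bij_betw h {..<card \<D>} \<D>"
      using ex_bij_betw_nat_finite[OF division_ofD(1)[OF D]] by (auto simp: lessThan_atLeast0)
    have hD: "h i \<in> \<D>" if "i < card \<D>" for i
      using h that by (auto simp: bij_betw_def)
    note iv = division_interval[OF D hD]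
    have "(\<Sum>i<card \<D>. cmod (f (Sup (h i)) - f (Inf (h i)))) < \<epsilon>"
    proof (rule ac[rule_format], intro conjI)
      show "\<forall>i<card \<D>. a \<le> Inf (h i) \<and> Inf (h i) \<le> Sup (h i) \<and> Sup (h i) \<le> b"
        using iv S by (meson atLeastAtMost_iff subsetD)
      show "\<forall>i<card \<D>. \<forall>j<card \<D>. i \<noteq> j \<longrightarrow> {Inf (h i)<..<Sup (h i)} \<inter> {Inf (h j)<..<Sup (h j)} = {}"
      proof (intro allI impI)
        fix i j assume ij: "i < card \<D>" "j < card \<D>" "i \<noteq> j"
        then have "h i \<noteq> h j" using h by (auto simp: bij_betw_def inj_on_def)
        then have "interior (h i) \<inter> interior (h j) = {}"
          using division_ofD(5)[OF D hD hD] ij by blast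
        then show "{Inf (h i)<..<Sup (h i)} \<inter> {Inf (h j)<..<Sup (h j)} = {}"
          using iv(2)[OF ij(1)] iv(2)[OF ij(2)] by (metis interior_atLeastAtMost_real)
      qed
      have "(\<Sum>i<card \<D>. Sup (h i) - Inf (h i)) = (\<Sum>i<card \<D>. content (h i))"
      proof (rule sum.cong)
        fix i assume "i \<in> {..<card \<D>}"
        then have i: "i < card \<D>" by simp
        have "content {Inf (h i)..Sup (h i)} = Sup (h i) - Inf (h i)"
          using iv(1)[OF i] by simp
        then show "Sup (h i) - Inf (h i) = content (h i)"
          using iv(2)[OF i] by simp
      qed simp
      also have "\<dots> = sum content \<D>"
        by (rule sum.reindex_bij_betw[OF h])
      finally show "(\<Sum>i<card \<D>. Sup (h i) - Inf (h i)) < \<delta>" using small by simp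
    qed
    then show ?thesis
      unfolding increment_def using sum.reindex_bij_betw[OF h, of "\<lambda>K. cmod (f (Sup K) - f (Inf K))"] by simp
  qed
  with \<delta> show "\<exists>\<delta>>0. \<forall>\<D> S. \<D> division_of S \<and> S \<subseteq> {a..b} \<and> sum content \<D> < \<delta> \<longrightarrow>
     (\<Sum>K\<in>\<D>. norm (increment f K)) < \<epsilon>" by blast
qed

lemma ac_on_imp_abs_continuous:
  assumes "ac_on a b f"
  shows "abs_continuous a b f"
  unfolding abs_continuous_def
proof (intro allI impI)
  fix \<epsilon> :: real assume "\<epsilon> > 0"
  then obtain \<delta> where \<delta>: "\<delta> > 0" and ac: "\<And>\<D> S. \<D> division_of S \<Longrightarrow> S \<subseteq> {a..b} \<Longrightarrow> sum content \<D> < \<delta> \<Longrightarrow>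
    (\<Sum>K\<in>\<D>. norm (increment f K)) < \<epsilon>"
    using ac_onD[OF assms] by metis
  have main: "(\<Sum>i<N. cmod (f (v i) - f (u i))) < \<epsilon>"
    if ord: "\<And>i. i < N \<Longrightarrow> a \<le> u i \<and> u i \<le> v i \<and> v i \<le> b"
      and disj: "\<And>i j. i < N \<Longrightarrow> j < N \<Longrightarrow> i \<noteq> j \<Longrightarrow> {u i<..<v i} \<inter> {u j<..<v j} = {}"
      and small: "(\<Sum>i<N. v i - u i) < \<delta>" for N :: nat and u v
  proof -
    \<comment> \<open>Degenerate intervals are dropped: several indices may share one, which would
      destroy injectivity of \<open>h\<close>, and they contribute zero to both sums.\<close>
    define I where "I = {i. i < N \<and> u i < v i}"
    define h where "h i = {u i..v i}" for i
    have inj: "inj_on h I"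
    proof (rule inj_onI)
      fix i j assume ij: "i \<in> I" "j \<in> I" "h i = h j"
      then have "u i = u j" "v i = v j" "u i < v i" by (auto simp: I_def h_def)
      then have "{u i<..<v i} \<inter> {u j<..<v j} \<noteq> {}" by simp
      then show "i = j" using disj ij by (auto simp: I_def)
    qed
    have "(\<Sum>K\<in>h ` I. norm (increment f K)) < \<epsilon>"
    proof (rule ac)
      show "h ` I division_of \<Union>(h ` I)"
      proof (rule division_ofI)
        fix K1 K2 assume "K1 \<in> h ` I" "K2 \<in> h ` I" "K1 \<noteq> K2"
        then obtain i j where "i \<in> I" "j \<in> I" "K1 = h i" "K2 = h j" "i \<noteq> j" by auto
        then show "interior K1 \<inter> interior K2 = {}"
          using disj[of i j] by (auto simp: h_def I_def)
      next
        fix K assume "K \<in> h ` I"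
        then show "\<exists>a b. K = cbox a b" by (auto simp: h_def)
      qed (auto simp: I_def h_def)
      show "\<Union>(h ` I) \<subseteq> {a..b}" using ord by (fastforce simp: I_def h_def)
      have "sum content (h ` I) = (\<Sum>i\<in>I. v i - u i)"
        unfolding sum.reindex[OF inj] by (intro sum.cong) (auto simp: h_def I_def)
      also have "\<dots> \<le> (\<Sum>i<N. v i - u i)"
        by (rule sum_mono2) (use ord in \<open>auto simp: I_def\<close>)
      finally show "sum content (h ` I) < \<delta>" using small by simp
    qed
    also have "(\<Sum>K\<in>h ` I. norm (increment f K)) = (\<Sum>i\<in>I. cmod (f (v i) - f (u i)))"
      unfolding sum.reindex[OF inj] by (intro sum.cong) (auto simp: h_def I_def increment_def)
    also have "\<dots> = (\<Sum>i<N. cmod (f (v i) - f (u i)))"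
    proof (rule sum.mono_neutral_left)
      show "\<forall>i\<in>{..<N} - I. cmod (f (v i) - f (u i)) = 0"
        using ord by (fastforce simp: I_def)
    qed (auto simp: I_def)
    finally show ?thesis .
  qed
  show "\<exists>\<delta>>0. \<forall>(N::nat) u v.
        (\<forall>i<N. a \<le> u i \<and> u i \<le> v i \<and> v i \<le> b) \<and>
        (\<forall>i<N. \<forall>j<N. i \<noteq> j \<longrightarrow> {u i<..<v i} \<inter> {u j<..<v j} = {}) \<and>
        (\<Sum>i<N. v i - u i) < \<delta> \<longrightarrow>
        (\<Sum>i<N. cmod (f (v i) - f (u i))) < \<epsilon>"
  proof (intro exI[of _ \<delta>] conjI allI impI)
    fix N :: nat and u v :: "nat \<Rightarrow> real"
    assume *: "(\<forall>i<N. a \<le> u i \<and> u i \<le> v i \<and> v i \<le> b) \<and>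
        (\<forall>i<N. \<forall>j<N. i \<noteq> j \<longrightarrow> {u i<..<v i} \<inter> {u j<..<v j} = {}) \<and> (\<Sum>i<N. v i - u i) < \<delta>"
    show "(\<Sum>i<N. cmod (f (v i) - f (u i))) < \<epsilon>"
      by (rule main) (use * in \<open>simp_all\<close>)
  qed fact
qed

text \<open>One criterion for the closure properties used later: linear images, translates, products
  and exponentials have increments bounded by those of at most two absolutely continuous
  functions.\<close>

lemma ac_on_dominated:
  assumes f: "ac_on a b f" and g: "ac_on a b g" and C: "C > 0"
    and le: "\<And>x y. x \<in> {a..b} \<Longrightarrow> y \<in> {a..b} \<Longrightarrow> norm (h x - h y) \<le> C * (norm (f x - f y) + norm (g x - g y))"
  shows "ac_on a b h"
  unfolding ac_on_def
proof (intro allI impI)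
  fix \<epsilon> :: real assume "\<epsilon> > 0"
  then have \<epsilon>: "\<epsilon> / (2 * C) > 0" using C by simp
  obtain \<delta>1 where \<delta>1: "\<delta>1 > 0" "\<And>\<D> S. \<D> division_of S \<Longrightarrow> S \<subseteq> {a..b} \<Longrightarrow> sum content \<D> < \<delta>1 \<Longrightarrow>
    (\<Sum>K\<in>\<D>. norm (increment f K)) < \<epsilon> / (2 * C)"
    using ac_onD[OF f \<epsilon>] by blast
  obtain \<delta>2 where \<delta>2: "\<delta>2 > 0" "\<And>\<D> S. \<D> division_of S \<Longrightarrow> S \<subseteq> {a..b} \<Longrightarrow> sum content \<D> < \<delta>2 \<Longrightarrow>
    (\<Sum>K\<in>\<D>. norm (increment g K)) < \<epsilon> / (2 * C)"
    using ac_onD[OF g \<epsilon>] by blast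
  have "(\<Sum>K\<in>\<D>. norm (increment h K)) < \<epsilon>"
    if D: "\<D> division_of S" "S \<subseteq> {a..b}" "sum content \<D> < min \<delta>1 \<delta>2" for \<D> S
  proof -
    have "norm (increment h K) \<le> C * (norm (increment f K) + norm (increment g K))" if "K \<in> \<D>" for K
      using division_interval(4,5)[OF D(1) that] D(2) unfolding increment_def by (intro le) auto
    then have "(\<Sum>K\<in>\<D>. norm (increment h K)) \<le> (\<Sum>K\<in>\<D>. C * (norm (increment f K) + norm (increment g K)))"
      by (rule sum_mono)
    also have "\<dots> = C * ((\<Sum>K\<in>\<D>. norm (increment f K)) + (\<Sum>K\<in>\<D>. norm (increment g K)))"
      by (simp only: sum.distrib sum_distrib_left[symmetric])
    also have "\<dots> < C * (\<epsilon> / (2 * C) + \<epsilon> / (2 * C))"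
      using \<delta>1(2)[OF D(1,2)] \<delta>2(2)[OF D(1,2)] D(3) C by (intro mult_strict_left_mono add_strict_mono) auto
    also have "\<dots> = \<epsilon>" using C by (simp add: field_simps)
    finally show ?thesis .
  qed
  moreover have "min \<delta>1 \<delta>2 > 0" using \<delta>1(1) \<delta>2(1) by simp
  ultimately show "\<exists>\<delta>>0. \<forall>\<D> S. \<D> division_of S \<and> S \<subseteq> {a..b} \<and> sum content \<D> < \<delta> \<longrightarrow>
     (\<Sum>K\<in>\<D>. norm (increment h K)) < \<epsilon>" by blast
qed

lemma ac_on_bounded_linear_image:
  assumes f: "ac_on a b f" and "bounded_linear T"
  shows "ac_on a b (\<lambda>t. T (f t))"
proof -
  interpret T: bounded_linear T by fact
  obtain B where B: "B > 0" "\<And>x. norm (T x) \<le> norm x * B" using T.pos_bounded by blast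
  show ?thesis
  proof (rule ac_on_dominated[OF f f B(1)])
    show "norm (T (f x) - T (f y)) \<le> B * (norm (f x - f y) + norm (f x - f y))" for x y
      using order_trans[OF B(2), of "f x - f y"] B(1) by (simp add: T.diff[symmetric] algebra_simps)
  qed
qed

lemma ac_on_imp_continuous_on:
  assumes "ac_on a b f"
  shows "continuous_on {a..b} f"
  unfolding continuous_on_iff
proof (intro ballI allI impI)
  fix x and e :: real assume x: "x \<in> {a..b}" and "e > 0"
  then obtain \<delta> where \<delta>: "\<delta> > 0" and ac: "\<And>\<D> S. \<D> division_of S \<Longrightarrow> S \<subseteq> {a..b} \<Longrightarrow> sum content \<D> < \<delta> \<Longrightarrow>
    (\<Sum>K\<in>\<D>. norm (increment f K)) < e"
    using ac_onD[OF assms] by metis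
  have "dist (f y) (f x) < e" if y: "y \<in> {a..b}" "dist y x < \<delta>" for y
  proof -
    have "{{min x y..max x y}} division_of {min x y..max x y}"
      using division_of_self[of "min x y" "max x y"] by simp
    then have "norm (increment f {min x y..max x y}) < e"
      using ac[of "{{min x y..max x y}}" "{min x y..max x y}"] x y
      by (auto simp: dist_real_def min_def max_def split: if_splits)
    then show ?thesis
      by (auto simp: increment_def dist_norm norm_minus_commute min_def max_def split: if_splits)
  qed
  with \<delta> show "\<exists>d>0. \<forall>x'\<in>{a..b}. dist x' x < d \<longrightarrow> dist (f x') (f x) < e" by blast
qed

lemma increment_division:
  assumes q: "q division_of {c..d}" and "c \<le> d"
  shows "(\<Sum>K\<in>q. increment f K) = f d - f c"
proof -
  \<comment> \<open>Any tag would do; left endpoints serve to quote the telescoping sum for tagged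
    divisions.\<close>
  let ?p = "(\<lambda>K. (Inf K, K)) ` q"
  note iv = division_interval[OF q]
  have "?p tagged_division_of {c..d}"
  proof (rule tagged_division_ofI)
    fix x K assume "(x, K) \<in> ?p"
    then have K: "K \<in> q" and x: "x = Inf K" by auto
    then have "x \<in> {Inf K..Sup K}" using iv(1) by simp
    then show "x \<in> K" using iv(2)[OF K] by simp
    show "K \<subseteq> {c..d}" "\<exists>a b. K = cbox a b"
      using division_ofD(2,4)[OF q K] by auto
    fix x' K' assume "(x', K') \<in> ?p" "(x, K) \<noteq> (x', K')"
    then have "K' \<in> q" "K \<noteq> K'" using x by auto
    then show "interior K \<inter> interior K' = {}" using division_ofD(5)[OF q K] by simp
  next
    have "{K. \<exists>x. (x, K) \<in> ?p} = q" by auto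
    then show "\<Union>{K. \<exists>x. (x, K) \<in> ?p} = {c..d}" using division_ofD(6)[OF q] by simp
  qed (use division_ofD(1)[OF q] in simp)
  from additive_tagged_division_1[OF assms(2) this, of f]
  have "(\<Sum>(x, K)\<in>?p. f (Sup K) - f (Inf K)) = f d - f c" .
  moreover have "(\<Sum>(x, K)\<in>?p. f (Sup K) - f (Inf K)) = (\<Sum>K\<in>q. increment f K)"
    by (subst sum.reindex) (auto simp: inj_on_def increment_def)
  ultimately show ?thesis by simp
qed

lemma content_division_interval:
  fixes c d :: real
  assumes "q division_of {c..d}" "c \<le> d"
  shows "sum content q = d - c"
  using additive_content_division[of q c d] assms by simp

section \<open>Vitali coverings and bounds on increments\<close>

text \<open>Vitali's theorem gives a countable disjoint family that misses only a null part of
  \<open>S\<close>. Removing its members one by one from \<open>S\<close> gives a decreasing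
  sequence of sets of finite measure with null intersection, so finitely many members leave less
  than \<open>\<eta>\<close>.\<close>

lemma Vitali_finite:
  fixes S :: "real set"
  assumes S: "S \<in> lmeasurable" and \<eta>: "\<eta> > 0"
    and fine: "\<And>x d. x \<in> S \<Longrightarrow> d > 0 \<Longrightarrow> \<exists>u v. P u v \<and> u < v \<and> v - u < d \<and> x \<in> {u..v}"
  obtains \<C> where "finite \<C>" "\<And>K. K \<in> \<C> \<Longrightarrow> K = {Inf K..Sup K} \<and> Inf K < Sup K \<and> P (Inf K) (Sup K)"
    "pairwise disjnt \<C>" "measure lebesgue (S - \<Union>\<C>) < \<eta>"
proof -
  let ?K = "{(u, v). u < v \<and> P u v}"
  \<comment> \<open>The covering theorem speaks of balls, so an interval is encoded by the pair of
    its endpoints, from which centre and radius are computed.\<close>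
  let ?a = "\<lambda>(u, v). (u + v) / 2 :: real" and ?r = "\<lambda>(u, v). (v - u) / 2 :: real"
  have cb: "cball (?a i) (?r i) = {fst i..snd i}" if "i \<in> ?K" for i
    using that by (auto simp: cball_eq_atLeastAtMost field_simps)
  obtain C where C: "countable C" "C \<subseteq> ?K"
     "pairwise (\<lambda>i j. disjnt (cball (?a i) (?r i)) (cball (?a j) (?r j))) C"
     "negligible (S - (\<Union>i\<in>C. cball (?a i) (?r i)))"
  proof (rule Vitali_covering_theorem_cballs[of ?K ?r S ?a])
    show "0 < ?r i" if "i \<in> ?K" for i using that by auto
    show "\<exists>i. i \<in> ?K \<and> x \<in> cball (?a i) (?r i) \<and> ?r i < d" if xd: "x \<in> S" "0 < d" for x d
    proof -
      obtain u v where uv: "P u v" "u < v" "v - u < d" "x \<in> {u..v}"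
        using fine[OF xd] by blast
      then show ?thesis
        using cb[of "(u, v)"] by (intro exI[of _ "(u, v)"]) auto
    qed
  qed blast
  define J where "J = (\<lambda>i. {fst i..snd i}) ` C"
  have cJ: "countable J" using C(1) by (simp add: J_def)
  have JP: "K = {Inf K..Sup K} \<and> Inf K < Sup K \<and> P (Inf K) (Sup K)" if "K \<in> J" for K
  proof -
    obtain i where i: "i \<in> C" "K = {fst i..snd i}" using \<open>K \<in> J\<close> unfolding J_def by blast
    then have "fst i < snd i" "P (fst i) (snd i)" using C(2) by auto
    then show ?thesis using i(2) by simp
  qed
  have pw: "pairwise disjnt J"
  proof (rule pairwiseI)
    fix X Y assume XY: "X \<in> J" "Y \<in> J" "X \<noteq> Y"
    then obtain i j where ij: "i \<in> C" "j \<in> C" "X = {fst i..snd i}" "Y = {fst j..snd j}" by (auto simp: J_def)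
    then have "i \<noteq> j" using XY by blast
    then show "disjnt X Y"
      using pairwiseD[OF C(3) ij(1,2)] cb[OF subsetD[OF C(2) ij(1)]] cb[OF subsetD[OF C(2) ij(2)]] ij(3,4)
      by simp
  qed
  have "(\<Union>i\<in>C. cball (?a i) (?r i)) = \<Union>J"
    unfolding J_def using cb[OF subsetD[OF C(2)]] by simp
  with C(4) have neg: "negligible (S - \<Union>J)" by simp
  show thesis
  \<comment> \<open>\<open>from_nat_into\<close> enumerates only a nonempty set, so the empty family
    is treated apart; repetitions in the enumeration of a finite family do no harm.\<close>
  proof (cases "J = {}")
    case True
    then have "measure lebesgue (S - \<Union>{}) < \<eta>" using neg \<eta> by (simp add: negligible_imp_measure0)
    then show thesis using that[of "{}"] by (simp add: pairwise_def)
  next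
    case False
    let ?T = "\<lambda>n. S - (\<Union>i<n. from_nat_into J i)"
    have meas: "from_nat_into J i \<in> lmeasurable" for i
      using JP[OF from_nat_into[OF False, of i]] lmeasurable_interval(1) by metis
    have Tm: "?T n \<in> lmeasurable" for n
      using S meas by (intro fmeasurable_Diff) (auto intro: fmeasurableD)
    have "(\<lambda>n. measure lebesgue (?T n)) \<longlonglongrightarrow> measure lebesgue (\<Inter>n. ?T n)"
    proof (rule Lim_measure_decseq)
      show "range ?T \<subseteq> sets lebesgue" using Tm by (auto intro: fmeasurableD)
      show "decseq ?T" unfolding decseq_def by (auto dest: less_le_trans)
      show "emeasure lebesgue (?T i) \<noteq> \<infinity>" for i using Tm[of i] fmeasurableD2 by (metis infinity_ennreal_def)
    qed
    moreover have "(\<Inter>n. ?T n) = S - \<Union>J"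
    proof -
      have "\<Union>J = (\<Union>i. from_nat_into J i)"
        using range_from_nat_into[OF False cJ] by simp
      then show ?thesis by (auto)
    qed
    ultimately have "(\<lambda>n. measure lebesgue (?T n)) \<longlonglongrightarrow> 0"
      using neg by (simp add: negligible_imp_measure0)
    then obtain n where n: "measure lebesgue (?T n) < \<eta>"
      using order_tendstoD(2)[OF _ \<eta>] eventually_sequentially by (metis (mono_tags, lifting) order_refl)
    show thesis
    proof (rule that[of "from_nat_into J ` {..<n}"])
      show "pairwise disjnt (from_nat_into J ` {..<n})"
        by (rule pairwise_subset[OF pw]) (use from_nat_into[OF False] in auto)
    qed (use n JP[OF from_nat_into[OF False]] in auto)
  qed
qed

lemma division_of_disjoint_intervals:
  fixes H :: "real set set"
  assumes "finite H" "pairwise disjnt H" "\<And>K. K \<in> H \<Longrightarrow> K = {Inf K..Sup K} \<and> Inf K \<le> Sup K"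
  shows "H division_of \<Union>H"
proof (rule division_ofI)
  fix K assume "K \<in> H"
  with assms(3) have K: "K = {Inf K..Sup K}" "Inf K \<le> Sup K" by blast+
  have "{Inf K..Sup K} \<noteq> {}" using K(2) by simp
  then show "K \<noteq> {}" using K(1) by simp
  show "\<exists>a b. K = cbox a b" using K(1) by (metis interval_cbox)
next
  fix K1 K2 assume "K1 \<in> H" "K2 \<in> H" "K1 \<noteq> K2"
  then have "K1 \<inter> K2 = {}" using pairwiseD[OF assms(2)] by (simp add: disjnt_def)
  then show "interior K1 \<inter> interior K2 = {}" using interior_subset by blast
qed (use assms(1) in auto)

lemma Union_intervals_subset:
  fixes H :: "real set set"
  assumes "\<And>K. K \<in> H \<Longrightarrow> K = {Inf K..Sup K} \<and> a \<le> Inf K \<and> Sup K \<le> b"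
  shows "\<Union>H \<subseteq> {a..b}"
proof
  fix x assume "x \<in> \<Union>H"
  then obtain K where K: "K \<in> H" "x \<in> K" by blast
  then have "x \<in> {Inf K..Sup K}" using assms[OF K(1)] by simp
  then have "Inf K \<le> x" "x \<le> Sup K" by simp_all
  moreover have "a \<le> Inf K" "Sup K \<le> b" using assms[OF K(1)] by blast+
  ultimately show "x \<in> {a..b}" by simp
qed

lemma sum_content_disjoint:
  fixes H :: "real set set"
  assumes "finite H" "pairwise disjnt H" "\<And>K. K \<in> H \<Longrightarrow> K = {Inf K..Sup K} \<and> Inf K \<le> Sup K"
  shows "\<Union>H \<in> lmeasurable" "sum content H = measure lebesgue (\<Union>H)"
proof -
  note div = division_of_disjoint_intervals[OF assms]
  show "\<Union>H \<in> lmeasurable" by (rule lmeasurable_division[OF div])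
  have "sum content H = sum (measure lebesgue) H"
  proof (rule sum.cong)
    fix K assume "K \<in> H"
    then obtain u v where "K = cbox u v" using division_ofD(4)[OF div] by blast
    then show "content K = measure lebesgue K" by simp
  qed simp
  then show "sum content H = measure lebesgue (\<Union>H)" using content_division[OF div] by simp
qed

lemma measure_le_diff_Un:
  assumes "E \<in> lmeasurable" "U \<in> lmeasurable"
  shows "measure lebesgue E \<le> measure lebesgue (E - U) + measure lebesgue U"
proof -
  have "measure lebesgue E \<le> measure lebesgue ((E - U) \<union> U)"
    using assms by (intro measure_mono_fmeasurable) (auto intro: fmeasurableD fmeasurable.Diff fmeasurable.Un)
  also have "\<dots> \<le> measure lebesgue (E - U) + measure lebesgue U"
    using assms by (intro measure_Un_le) (auto intro: fmeasurableD)
  finally show ?thesis .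
qed

text \<open>The disjoint family from \<open>Vitali_finite\<close> extends to a division of
  \<open>{c..d}\<close>. By additivity of lengths, the added intervals \<open>q - \<C>\<close> are
  in total as long as the part of \<open>{c..d}\<close> left uncovered, hence little longer than the
  complement of \<open>E\<close>.\<close>

lemma Vitali_division:
  fixes c d :: real
  assumes "c < d" and E: "E \<in> lmeasurable" and \<eta>: "\<eta> > 0"
    and fine: "\<And>x e. x \<in> E \<Longrightarrow> e > 0 \<Longrightarrow> \<exists>u v. P u v \<and> u < v \<and> v - u < e \<and> x \<in> {u..v}"
  obtains \<C> q where "\<C> \<subseteq> q" "q division_of {c..d}" "\<And>K. K \<in> \<C> \<Longrightarrow> P (Inf K) (Sup K)"
    "sum content (q - \<C>) \<le> (d - c) - measure lebesgue (E \<inter> {c..d}) + \<eta>"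
proof -
  \<comment> \<open>Passing to the open interval lets the small covering intervals fit strictly
    inside \<open>{c..d}\<close>; the two endpoints lost carry no measure.\<close>
  define S where "S = E \<inter> {c<..<d}"
  have S: "S \<in> lmeasurable" unfolding S_def by (intro fmeasurable.Int) (use E in auto)
  obtain \<C> where C: "finite \<C>" "\<And>K. K \<in> \<C> \<Longrightarrow> K = {Inf K..Sup K} \<and> Inf K < Sup K \<and>
        (P (Inf K) (Sup K) \<and> c < Inf K \<and> Sup K < d)"
    "pairwise disjnt \<C>" "measure lebesgue (S - \<Union>\<C>) < \<eta>"
  proof (rule Vitali_finite[OF S \<eta>, where P = "\<lambda>u v. P u v \<and> c < u \<and> v < d"])
    fix x e :: real assume x: "x \<in> S" and "e > 0"
    then have "min e (min (x - c) (d - x)) > 0" by (auto simp: S_def)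
    then obtain u v where "P u v" "u < v" "v - u < min e (min (x - c) (d - x))" "x \<in> {u..v}"
      using fine[of x "min e (min (x - c) (d - x))"] x unfolding S_def by blast
    then show "\<exists>u v. (P u v \<and> c < u \<and> v < d) \<and> u < v \<and> v - u < e \<and> x \<in> {u..v}"
      by (intro exI[of _ u] exI[of _ v]) auto
  qed blast
  have C': "K = {Inf K..Sup K} \<and> Inf K \<le> Sup K" if "K \<in> \<C>" for K using C(2)[OF that] by simp
  have "\<Union>\<C> \<subseteq> {c..d}"
  proof (rule Union_intervals_subset)
    show "K = {Inf K..Sup K} \<and> c \<le> Inf K \<and> Sup K \<le> d" if "K \<in> \<C>" for K
      using C(2)[OF that] by linarith
  qed
  then have "\<Union>\<C> \<subseteq> cbox c d" by simp
  then obtain q where q: "\<C> \<subseteq> q" "q division_of {c..d}"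
    using partial_division_extend_interval[OF division_of_disjoint_intervals[OF C(1,3) C']]
    by (metis cbox_interval)
  have cd: "{c, d} \<in> lmeasurable" "measure lebesgue {c, d} = 0"
    using negligible_finite[of "{c, d}"] by (simp_all add: negligible_iff_measure)
  have "measure lebesgue (E \<inter> {c..d}) \<le> measure lebesgue (S \<union> {c, d})"
  proof (rule measure_mono_fmeasurable)
    show "S \<union> {c, d} \<in> lmeasurable" using S cd(1) by (rule fmeasurable.Un)
    show "E \<inter> {c..d} \<in> sets lebesgue" using E by (auto intro: fmeasurableD)
  qed (auto simp: S_def)
  also have "\<dots> \<le> measure lebesgue S + measure lebesgue {c, d}"
    using S cd by (intro measure_Un_le) (auto intro: fmeasurableD)
  also have "\<dots> = measure lebesgue S" using cd by simp
  finally have "measure lebesgue (E \<inter> {c..d}) \<le> \<eta> + sum content \<C>"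
    using measure_le_diff_Un[OF S sum_content_disjoint(1)[OF C(1,3) C']] C(4) sum_content_disjoint(2)[OF C(1,3) C']
    by simp
  moreover have "sum content q = sum content (q - \<C>) + sum content \<C>"
    using q(1) division_ofD(1)[OF q(2)] by (simp add: sum.subset_diff)
  ultimately have "sum content (q - \<C>) \<le> (d - c) - measure lebesgue (E \<inter> {c..d}) + \<eta>"
    using content_division_interval[OF q(2)] assms(1) by simp
  moreover have "P (Inf K) (Sup K)" if "K \<in> \<C>" for K using C(2)[OF that] by blast
  ultimately show thesis using that[OF q] by blast
qed

text \<open>The intervals only have to contain \<open>x\<close>, possibly in their interior, which
  is what a Vitali covering needs. Slopes at least \<open>q\<close> are expressed by
  \<open>slope_le (\<lambda>x. - f x) (- q)\<close>, so that one estimate serves both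
  directions.\<close>

definition slope_le :: "(real \<Rightarrow> real) \<Rightarrow> real \<Rightarrow> real \<Rightarrow> bool" where
  "slope_le f p x \<longleftrightarrow> (\<forall>e>0. \<exists>u v. f v - f u \<le> p * (v - u) \<and> u < v \<and> v - u < e \<and> x \<in> {u..v})"

text \<open>Each interval of \<open>H\<close> is divided into pieces of slope at most
  \<open>p\<close> and a remainder \<open>R K\<close>. Since \<open>E\<close> nearly fills
  \<open>H\<close>, the remainders together are shorter than \<open>\<delta>\<close>, so absolute
  continuity bounds their increments, and crediting them with slope \<open>p\<close> costs little.
  It matters that \<open>\<delta>\<close> depends on \<open>f\<close>, \<open>p\<close> and
  \<open>\<epsilon>\<close> only and is chosen before \<open>H\<close> and \<open>E\<close>.\<close>

lemma increment_le_of_slope_le: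
  fixes f :: "real \<Rightarrow> real"
  assumes ac: "ac_on a b f" and \<epsilon>: "\<epsilon> > 0"
  obtains \<delta> where "\<delta> > 0" "\<And>H E. \<lbrakk>finite H; pairwise disjnt H;
      \<And>K. K \<in> H \<Longrightarrow> K = {Inf K..Sup K} \<and> Inf K < Sup K \<and> a \<le> Inf K \<and> Sup K \<le> b;
      E \<in> lmeasurable; \<And>x. x \<in> E \<Longrightarrow> slope_le f p x;
      sum content H - measure lebesgue (E \<inter> \<Union>H) < \<delta>\<rbrakk>
    \<Longrightarrow> sum (increment f) H \<le> p * sum content H + \<epsilon>"
proof -
  obtain \<delta>1 where \<delta>1: "\<delta>1 > 0" "\<And>\<D> S. \<D> division_of S \<Longrightarrow> S \<subseteq> {a..b} \<Longrightarrow> sum content \<D> < \<delta>1 \<Longrightarrow>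
    (\<Sum>K\<in>\<D>. norm (increment f K)) < \<epsilon> / 2"
    using ac_onD[OF ac, of "\<epsilon> / 2"] \<epsilon> by (metis half_gt_zero)
  \<comment> \<open>The first bound limits the increments over the remainders to
    \<open>\<epsilon> / 2\<close>, the second limits \<open>\<bar>p\<bar>\<close> times their length
    to \<open>\<epsilon> / 2\<close>; the added 1 covers \<open>p = 0\<close>.\<close>
  define \<delta> where "\<delta> = min \<delta>1 (\<epsilon> / (2 * (\<bar>p\<bar> + 1)))"
  have "\<delta> > 0" using \<delta>1(1) \<epsilon> by (auto simp: \<delta>_def intro!: divide_pos_pos add_nonneg_pos)
  have p\<delta>: "\<bar>p\<bar> * \<delta> \<le> \<epsilon> / 2"
  proof -
    have "\<bar>p\<bar> * \<delta> \<le> (\<bar>p\<bar> + 1) * (\<epsilon> / (2 * (\<bar>p\<bar> + 1)))"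
      using \<open>\<delta> > 0\<close> by (intro mult_mono) (auto simp: \<delta>_def)
    also have "\<dots> = \<epsilon> / 2"
    proof -
      have "\<bar>p\<bar> + 1 \<noteq> 0" by linarith
      then show ?thesis by (simp add: field_simps)
    qed
    finally show ?thesis .
  qed
  show thesis
  proof (rule that[OF \<open>\<delta> > 0\<close>])
    fix H E
    assume H: "finite H" "pairwise disjnt H"
      and HI: "\<And>K. K \<in> H \<Longrightarrow> K = {Inf K..Sup K} \<and> Inf K < Sup K \<and> a \<le> Inf K \<and> Sup K \<le> b"
      and E: "E \<in> lmeasurable" and slope: "\<And>x. x \<in> E \<Longrightarrow> slope_le f p x"
      and small: "sum content H - measure lebesgue (E \<inter> \<Union>H) < \<delta>"
    \<comment> \<open>\<open>s\<close> is the slack left by the assumption on \<open>E\<close>.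
      Distributed over the intervals of \<open>H\<close>, it pays for one error
      \<open>\<eta>\<close> in each; the denominator \<open>real (card H) + 1\<close> keeps the
      total strictly below \<open>s\<close>, also for empty \<open>H\<close>.\<close>
    define s where "s = \<delta> - (sum content H - measure lebesgue (E \<inter> \<Union>H))"
    define \<eta> where "\<eta> = s / (real (card H) + 1)"
    have "s > 0" using small by (simp add: s_def)
    have \<eta>: "\<eta> > 0" using \<open>s > 0\<close> by (simp add: \<eta>_def)
    have card\<eta>: "real (card H) * \<eta> < s"
    proof -
      have "real (card H) * \<eta> < (real (card H) + 1) * \<eta>" using \<eta> by (intro mult_strict_right_mono) auto
      also have "\<dots> = s" by (simp add: \<eta>_def)
      finally show ?thesis .
    qed
    have "\<exists>\<C> q. \<C> \<subseteq> q \<and> q division_of K \<and> (\<forall>J\<in>\<C>. f (Sup J) - f (Inf J) \<le> p * (Sup J - Inf J)) \<and>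
        sum content (q - \<C>) \<le> content K - measure lebesgue (E \<inter> K) + \<eta>" if "K \<in> H" for K
    proof -
      have K: "K = {Inf K..Sup K}" "Inf K < Sup K" using HI[OF that] by blast+
      obtain \<C> q where "\<C> \<subseteq> q" "q division_of {Inf K..Sup K}"
          "\<And>J. J \<in> \<C> \<Longrightarrow> f (Sup J) - f (Inf J) \<le> p * (Sup J - Inf J)"
          "sum content (q - \<C>) \<le> (Sup K - Inf K) - measure lebesgue (E \<inter> {Inf K..Sup K}) + \<eta>"
        using Vitali_division[OF K(2) E \<eta>, of "\<lambda>u v. f v - f u \<le> p * (v - u)"] slope
        unfolding slope_le_def by metis
      moreover have "content {Inf K..Sup K} = Sup K - Inf K" using K(2) by simp
      ultimately show ?thesis using K(1) by metis
    qed
    then obtain \<C> q where Cq: "\<And>K. K \<in> H \<Longrightarrow> \<C> K \<subseteq> q K" "\<And>K. K \<in> H \<Longrightarrow> q K division_of K"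
        "\<And>K J. K \<in> H \<Longrightarrow> J \<in> \<C> K \<Longrightarrow> f (Sup J) - f (Inf J) \<le> p * (Sup J - Inf J)"
        "\<And>K. K \<in> H \<Longrightarrow> sum content (q K - \<C> K) \<le> content K - measure lebesgue (E \<inter> K) + \<eta>"
      by metis
    define R where "R K = q K - \<C> K" for K
    have finR: "finite (R K)" and finC: "finite (\<C> K)" if "K \<in> H" for K
      using division_ofD(1)[OF Cq(2)[OF that]] Cq(1)[OF that] by (auto simp: R_def intro: finite_subset)
    have RK: "J \<subseteq> K" "J \<noteq> {}" "\<exists>a b. J = cbox a b" if "K \<in> H" "J \<in> R K" for J K
      using division_ofD(2,3,4)[OF Cq(2)[OF that(1)], of J] that(2) by (auto simp: R_def)
    have Hdisj: "K \<inter> K' = {}" if "K \<in> H" "K' \<in> H" "K \<noteq> K'" for K K'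
      using pairwiseD[OF H(2) that] by (simp add: disjnt_def)
    have Rdisj: "R K \<inter> R K' = {}" if "K \<in> H" "K' \<in> H" "K \<noteq> K'" for K K'
      using RK(1,2) Hdisj[OF that] that by (metis Int_emptyI Int_greatest subset_empty)
    have Rdiv: "\<Union>(R ` H) division_of \<Union>(\<Union>(R ` H))"
    proof (rule division_ofI)
      fix J J' assume "J \<in> \<Union>(R ` H)" "J' \<in> \<Union>(R ` H)" "J \<noteq> J'"
      then obtain K K' where K: "K \<in> H" "K' \<in> H" "J \<in> R K" "J' \<in> R K'" by blast
      show "interior J \<inter> interior J' = {}"
      proof (cases "K = K'")
        case True
        then show ?thesis using division_ofD(5)[OF Cq(2)[OF K(1)], of J J'] K \<open>J \<noteq> J'\<close> by (auto simp: R_def)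
      next
        case False
        then show ?thesis
          using Hdisj[OF K(1,2) False] RK(1)[OF K(1,3)] RK(1)[OF K(2,4)]
            interior_subset[of J] interior_subset[of J'] by blast
      qed
    next
      fix J assume "J \<in> \<Union>(R ` H)"
      then obtain K where "K \<in> H" "J \<in> R K" by blast
      then show "J \<noteq> {}" "\<exists>a b. J = cbox a b" using RK by auto
    qed (use H(1) finR in auto)
    have sumR: "(\<Sum>J\<in>\<Union>(R ` H). g J) = (\<Sum>K\<in>H. \<Sum>J\<in>R K. g J)" for g :: "real set \<Rightarrow> real"
      by (rule sum.UNION_disjoint) (use H(1) finR Rdisj in auto)
    have EK: "measure lebesgue (E \<inter> \<Union>H) \<le> (\<Sum>K\<in>H. measure lebesgue (E \<inter> K))"
    proof -
      have "E \<inter> K \<in> sets lebesgue" if "K \<in> H" for K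
      proof -
        have "{Inf K..Sup K} \<in> sets lebesgue" by simp
        then have "K \<in> sets lebesgue" using HI[OF that] by metis
        then show ?thesis using fmeasurableD[OF E] by blast
      qed
      then have "measure lebesgue (\<Union>K\<in>H. E \<inter> K) \<le> (\<Sum>K\<in>H. measure lebesgue (E \<inter> K))"
        using H(1) by (intro measure_UNION_le) auto
      then show ?thesis by (simp only: Int_Union)
    qed
    have "(\<Sum>K\<in>H. sum content (R K)) \<le> (\<Sum>K\<in>H. content K - measure lebesgue (E \<inter> K) + \<eta>)"
      by (rule sum_mono) (use Cq(4) in \<open>simp add: R_def\<close>)
    also have "\<dots> = sum content H - (\<Sum>K\<in>H. measure lebesgue (E \<inter> K)) + real (card H) * \<eta>"
      by (simp add: sum.distrib sum_subtractf)
    finally have contR: "(\<Sum>K\<in>H. sum content (R K)) < \<delta>"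
      using card\<eta> EK by (simp add: s_def)
    have "\<Union>(\<Union>(R ` H)) \<subseteq> \<Union>H" using RK(1) by blast
    also have "\<Union>H \<subseteq> {a..b}" by (rule Union_intervals_subset) (use HI in blast)
    finally have "\<Union>(\<Union>(R ` H)) \<subseteq> {a..b}" .
    then have "(\<Sum>J\<in>\<Union>(R ` H). norm (increment f J)) < \<epsilon> / 2"
      by (rule \<delta>1(2)[OF Rdiv]) (use contR in \<open>simp add: sumR \<delta>_def\<close>)
    then have incR: "(\<Sum>K\<in>H. \<Sum>J\<in>R K. increment f J) < \<epsilon> / 2"
      unfolding sumR by (rule le_less_trans[rotated]) (intro sum_mono, simp)
    have "increment f K \<le> p * content K - p * sum content (R K) + (\<Sum>J\<in>R K. increment f J)" if K: "K \<in> H" for K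
    proof -
      have div: "q K division_of {Inf K..Sup K}" and le: "Inf K \<le> Sup K"
        using Cq(2)[OF K] HI[OF K] by auto
      have qK: "sum g (q K) = sum g (\<C> K) + sum g (R K)" for g :: "real set \<Rightarrow> real"
        using sum.subset_diff[OF Cq(1)[OF K] division_ofD(1)[OF Cq(2)[OF K]], of g] by (simp add: R_def)
      have "(\<Sum>J\<in>\<C> K. increment f J) \<le> (\<Sum>J\<in>\<C> K. p * content J)"
      proof (rule sum_mono)
        fix J assume J: "J \<in> \<C> K"
        then have "J \<in> q K" using Cq(1)[OF K] by blast
        note iv = division_interval[OF Cq(2)[OF K] this]
        have "content {Inf J..Sup J} = Sup J - Inf J" using iv(1) by simp
        then have "content J = Sup J - Inf J" using iv(2) by simp
        then show "increment f J \<le> p * content J" using Cq(3)[OF K J] by (simp add: increment_def)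
      qed
      moreover have "increment f K = (\<Sum>J\<in>q K. increment f J)"
        using increment_division[OF div le, of f] by (simp add: increment_def)
      moreover have "sum content (q K) = content K"
        using content_division_interval[OF div le] HI[OF K] by (metis content_real le)
      moreover have "p * sum content (q K) = p * sum content (\<C> K) + p * sum content (R K)"
        by (simp add: qK[of content] distrib_left)
      ultimately show ?thesis
        unfolding sum_distrib_left[symmetric] using qK[of "increment f"] by simp
    qed
    then have "sum (increment f) H \<le> (\<Sum>K\<in>H. p * content K - p * sum content (R K) + (\<Sum>J\<in>R K. increment f J))"
      by (rule sum_mono)
    also have "\<dots> = p * sum content H - p * (\<Sum>K\<in>H. sum content (R K)) + (\<Sum>K\<in>H. \<Sum>J\<in>R K. increment f J)"
      by (simp add: sum.distrib sum_subtractf sum_distrib_left)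
    also have "\<dots> \<le> p * sum content H + \<epsilon>"
    proof -
      \<comment> \<open>The sign of \<open>p\<close> is unknown, so the length of the remainders
        enters through \<open>\<bar>p\<bar>\<close>.\<close>
      have "- (p * (\<Sum>K\<in>H. sum content (R K))) \<le> \<bar>p\<bar> * (\<Sum>K\<in>H. sum content (R K))"
        using sum_nonneg[of H "\<lambda>K. sum content (R K)"]
        by (metis abs_ge_minus_self abs_mult abs_of_nonneg measure_nonneg sum_nonneg)
      also have "\<dots> \<le> \<bar>p\<bar> * \<delta>" using contR by (intro mult_left_mono) auto
      finally show ?thesis using p\<delta> incR by simp
    qed
    finally show "sum (increment f) H \<le> p * sum content H + \<epsilon>" .
  qed
qed

text \<open>Two approximations are combined: an open set \<open>T\<close> only slightly larger than
  \<open>E\<close>, which confines the intervals, and a Vitali covering of \<open>E\<close> by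
  intervals inside \<open>T\<close>. The first keeps \<open>H\<close> from exceeding
  \<open>E\<close>, the second keeps \<open>E\<close> from exceeding \<open>H\<close>, both up to
  \<open>\<delta>\<close>.\<close>

lemma approximate_by_intervals:
  fixes E :: "real set"
  assumes E: "E \<in> lmeasurable" "E \<subseteq> {a<..<b}" and \<delta>: "\<delta> > 0"
  obtains H where "finite H" "pairwise disjnt H"
    "\<And>K. K \<in> H \<Longrightarrow> K = {Inf K..Sup K} \<and> Inf K < Sup K \<and> a \<le> Inf K \<and> Sup K \<le> b"
    "sum content H - measure lebesgue (E \<inter> \<Union>H) < \<delta>"
    "measure lebesgue E - \<delta> < sum content H" "sum content H < measure lebesgue E + \<delta>"
proof -
  obtain T where T: "open T" "E \<subseteq> T" "T - E \<in> lmeasurable" "emeasure lebesgue (T - E) < ennreal \<delta>"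
    using sets_lebesgue_outer_open[OF fmeasurableD[OF E(1)] \<delta>] by blast
  have TE: "measure lebesgue (T - E) < \<delta>"
    using T(3,4) \<delta> by (simp add: emeasure_eq_measure2 ennreal_less_iff)
  let ?G = "T \<inter> {a<..<b}"
  obtain H where H: "finite H" "\<And>K. K \<in> H \<Longrightarrow> K = {Inf K..Sup K} \<and> Inf K < Sup K \<and> {Inf K..Sup K} \<subseteq> ?G"
    "pairwise disjnt H" "measure lebesgue (E - \<Union>H) < \<delta>"
  proof (rule Vitali_finite[OF E(1) \<delta>, where P = "\<lambda>u v. {u..v} \<subseteq> ?G"])
    fix x e :: real assume "x \<in> E" "e > 0"
    then have "x \<in> ?G" "open ?G" using T E(2) by auto
    then obtain r where r: "r > 0" "ball x r \<subseteq> ?G" using open_contains_ball by blast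
    \<comment> \<open>With a third of the minimum the closed interval around \<open>x\<close> stays
      in the ball and its length \<open>2 * h\<close> is below \<open>e\<close>.\<close>
    define h where "h = min r e / 3"
    have "h > 0" "2 * h < e" "h < r" using r \<open>e > 0\<close> by (auto simp: h_def)
    moreover have "{x - h..x + h} \<subseteq> ball x r" using \<open>h < r\<close> by (auto simp: dist_real_def)
    ultimately show "\<exists>u v. {u..v} \<subseteq> ?G \<and> u < v \<and> v - u < e \<and> x \<in> {u..v}"
      using r(2) by (intro exI[of _ "x - h"] exI[of _ "x + h"]) auto
  qed blast
  have H': "K = {Inf K..Sup K} \<and> Inf K \<le> Sup K" if "K \<in> H" for K using H(2)[OF that] by simp
  note mH = sum_content_disjoint[OF H(1,3) H']
  have EH: "E \<inter> \<Union>H \<in> lmeasurable" using E(1) mH(1) by (intro fmeasurable.Int) auto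
  have "measure lebesgue (\<Union>H) \<le> measure lebesgue (E \<inter> \<Union>H) + measure lebesgue (T - E)"
  proof -
    have "\<Union>H \<subseteq> T" using H(2) by blast
    then have "measure lebesgue (\<Union>H) \<le> measure lebesgue ((E \<inter> \<Union>H) \<union> (T - E))"
      using mH(1) EH T(3) by (intro measure_mono_fmeasurable) (auto intro: fmeasurableD fmeasurable.Un)
    also have "\<dots> \<le> measure lebesgue (E \<inter> \<Union>H) + measure lebesgue (T - E)"
      using EH T(3) by (intro measure_Un_le) (auto intro: fmeasurableD)
    finally show ?thesis .
  qed
  moreover have "measure lebesgue (E \<inter> \<Union>H) \<le> measure lebesgue E"
    using E(1) EH by (intro measure_mono_fmeasurable) (auto intro: fmeasurableD)
  moreover have "a \<le> Inf K" "Sup K \<le> b" if "K \<in> H" for K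
  proof -
    have "Inf K \<in> {Inf K..Sup K}" "Sup K \<in> {Inf K..Sup K}" using H(2)[OF that] by auto
    then have "Inf K \<in> ?G" "Sup K \<in> ?G" using H(2)[OF that] by blast+
    then show "a \<le> Inf K" "Sup K \<le> b" by auto
  qed
  ultimately show thesis
    using measure_le_diff_Un[OF E(1) mH(1)] H TE mH(2)
    by (intro that[of H]) (auto dest: H(2))
qed

section \<open>Differentiability almost everywhere and recovery from the derivative\<close>

lemma increment_uminus: "sum (increment (\<lambda>x. - f x)) H = - sum (increment f) H"
  by (simp add: increment_def sum_negf[symmetric])

text \<open>On one family \<open>H\<close> that approximates \<open>E\<close>, the two slope
  conditions give \<open>q * sum content H - \<epsilon> \<le> sum (increment f) H\<close> and
  \<open>sum (increment f) H \<le> p * sum content H + \<epsilon>\<close>, so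
  \<open>(q - p) * sum content H\<close> is at most \<open>2 * \<epsilon>\<close>.\<close>

lemma negligible_if_two_slopes:
  fixes f :: "real \<Rightarrow> real"
  assumes ac: "ac_on a b f" and E: "E \<in> lmeasurable" "E \<subseteq> {a<..<b}" and "p < q"
    and lo: "\<And>x. x \<in> E \<Longrightarrow> slope_le f p x" and up: "\<And>x. x \<in> E \<Longrightarrow> slope_le (\<lambda>x. - f x) (- q) x"
  shows "negligible E"
proof -
  have ac': "ac_on a b (\<lambda>x. - f x)"
    using ac_on_bounded_linear_image[OF ac, of uminus] by (simp add: bounded_linear_minus)
  have "(q - p) * (measure lebesgue E - \<epsilon>) \<le> 2 * \<epsilon>" if "\<epsilon> > 0" for \<epsilon>
  proof -
    obtain \<delta>1 where \<delta>1: "\<delta>1 > 0" "\<And>H E. \<lbrakk>finite H; pairwise disjnt H;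
      \<And>K. K \<in> H \<Longrightarrow> K = {Inf K..Sup K} \<and> Inf K < Sup K \<and> a \<le> Inf K \<and> Sup K \<le> b;
      E \<in> lmeasurable; \<And>x. x \<in> E \<Longrightarrow> slope_le f p x;
      sum content H - measure lebesgue (E \<inter> \<Union>H) < \<delta>1\<rbrakk>
        \<Longrightarrow> sum (increment f) H \<le> p * sum content H + \<epsilon>"
      using increment_le_of_slope_le[OF ac \<open>\<epsilon> > 0\<close>, of p] by blast
    obtain \<delta>2 where \<delta>2: "\<delta>2 > 0" "\<And>H E. \<lbrakk>finite H; pairwise disjnt H;
      \<And>K. K \<in> H \<Longrightarrow> K = {Inf K..Sup K} \<and> Inf K < Sup K \<and> a \<le> Inf K \<and> Sup K \<le> b;
      E \<in> lmeasurable; \<And>x. x \<in> E \<Longrightarrow> slope_le (\<lambda>x. - f x) (- q) x;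
      sum content H - measure lebesgue (E \<inter> \<Union>H) < \<delta>2\<rbrakk>
        \<Longrightarrow> sum (increment (\<lambda>x. - f x)) H \<le> - q * sum content H + \<epsilon>"
      using increment_le_of_slope_le[OF ac' \<open>\<epsilon> > 0\<close>, of "- q"] by blast
    have "min \<epsilon> (min \<delta>1 \<delta>2) > 0" using \<delta>1(1) \<delta>2(1) that by simp
    then obtain H where H: "finite H" "pairwise disjnt H"
      "\<And>K. K \<in> H \<Longrightarrow> K = {Inf K..Sup K} \<and> Inf K < Sup K \<and> a \<le> Inf K \<and> Sup K \<le> b"
      "sum content H - measure lebesgue (E \<inter> \<Union>H) < min \<epsilon> (min \<delta>1 \<delta>2)"
      "measure lebesgue E - min \<epsilon> (min \<delta>1 \<delta>2) < sum content H"
      using approximate_by_intervals[OF E] by metis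
    have "sum (increment f) H \<le> p * sum content H + \<epsilon>"
      by (rule \<delta>1(2)[OF H(1-3) E(1) lo]) (use H(4) in auto)
    moreover have "sum (increment (\<lambda>x. - f x)) H \<le> - q * sum content H + \<epsilon>"
      by (rule \<delta>2(2)[OF H(1-3) E(1) up]) (use H(4) in auto)
    ultimately have "(q - p) * sum content H \<le> 2 * \<epsilon>"
      by (simp add: increment_uminus algebra_simps)
    moreover have "(q - p) * (measure lebesgue E - \<epsilon>) \<le> (q - p) * sum content H"
      using H(5) \<open>p < q\<close> by (intro mult_left_mono) auto
    ultimately show ?thesis by simp
  qed
  note * = this
  have "(q - p) * measure lebesgue E \<le> 0 + e" if "e > 0" for e
  proof -
    \<comment> \<open>Chosen so that \<open>2 * t + (q - p) * t = e\<close>, which turns the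
      estimate for \<open>t\<close> into the one wanted for \<open>e\<close>.\<close>
    define t where "t = e / (q - p + 2)"
    have "q - p + 2 > 0" using \<open>p < q\<close> by simp
    then have "t > 0" "(q - p + 2) * t = e" using that by (simp_all add: t_def)
    then show ?thesis using *[of t] by (simp add: algebra_simps)
  qed
  then have "(q - p) * measure lebesgue E \<le> 0" by (rule field_le_epsilon)
  then have "measure lebesgue E \<le> 0" using \<open>p < q\<close> by (simp add: mult_le_0_iff)
  then show ?thesis using E(1) by (simp add: negligible_iff_measure measure_le_0_iff)
qed

text \<open>Families shorter than \<open>d\<close> have total increment below 1, while slopes at
  least \<open>q\<close> force an increment of at least \<open>q * sum content H - 1\<close>. Hence
  \<open>q * sum content H\<close> is at most 2 for every \<open>q\<close>. The bound
  \<open>d\<close> concerns short families only, so \<open>E\<close> is cut into pieces of length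
  \<open>d / 2\<close>; the other half of \<open>d\<close> is room for the approximation by
  intervals.\<close>

lemma negligible_if_infinite_slope:
  fixes f :: "real \<Rightarrow> real"
  assumes ac: "ac_on a b f" and E: "E \<in> lmeasurable" "E \<subseteq> {a<..<b}"
    and up: "\<And>x q. x \<in> E \<Longrightarrow> slope_le (\<lambda>x. - f x) (- q) x"
  shows "negligible E"
proof -
  have ac': "ac_on a b (\<lambda>x. - f x)"
    using ac_on_bounded_linear_image[OF ac, of uminus] by (simp add: bounded_linear_minus)
  obtain d where d: "d > 0" "\<And>\<D> S. \<D> division_of S \<Longrightarrow> S \<subseteq> {a..b} \<Longrightarrow> sum content \<D> < d \<Longrightarrow>
    (\<Sum>K\<in>\<D>. norm (increment f K)) < 1"
    by (rule ac_onD[OF ac, of 1]) auto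
  have "negligible (E \<inter> {c..c + d / 2})" for c
  proof -
    let ?E = "E \<inter> {c..c + d / 2}"
    have mE: "?E \<in> lmeasurable" "?E \<subseteq> {a<..<b}" using E by (auto intro: fmeasurable.Int)
    have "measure lebesgue ?E \<le> measure lebesgue {c..c + d / 2}"
      using mE by (intro measure_mono_fmeasurable) (auto intro: fmeasurableD)
    then have small: "measure lebesgue ?E \<le> d / 2" using d(1) by simp
    have "measure lebesgue ?E \<le> 0 + e" if "e > 0" for e
    proof -
      \<comment> \<open>Gives \<open>sum content H \<le> e / 2\<close>; the other half of
        \<open>e\<close> is the approximation error of \<open>H\<close>.\<close>
      define q where "q = 4 / e"
      have "q > 0" using that by (simp add: q_def)
      obtain \<delta> where \<delta>: "\<delta> > 0" "\<And>H E. \<lbrakk>finite H; pairwise disjnt H;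
        \<And>K. K \<in> H \<Longrightarrow> K = {Inf K..Sup K} \<and> Inf K < Sup K \<and> a \<le> Inf K \<and> Sup K \<le> b;
        E \<in> lmeasurable; \<And>x. x \<in> E \<Longrightarrow> slope_le (\<lambda>x. - f x) (- q) x;
        sum content H - measure lebesgue (E \<inter> \<Union>H) < \<delta>\<rbrakk>
          \<Longrightarrow> sum (increment (\<lambda>x. - f x)) H \<le> - q * sum content H + 1"
        by (rule increment_le_of_slope_le[OF ac', of 1 "- q"]) auto
      have "min \<delta> (min (d / 2) (e / 2)) > 0" using \<delta>(1) d(1) that by simp
      then obtain H where H: "finite H" "pairwise disjnt H"
        "\<And>K. K \<in> H \<Longrightarrow> K = {Inf K..Sup K} \<and> Inf K < Sup K \<and> a \<le> Inf K \<and> Sup K \<le> b"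
        "sum content H - measure lebesgue (?E \<inter> \<Union>H) < min \<delta> (min (d / 2) (e / 2))"
        "measure lebesgue ?E - min \<delta> (min (d / 2) (e / 2)) < sum content H"
        "sum content H < measure lebesgue ?E + min \<delta> (min (d / 2) (e / 2))"
        using approximate_by_intervals[OF mE] by metis
      have H': "K = {Inf K..Sup K} \<and> Inf K \<le> Sup K" if "K \<in> H" for K using H(3)[OF that] by simp
      have "(\<Sum>K\<in>H. norm (increment f K)) < 1"
      proof (rule d(2))
        show "H division_of \<Union>H" by (rule division_of_disjoint_intervals[OF H(1,2) H'])
        show "\<Union>H \<subseteq> {a..b}" by (rule Union_intervals_subset) (use H(3) in blast)
        show "sum content H < d" using H(6) small by auto
      qed
      then have "sum (increment f) H < 1"
        by (rule le_less_trans[rotated]) (intro sum_mono, simp)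
      moreover have "sum (increment (\<lambda>x. - f x)) H \<le> - q * sum content H + 1"
        by (rule \<delta>(2)[OF H(1-3) mE(1) up]) (use H(4) in auto)
      ultimately have "q * sum content H \<le> 2" by (simp add: increment_uminus)
      then have "sum content H \<le> e / 2" using that by (simp add: q_def field_simps)
      then show ?thesis using H(5) by simp
    qed
    then have "measure lebesgue ?E \<le> 0" by (rule field_le_epsilon)
    then show ?thesis using mE by (simp add: negligible_iff_measure measure_le_0_iff)
  qed
  then have "negligible (\<Union>k::int. E \<inter> {of_int k * (d / 2)..of_int k * (d / 2) + d / 2})"
    by (intro negligible_countable_Union) auto
  moreover have "E \<subseteq> (\<Union>k::int. E \<inter> {of_int k * (d / 2)..of_int k * (d / 2) + d / 2})"
  proof
    fix x assume "x \<in> E"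
    let ?k = "\<lfloor>x / (d / 2)\<rfloor>"
    have k: "of_int ?k \<le> x / (d / 2)" "x / (d / 2) < of_int ?k + 1" by linarith+
    have "d / 2 > 0" using d(1) by simp
    then have "of_int ?k * (d / 2) \<le> x" "x < (of_int ?k + 1) * (d / 2)"
      using k by (simp_all only: pos_le_divide_eq pos_divide_less_eq)
    then have "of_int ?k * (d / 2) \<le> x" "x \<le> of_int ?k * (d / 2) + d / 2"
      by (simp_all add: distrib_right)
    then show "x \<in> (\<Union>k::int. E \<inter> {of_int k * (d / 2)..of_int k * (d / 2) + d / 2})"
      using \<open>x \<in> E\<close> by auto
  qed
  ultimately show ?thesis by (rule negligible_subset)
qed

text \<open>For interior \<open>x\<close> this holds when the upper limit of the difference
  quotients at \<open>x\<close> exceeds \<open>q\<close> and fails when it is below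
  \<open>q\<close>. With \<open>- f\<close> and \<open>- p\<close> it compares the lower limit with
  \<open>p\<close>. The strict inequality is an open condition on \<open>x\<close>, which gives
  measurability.\<close>

definition upper_slope :: "real \<Rightarrow> real \<Rightarrow> (real \<Rightarrow> real) \<Rightarrow> real \<Rightarrow> real \<Rightarrow> bool" where
  "upper_slope a b f q x \<longleftrightarrow> (\<forall>e>0. \<exists>y\<in>{a<..<b}. y \<noteq> x \<and> \<bar>y - x\<bar> < e \<and> (f y - f x) / (y - x) > q)"

lemma upper_slope_imp_slope_le:
  assumes "upper_slope a b f q x"
  shows "slope_le (\<lambda>x. - f x) (- q) x"
  unfolding slope_le_def
proof (intro allI impI)
  fix e :: real assume "e > 0"
  then obtain y where y: "y \<noteq> x" "\<bar>y - x\<bar> < e" "(f y - f x) / (y - x) > q"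
    using assms unfolding upper_slope_def by blast
  show "\<exists>u v. - f v - - f u \<le> - q * (v - u) \<and> u < v \<and> v - u < e \<and> x \<in> {u..v}"
  proof (cases "x < y")
    case True
    then have "f y - f x > q * (y - x)" using y(3) by (simp add: pos_less_divide_eq)
    then show ?thesis using True y(2) by (intro exI[of _ x] exI[of _ y]) (auto simp: algebra_simps)
  next
    case False
    then have "y < x" using y(1) by simp
    then have "f y - f x < q * (y - x)" using y(3) by (simp add: neg_less_divide_eq)
    then show ?thesis using \<open>y < x\<close> y(2) by (intro exI[of _ y] exI[of _ x]) (auto simp: algebra_simps)
  qed
qed

text \<open>For fixed \<open>y\<close> and radius the points \<open>x\<close> in question form an
  open set, by continuity of \<open>f\<close>. So the union over uncountably many \<open>y\<close>
  is still open, and only the countable intersection over the radii \<open>1 / real (Suc n)\<close>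
  leads out of the open sets.\<close>

lemma measurable_upper_slope:
  assumes f: "continuous_on {a..b} f"
  shows "{x \<in> {a<..<b}. upper_slope a b f q x} \<in> lmeasurable"
proof -
  define O' where "O' n y = ({a<..<b} \<inter> ball y (1 / real (Suc n)) - {y}) \<inter>
      (\<lambda>x. (f y - f x) / (y - x)) -` {q<..}" for n :: nat and y
  have "open (O' n y)" for n y
    unfolding O'_def
  proof (rule continuous_open_preimage)
    show "continuous_on ({a<..<b} \<inter> ball y (1 / real (Suc n)) - {y}) (\<lambda>x. (f y - f x) / (y - x))"
      by (intro continuous_intros continuous_on_subset[OF f]) auto
  qed (auto intro!: open_delete open_Int)
  then have "(\<Inter>n. \<Union>y\<in>{a<..<b}. O' n y) \<in> sets borel"
    by (intro sets.countable_INT'') (auto intro!: borel_open)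
  then have m: "(\<Inter>n. \<Union>y\<in>{a<..<b}. O' n y) \<in> sets lebesgue" by simp
  have "{x \<in> {a<..<b}. upper_slope a b f q x} = {a<..<b} \<inter> (\<Inter>n. \<Union>y\<in>{a<..<b}. O' n y)"
  proof (rule Set.set_eqI, rule iffI)
    fix x assume "x \<in> {x \<in> {a<..<b}. upper_slope a b f q x}"
    then have x: "x \<in> {a<..<b}" and u: "upper_slope a b f q x" by auto
    have "x \<in> (\<Union>y\<in>{a<..<b}. O' n y)" for n
    proof -
      have "1 / real (Suc n) > 0" by simp
      then obtain y where "y \<in> {a<..<b}" "y \<noteq> x" "\<bar>y - x\<bar> < 1 / real (Suc n)" "(f y - f x) / (y - x) > q"
        using u unfolding upper_slope_def by blast
      then show ?thesis using x by (auto simp: O'_def dist_real_def)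
    qed
    then show "x \<in> {a<..<b} \<inter> (\<Inter>n. \<Union>y\<in>{a<..<b}. O' n y)" using x by blast
  next
    fix x assume x: "x \<in> {a<..<b} \<inter> (\<Inter>n. \<Union>y\<in>{a<..<b}. O' n y)"
    have "upper_slope a b f q x"
      unfolding upper_slope_def
    proof (intro allI impI)
      fix e :: real assume "e > 0"
      then obtain n where n: "1 / real (Suc n) < e" using nat_approx_posE by blast
      obtain y where "y \<in> {a<..<b}" "x \<in> O' n y" using x by blast
      then show "\<exists>y\<in>{a<..<b}. y \<noteq> x \<and> \<bar>y - x\<bar> < e \<and> (f y - f x) / (y - x) > q"
        using n by (intro bexI[of _ y]) (auto simp: O'_def dist_real_def)
    qed
    then show "x \<in> {x \<in> {a<..<b}. upper_slope a b f q x}" using x by blast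
  qed
  then show ?thesis using m by (auto intro: fmeasurable_Int_fmeasurable)
qed

lemma not_upper_slope:
  assumes "x \<in> {a<..<b}"
  shows "\<not> upper_slope a b f q x \<longleftrightarrow> (\<forall>\<^sub>F y in at x. (f y - f x) / (y - x) \<le> q)"
proof
  assume "\<not> upper_slope a b f q x"
  then obtain e where e: "e > 0" "\<And>y. y \<in> {a<..<b} \<Longrightarrow> y \<noteq> x \<Longrightarrow> \<bar>y - x\<bar> < e \<Longrightarrow> (f y - f x) / (y - x) \<le> q"
    unfolding upper_slope_def by (meson linorder_not_less)
  have "min e (min (x - a) (b - x)) > 0" using e(1) assms by auto
  then show "\<forall>\<^sub>F y in at x. (f y - f x) / (y - x) \<le> q"
    unfolding eventually_at
    by (intro exI[of _ "min e (min (x - a) (b - x))"]) (auto simp: dist_real_def intro!: e(2))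
next
  assume "\<forall>\<^sub>F y in at x. (f y - f x) / (y - x) \<le> q"
  then obtain e where "e > 0" "\<And>y. y \<noteq> x \<Longrightarrow> \<bar>y - x\<bar> < e \<Longrightarrow> (f y - f x) / (y - x) \<le> q"
    unfolding eventually_at by (auto simp: dist_real_def)
  then show "\<not> upper_slope a b f q x"
    unfolding upper_slope_def by (meson linorder_not_less)
qed

text \<open>The set \<open>Q\<close> of eventual upper bounds of the difference quotients is
  nonempty and bounded below by the two assumptions \<open>bdd\<close>, and \<open>Inf Q\<close> is
  the upper limit. If the lower limit were smaller, two rationals \<open>p < q\<close> would fit in
  between, against \<open>no\<close>.\<close>

lemma differentiable_if_slopes:
  assumes x: "x \<in> {a<..<b}" and bdd: "\<not> upper_slope a b f q0 x" "\<not> upper_slope a b (\<lambda>x. - f x) q1 x"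
    and no: "\<And>p q. p \<in> \<rat> \<Longrightarrow> q \<in> \<rat> \<Longrightarrow> p < q \<Longrightarrow>
      \<not> (upper_slope a b f q x \<and> upper_slope a b (\<lambda>x. - f x) (- p) x)"
  shows "\<exists>D. (f has_real_derivative D) (at x)"
proof -
  let ?s = "\<lambda>y. (f y - f x) / (y - x)"
  note up = not_upper_slope[OF x, of f]
  have dn: "\<not> upper_slope a b (\<lambda>x. - f x) q x \<longleftrightarrow> (\<forall>\<^sub>F y in at x. - q \<le> ?s y)" for q
  proof -
    have "(- f y - - f x) / (y - x) \<le> q \<longleftrightarrow> - q \<le> ?s y" for y
      by (simp add: diff_divide_distrib) linarith
    then show ?thesis using not_upper_slope[OF x, of "\<lambda>x. - f x" q] by simp
  qed
  define Q where "Q = {q. \<forall>\<^sub>F y in at x. ?s y \<le> q}"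
  have "q0 \<in> Q" using bdd(1) up by (simp add: Q_def)
  have lower: "- q1 \<le> q" if "q \<in> Q" for q
  proof -
    have "\<forall>\<^sub>F y in at x. - q1 \<le> ?s y \<and> ?s y \<le> q"
      using that bdd(2) dn by (auto simp: Q_def intro: eventually_conj)
    then have "\<exists>y. - q1 \<le> ?s y \<and> ?s y \<le> q"
      using eventually_happens[of _ "at x"] by (metis (no_types, lifting) trivial_limit_at)
    then show ?thesis by auto
  qed
  then have bdd: "bdd_below Q" by (auto simp: bdd_below_def)
  have "(?s \<longlongrightarrow> Inf Q) (at x)"
  proof (rule order_tendstoI)
    fix c assume "c < Inf Q"
    then obtain p where p: "p \<in> \<rat>" "c < p" "p < Inf Q" using Rats_dense_in_real by blast
    then obtain q where q: "q \<in> \<rat>" "p < q" "q < Inf Q" using Rats_dense_in_real by blast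
    have "q \<notin> Q" using cInf_lower[OF _ bdd, of q] q(3) by auto
    then have "upper_slope a b f q x" using up by (auto simp: Q_def)
    then have "\<forall>\<^sub>F y in at x. p \<le> ?s y" using no[OF p(1) q(1,2)] dn[of "- p"] by simp
    then show "\<forall>\<^sub>F y in at x. c < ?s y" by (rule eventually_mono) (use p(2) in auto)
  next
    fix c assume "Inf Q < c"
    then obtain q where "q \<in> Q" "q < c" using cInf_less_iff[OF _ bdd] \<open>q0 \<in> Q\<close> by blast
    then show "\<forall>\<^sub>F y in at x. ?s y < c" unfolding Q_def by (auto elim: eventually_mono)
  qed
  then show ?thesis by (auto simp: has_field_derivative_iff)
qed

text \<open>Interior points without derivative lie in countably many null sets: two where a slope is
  infinite and, for each pair of rationals \<open>p < q\<close>, one where slopes above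
  \<open>q\<close> and below \<open>p\<close> both occur.\<close>

lemma ac_on_real_differentiable_AE:
  fixes f :: "real \<Rightarrow> real"
  assumes ac: "ac_on a b f"
  shows "negligible {x \<in> {a<..<b}. \<nexists>D. (f has_real_derivative D) (at x)}"
proof -
  let ?f = "\<lambda>x. - f x"
  have ac': "ac_on a b ?f"
    using ac_on_bounded_linear_image[OF ac, of uminus] by (simp add: bounded_linear_minus)
  define U where "U g q = {x \<in> {a<..<b}. upper_slope a b g q x}" for g q
  have mU: "U f q \<in> lmeasurable" "U ?f q \<in> lmeasurable" for q
    unfolding U_def using measurable_upper_slope ac_on_imp_continuous_on[OF ac] ac_on_imp_continuous_on[OF ac']
    by blast+
  have mono: "upper_slope a b g q' x" if "upper_slope a b g q x" "q' \<le> q" for g q q' x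
    using that unfolding upper_slope_def by (meson le_less_trans)
  have inf: "negligible (\<Inter>n. U g (real n))" if "ac_on a b g" "\<And>q. U g q \<in> lmeasurable" for g
  proof (rule negligible_if_infinite_slope[OF that(1)])
    show "(\<Inter>n. U g (real n)) \<in> lmeasurable"
      using that(2) by (intro fmeasurable_INT) auto
    show "(\<Inter>n. U g (real n)) \<subseteq> {a<..<b}" by (auto simp: U_def)
    fix x q assume x: "x \<in> (\<Inter>n. U g (real n))"
    obtain n where "q \<le> real n" using real_arch_simple by blast
    moreover have "upper_slope a b g (real n) x" using x by (auto simp: U_def)
    ultimately show "slope_le (\<lambda>x. - g x) (- q) x"
      using mono upper_slope_imp_slope_le by blast
  qed
  have two: "negligible (U f q \<inter> U ?f (- p))" if "p < q" for p q
  proof (rule negligible_if_two_slopes[OF ac _ _ that])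
    fix x assume x: "x \<in> U f q \<inter> U ?f (- p)"
    then show "slope_le f p x" using upper_slope_imp_slope_le[of a b ?f "- p" x] by (simp add: U_def)
    show "slope_le ?f (- q) x" using upper_slope_imp_slope_le[of a b f q x] x by (simp add: U_def)
  qed (use mU in \<open>auto simp: U_def intro: fmeasurable.Int\<close>)
  let ?R = "{pq \<in> \<rat> \<times> \<rat>. fst pq < snd pq}"
  have "countable ?R" by (rule countable_subset[of _ "\<rat> \<times> \<rat>"]) (auto intro: countable_SIGMA countable_rat)
  then have "negligible (\<Union>pq\<in>?R. U f (snd pq) \<inter> U ?f (- fst pq))"
    using two by (intro negligible_countable_Union) auto
  then have "negligible ((\<Union>pq\<in>?R. U f (snd pq) \<inter> U ?f (- fst pq)) \<union> ((\<Inter>n. U f (real n)) \<union> (\<Inter>n. U ?f (real n))))"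
    using inf[OF ac mU(1)] inf[OF ac' mU(2)] by (intro negligible_Un)
  moreover have "{x \<in> {a<..<b}. \<nexists>D. (f has_real_derivative D) (at x)} \<subseteq>
      (\<Union>pq\<in>?R. U f (snd pq) \<inter> U ?f (- fst pq)) \<union> ((\<Inter>n. U f (real n)) \<union> (\<Inter>n. U ?f (real n)))"
  proof
    fix x assume "x \<in> {x \<in> {a<..<b}. \<nexists>D. (f has_real_derivative D) (at x)}"
    then have x: "x \<in> {a<..<b}" "\<nexists>D. (f has_real_derivative D) (at x)" by auto
    show "x \<in> (\<Union>pq\<in>?R. U f (snd pq) \<inter> U ?f (- fst pq)) \<union> ((\<Inter>n. U f (real n)) \<union> (\<Inter>n. U ?f (real n)))"
    proof (rule ccontr)
      assume n: "\<not> ?thesis"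
      then obtain n1 n2 where "\<not> upper_slope a b f (real n1) x" "\<not> upper_slope a b ?f (real n2) x"
        using x(1) by (auto simp: U_def)
      moreover have "\<not> (upper_slope a b f q x \<and> upper_slope a b ?f (- p) x)"
        if "p \<in> \<rat>" "q \<in> \<rat>" "p < q" for p q
        using n x(1) that by (auto simp: U_def)
      ultimately show False using differentiable_if_slopes[OF x(1)] x(2) by blast
    qed
  qed
  ultimately show ?thesis by (rule negligible_subset)
qed

lemma ac_on_has_vector_derivative_AE:
  fixes f :: "real \<Rightarrow> complex"
  assumes ac: "ac_on a b f"
  obtains g N where "negligible N" "\<And>x. x \<in> {a..b} - N \<Longrightarrow> (f has_vector_derivative g x) (at x within {a..b})"
proof -
  let ?N = "\<lambda>f. {x \<in> {a<..<b}. \<nexists>D. (f has_real_derivative D) (at x)}"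
  \<comment> \<open>Derivatives of the real and imaginary parts are available at interior points
    only, so both endpoints join the null set.\<close>
  define N where "N = ?N (\<lambda>x. Re (f x)) \<union> ?N (\<lambda>x. Im (f x)) \<union> {a, b}"
  have "negligible N"
    unfolding N_def using ac_on_bounded_linear_image[OF ac bounded_linear_Re]
      ac_on_bounded_linear_image[OF ac bounded_linear_Im]
    by (intro negligible_Un ac_on_real_differentiable_AE) auto
  moreover have "\<exists>D. (f has_vector_derivative D) (at x within {a..b})" if "x \<in> {a..b} - N" for x
  proof -
    have "x \<in> {a<..<b}" using that by (auto simp: N_def)
    then have "\<exists>D. ((\<lambda>x. Re (f x)) has_real_derivative D) (at x)"
      and "\<exists>D. ((\<lambda>x. Im (f x)) has_real_derivative D) (at x)"
      using that by (auto simp: N_def)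
    then obtain D1 D2 where D: "((\<lambda>x. Re (f x)) has_real_derivative D1) (at x)"
        "((\<lambda>x. Im (f x)) has_real_derivative D2) (at x)"
      by blast
    have "(f has_vector_derivative Complex D1 D2) (at x)"
      unfolding has_vector_derivative_complex_iff using D by simp
    then show ?thesis using has_vector_derivative_at_within by blast
  qed
  ultimately show thesis using that by metis
qed

text \<open>The gauge forces intervals tagged in \<open>N\<close> into an open set of small measure, where the increments
  are controlled by absolute continuity; elsewhere differentiability suffices.\<close>

lemma ac_on_has_integral:
  fixes f g :: "real \<Rightarrow> 'a::banach"
  assumes ac: "ac_on a b f" and "a \<le> b" and N: "negligible N"
    and deriv: "\<And>x. x \<in> {a..b} - N \<Longrightarrow> (f has_vector_derivative g x) (at x within {a..b})"
  shows "(g has_integral (f b - f a)) {a..b}"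
proof -
  \<comment> \<open>Setting the integrand to 0 on \<open>N\<close> leaves only the increments of
    \<open>f\<close> to be estimated over the intervals tagged in \<open>N\<close>.\<close>
  define g' where "g' x = (if x \<in> N then 0 else g x)" for x
  have "(g' has_integral (f b - f a)) {a..b}"
    unfolding has_integral_real
  proof (intro allI impI)
    fix e :: real assume "e > 0"
    define e1 where "e1 = e / (2 * (b - a + 1))"
    have "e1 > 0" using \<open>e > 0\<close> \<open>a \<le> b\<close> by (simp add: e1_def)
    have e1: "e1 * (b - a) < e / 2"
    proof -
      have "e1 * (b - a) < e1 * (b - a + 1)" using \<open>e1 > 0\<close> by simp
      also have "\<dots> = e / 2" using \<open>a \<le> b\<close> by (simp add: e1_def divide_simps)
      finally show ?thesis .
    qed
    obtain \<delta> where \<delta>: "\<delta> > 0" "\<And>\<D> S. \<D> division_of S \<Longrightarrow> S \<subseteq> {a..b} \<Longrightarrow> sum content \<D> < \<delta> \<Longrightarrow>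
      (\<Sum>K\<in>\<D>. norm (increment f K)) < e / 2"
      using ac_onD[OF ac, of "e / 2"] \<open>e > 0\<close> by (metis half_gt_zero)
    have N0: "N \<in> lmeasurable" "measure lebesgue N = 0" using N by (auto simp: negligible_iff_measure)
    obtain G where G: "open G" "N \<subseteq> G" "G - N \<in> lmeasurable" "emeasure lebesgue (G - N) < ennreal \<delta>"
      using sets_lebesgue_outer_open[OF fmeasurableD[OF N0(1)] \<delta>(1)] by blast
    have Gm: "G \<in> lmeasurable"
      using fmeasurable.Un[OF G(3) N0(1)] G(2) by (simp add: Un_absorb2)
    have "measure lebesgue (G - N) < \<delta>" using G(3,4) \<delta>(1) by (simp add: emeasure_eq_measure2 ennreal_less_iff)
    then have mG: "measure lebesgue G < \<delta>" using measure_le_diff_Un[OF Gm N0(1)] N0(2) by simp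
    have "\<exists>r>0. \<forall>y\<in>{a..b}. \<bar>y - x\<bar> < r \<longrightarrow> norm (f y - f x - (y - x) *\<^sub>R g x) \<le> e1 * \<bar>y - x\<bar>"
      if "x \<in> {a..b} - N" for x
      using deriv[OF that] \<open>e1 > 0\<close> unfolding has_vector_derivative_def has_derivative_within_alt
      by (auto simp: real_norm_def)
    then obtain r where r: "\<And>x. x \<in> {a..b} - N \<Longrightarrow> r x > 0"
      "\<And>x y. x \<in> {a..b} - N \<Longrightarrow> y \<in> {a..b} \<Longrightarrow> \<bar>y - x\<bar> < r x \<Longrightarrow> norm (f y - f x - (y - x) *\<^sub>R g x) \<le> e1 * \<bar>y - x\<bar>"
      by metis
    define \<gamma> where "\<gamma> x = (if x \<in> N then G else if x \<in> {a..b} then ball x (r x) else ball x 1)" for x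
    have "gauge \<gamma>" using G(1,2) r(1) by (auto simp: gauge_def \<gamma>_def)
    moreover have "norm ((\<Sum>(x, k)\<in>p. content k *\<^sub>R g' x) - (f b - f a)) < e"
      if p: "p tagged_division_of {a..b}" "\<gamma> fine p" for p
    proof -
      define P where "P = {xK \<in> p. fst xK \<in> N}"
      have Pp: "P \<subseteq> p" by (auto simp: P_def)
      have fin: "finite p" using p(1) by blast
      have Ptag: "P tagged_division_of \<Union>(snd ` P)"
        by (rule tagged_partial_division_of_Union_self, rule tagged_partial_division_subset[OF _ Pp])
          (use p(1) in \<open>auto simp: tagged_division_of_def\<close>)
      note Pdiv = division_of_tagged_division[OF Ptag]
      have sub: "\<Union>(snd ` P) \<subseteq> G \<inter> {a..b}"
      proof
        fix x assume "x \<in> \<Union>(snd ` P)"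
        then obtain y K where K: "(y, K) \<in> p" "y \<in> N" "x \<in> K" by (auto simp: P_def)
        then have "K \<subseteq> \<gamma> y" "K \<subseteq> {a..b}" using p unfolding fine_def by blast+
        then show "x \<in> G \<inter> {a..b}" using K by (auto simp: \<gamma>_def)
      qed
      \<comment> \<open>Passing from tagged pairs to distinct intervals requires a summand that
        vanishes on degenerate intervals, the empty set included, on which \<open>increment\<close>
        depends on unspecified values of \<open>Sup\<close> and \<open>Inf\<close>.\<close>
      define d where "d K = (if K = {} then 0 else norm (increment f K))" for K
      have "(\<Sum>(x, K)\<in>P. d K) = sum d (snd ` P)"
        by (rule sum.over_tagged_division_lemma[OF Ptag]) (auto simp: d_def increment_def)
      moreover have "(\<Sum>(x, K)\<in>P. d K) = (\<Sum>(x, K)\<in>P. norm (increment f K))"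
        by (rule sum.cong) (use Pp p(1) in \<open>auto simp: d_def\<close>)
      moreover have "sum d (snd ` P) = (\<Sum>K\<in>snd ` P. norm (increment f K))"
        by (rule sum.cong) (use division_ofD(3)[OF Pdiv] in \<open>auto simp: d_def\<close>)
      moreover have "(\<Sum>K\<in>snd ` P. norm (increment f K)) < e / 2"
      proof (rule \<delta>(2)[OF Pdiv])
        have "sum content (snd ` P) = measure lebesgue (\<Union>(snd ` P))"
          using content_division[OF Pdiv] by (metis (no_types, lifting) sum.cong division_ofD(4)[OF Pdiv] measure_completion lmeasurable_cbox measure_lborel_cbox_eq sets_lborel borel_closed closed_cbox)
        also have "\<dots> \<le> measure lebesgue G"
          using sub lmeasurable_division[OF Pdiv] Gm by (intro measure_mono_fmeasurable) (auto intro: fmeasurableD)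
        finally show "sum content (snd ` P) < \<delta>" using mG by simp
      qed (use sub in auto)
      ultimately have partN: "(\<Sum>(x, K)\<in>P. norm (increment f K)) < e / 2" by simp
      have off: "norm (content K *\<^sub>R g' x - increment f K) \<le> e1 * content K" if "(x, K) \<in> p - P" for x K
      proof -
        have xK: "(x, K) \<in> p" "x \<notin> N" using that by (auto simp: P_def)
        have K: "x \<in> K" "K \<subseteq> {a..b}" "\<exists>a b. K = cbox a b" using tagged_division_ofD(2-4)[OF p(1) xK(1)] by blast+
        then obtain u v where uv: "K = {u..v}" by auto
        then have "u \<le> x" "x \<le> v" "u \<in> {a..b}" "v \<in> {a..b}" using K by auto
        have x: "x \<in> {a..b} - N" using K xK by auto
        have "K \<subseteq> ball x (r x)" using p(2) xK x unfolding fine_def \<gamma>_def by fastforce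
        then have "u \<in> ball x (r x)" "v \<in> ball x (r x)"
          using subsetD[of K "ball x (r x)"] uv \<open>u \<le> x\<close> \<open>x \<le> v\<close> by simp_all
        then have "norm (f u - f x - (u - x) *\<^sub>R g x) \<le> e1 * \<bar>u - x\<bar>" "norm (f v - f x - (v - x) *\<^sub>R g x) \<le> e1 * \<bar>v - x\<bar>"
          using r(2)[OF x] \<open>u \<in> {a..b}\<close> \<open>v \<in> {a..b}\<close> by (auto simp: dist_real_def abs_minus_commute)
        \<comment> \<open>The interval is split at its tag \<open>x\<close>, since the
          differentiability estimate compares values of \<open>f\<close> with the one at
          \<open>x\<close>.\<close>
        moreover have "content K *\<^sub>R g' x - increment f K =
            (f u - f x - (u - x) *\<^sub>R g x) - (f v - f x - (v - x) *\<^sub>R g x)"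
          using uv \<open>u \<le> x\<close> \<open>x \<le> v\<close> xK(2) by (simp add: g'_def increment_def algebra_simps)
        ultimately have "norm (content K *\<^sub>R g' x - increment f K) \<le> e1 * \<bar>u - x\<bar> + e1 * \<bar>v - x\<bar>"
          by (simp only: order_trans[OF norm_triangle_ineq4 add_mono])
        also have "\<dots> = e1 * content K" using uv \<open>u \<le> x\<close> \<open>x \<le> v\<close> by (simp add: algebra_simps)
        finally show ?thesis .
      qed
      have "(\<Sum>(x, K)\<in>p. content K *\<^sub>R g' x) - (f b - f a) = (\<Sum>(x, K)\<in>p. content K *\<^sub>R g' x - increment f K)"
        using additive_tagged_division_1[OF \<open>a \<le> b\<close> p(1), of f]
        by (simp add: case_prod_beta sum_subtractf increment_def)
      also have "norm \<dots> \<le> (\<Sum>(x, K)\<in>p. norm (content K *\<^sub>R g' x - increment f K))"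
        by (rule order_trans[OF norm_sum]) (simp add: case_prod_beta)
      also have "\<dots> = (\<Sum>(x, K)\<in>p - P. norm (content K *\<^sub>R g' x - increment f K)) + (\<Sum>(x, K)\<in>P. norm (content K *\<^sub>R g' x - increment f K))"
        by (rule sum.subset_diff[OF Pp fin])
      also have "(\<Sum>(x, K)\<in>P. norm (content K *\<^sub>R g' x - increment f K)) = (\<Sum>(x, K)\<in>P. norm (increment f K))"
        by (rule sum.cong) (auto simp: P_def g'_def)
      also have "(\<Sum>(x, K)\<in>p - P. norm (content K *\<^sub>R g' x - increment f K)) \<le> (\<Sum>(x, K)\<in>p - P. e1 * content K)"
        by (rule sum_mono) (use off in auto)
      also have "\<dots> \<le> (\<Sum>(x, K)\<in>p. e1 * content K)"
        by (rule sum_mono2) (use fin \<open>e1 > 0\<close> in \<open>auto simp: case_prod_beta\<close>)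
      also have "\<dots> = e1 * (b - a)"
        using additive_content_tagged_division[of p a b] p(1) \<open>a \<le> b\<close>
        by (simp add: case_prod_beta sum_distrib_left[symmetric])
      finally show ?thesis using partN e1 by simp
    qed
    ultimately show "\<exists>\<gamma>. gauge \<gamma> \<and> (\<forall>p. p tagged_division_of {a..b} \<and> \<gamma> fine p \<longrightarrow>
        norm ((\<Sum>(x, k)\<in>p. content k *\<^sub>R g' x) - (f b - f a)) < e)"
      by (intro exI[of _ \<gamma>]) simp
  qed
  note int = this
  have "g x = g' x" if "x \<in> {a..b} - N" for x
    using that by (simp add: g'_def)
  from has_integral_spike[OF N this int] show ?thesis .
qed

section \<open>Indefinite integrals and their derivatives\<close>

text \<open>Henstock's lemma bounds the sums of
  \<open>norm (content k *\<^sub>R h x - integral k h)\<close>, and all the integrals here vanish.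
  So the Riemann sums of the norm of \<open>h\<close> are arbitrarily small and its integral is 0.
  The argument starts from gauge integrability of \<open>h\<close>, which is what is known of the
  derivative when \<open>Lebesgue_differentiation\<close> calls on it.\<close>

lemma negligible_if_integrals_zero:
  fixes h :: "real \<Rightarrow> 'a::euclidean_space"
  assumes "a \<le> b" and zero: "\<And>t. t \<in> {a..b} \<Longrightarrow> (h has_integral 0) {a..t}"
  shows "negligible {x \<in> {a..b}. h x \<noteq> 0}"
proof -
  have hint: "h integrable_on {a..b}" using zero[of b] assms(1) by auto
  have sub: "integral {c..d} h = 0" if "a \<le> c" "c \<le> d" "d \<le> b" for c d
  proof -
    have "h integrable_on {a..d}" using zero[of d] that by auto
    then have "integral {a..c} h + integral {c..d} h = integral {a..d} h"
      using Henstock_Kurzweil_Integration.integral_combine[of a c d h] that by simp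
    then show ?thesis using integral_unique[OF zero[of c]] integral_unique[OF zero[of d]] that by simp
  qed
  have "((\<lambda>x. norm (h x)) has_integral 0) {a..b}"
    unfolding has_integral_real
  proof (intro allI impI)
    fix e :: real assume "e > 0"
    obtain \<gamma> where \<gamma>: "gauge \<gamma>" "\<And>p. p tagged_partial_division_of (cbox a b) \<Longrightarrow> \<gamma> fine p \<Longrightarrow>
        (\<Sum>(x, k)\<in>p. norm (content k *\<^sub>R h x - integral k h)) < e"
      using Henstock_lemma[of h a b e] hint \<open>e > 0\<close> by auto
    have "norm ((\<Sum>(x, k)\<in>p. content k *\<^sub>R norm (h x)) - 0) < e"
      if p: "p tagged_division_of {a..b}" "\<gamma> fine p" for p
    proof -
      have "(\<Sum>(x, k)\<in>p. content k *\<^sub>R norm (h x)) = (\<Sum>(x, k)\<in>p. norm (content k *\<^sub>R h x - integral k h))"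
      proof (rule sum.cong)
        fix y assume "y \<in> p"
        then obtain x k where y: "y = (x, k)" "(x, k) \<in> p" by (metis surj_pair)
        then obtain u v where "k = {u..v}" "k \<noteq> {}" "k \<subseteq> {a..b}"
          using tagged_division_ofD(2-4)[OF p(1) y(2)] by (metis cbox_interval empty_iff)
        then have "integral k h = 0" using sub[of u v] by auto
        then show "(case y of (x, k) \<Rightarrow> content k *\<^sub>R norm (h x)) =
            (case y of (x, k) \<Rightarrow> norm (content k *\<^sub>R h x - integral k h))"
          using y by simp
      qed simp
      also have "\<dots> < e"
        by (rule \<gamma>(2)) (use p in \<open>auto simp: tagged_division_of_def\<close>)
      finally show ?thesis
        by (simp add: abs_of_nonneg sum_nonneg case_prod_beta)
    qed
    with \<gamma>(1) show "\<exists>\<gamma>. gauge \<gamma> \<and> (\<forall>p. p tagged_division_of {a..b} \<and> \<gamma> fine p \<longrightarrow>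
        norm ((\<Sum>(x, k)\<in>p. content k *\<^sub>R norm (h x)) - 0) < e)"
      by (intro exI[of _ \<gamma>]) simp
  qed
  then have I: "(\<lambda>x. norm (h x)) integrable_on {a..b}" "integral {a..b} (\<lambda>x. norm (h x)) = 0"
    by (auto simp: integral_unique)
  then have abs: "(\<lambda>x. norm (h x)) absolutely_integrable_on {a..b}"
    by (intro nonnegative_absolutely_integrable_1) auto
  then have "(LINT x:{a..b}|lebesgue. norm (h x)) = 0"
    using set_lebesgue_integral_eq_integral(2) I(2) by metis
  then have "AE x in lebesgue. indicator {a..b} x *\<^sub>R norm (h x) = 0"
    using abs unfolding set_lebesgue_integral_def set_integrable_def
    by (subst (asm) integral_nonneg_eq_0_iff_AE) auto
  then have "{x. \<not> indicator {a..b} x *\<^sub>R norm (h x) = 0} \<in> null_sets lebesgue"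
    by (simp add: completion.AE_iff_null_sets)
  moreover have "{x. \<not> indicator {a..b} x *\<^sub>R norm (h x) = 0} = {x \<in> {a..b}. h x \<noteq> 0}"
    by (auto simp: indicator_def)
  ultimately show ?thesis by (simp add: negligible_iff_null_sets)
qed

text \<open>Truncation at height \<open>n\<close>: by dominated convergence the excess of
  \<open>h\<close> over the truncated function has integral below \<open>\<epsilon> / 2\<close>, and
  the truncated function contributes at most \<open>n\<close> times the total length.\<close>

lemma integral_nonneg_small_division:
  fixes h :: "real \<Rightarrow> real"
  assumes h: "h integrable_on {a..b}" and nonneg: "\<And>x. x \<in> {a..b} \<Longrightarrow> 0 \<le> h x" and \<epsilon>: "\<epsilon> > 0"
  obtains \<delta> where "\<delta> > 0" "\<And>\<D> S. \<D> division_of S \<Longrightarrow> S \<subseteq> {a..b} \<Longrightarrow> sum content \<D> < \<delta> \<Longrightarrow>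
    (\<Sum>K\<in>\<D>. integral K h) < \<epsilon>"
proof -
  have abs: "h absolutely_integrable_on {a..b}"
    using h nonneg by (rule nonnegative_absolutely_integrable_1)
  define m where "m n x = min (h x) (real n)" for n :: nat and x
  have mint: "m n integrable_on {a..b}" for n
  proof -
    have "m n absolutely_integrable_on {a..b}"
      unfolding m_def by (intro absolutely_integrable_min_1[OF abs]) auto
    then show ?thesis using set_lebesgue_integral_eq_integral(1) by blast
  qed
  have "(\<lambda>n. integral {a..b} (m n)) \<longlonglongrightarrow> integral {a..b} h"
  proof (rule dominated_convergence(2)[OF mint h])
    show "norm (m n x) \<le> h x" if "x \<in> {a..b}" for n x
      using nonneg[OF that] by (auto simp: m_def)
    show "(\<lambda>n. m n x) \<longlonglongrightarrow> h x" if "x \<in> {a..b}" for x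
    proof (rule tendsto_eventually)
      obtain N where "h x \<le> real N" using real_arch_simple by blast
      then have "m n x = h x" if "n \<ge> N" for n using that by (simp add: m_def)
      then show "\<forall>\<^sub>F n in sequentially. m n x = h x" by (auto simp: eventually_sequentially)
    qed
  qed
  then obtain n where "dist (integral {a..b} (m n)) (integral {a..b} h) < \<epsilon> / 2"
    using \<epsilon> by (metis (no_types, lifting) half_gt_zero lim_sequentially order_refl)
  then have n: "integral {a..b} h - integral {a..b} (m n) < \<epsilon> / 2" unfolding dist_real_def by linarith
  define \<delta> where "\<delta> = \<epsilon> / (2 * (real n + 1))"
  have "\<delta> > 0" using \<epsilon> by (simp add: \<delta>_def)
  have n\<delta>: "real n * \<delta> \<le> \<epsilon> / 2"
  proof -
    have "real n * \<delta> \<le> (real n + 1) * \<delta>" using \<open>\<delta> > 0\<close> by simp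
    also have "\<dots> = \<epsilon> / 2" by (simp add: \<delta>_def divide_simps)
    finally show ?thesis .
  qed
  have "(\<Sum>K\<in>\<D>. integral K h) < \<epsilon>"
    if D: "\<D> division_of S" "S \<subseteq> {a..b}" "sum content \<D> < \<delta>" for \<D> S
  proof -
    have int: "h integrable_on S" "m n integrable_on S"
      using integrable_on_subdivision[OF D(1) h D(2)] integrable_on_subdivision[OF D(1) mint D(2)] by auto
    have "(\<Sum>K\<in>\<D>. integral K h) = integral S h"
      by (rule integral_combine_division_topdown[OF int(1) D(1), symmetric])
    also have "\<dots> = integral S (\<lambda>x. h x - m n x) + integral S (m n)"
      using integral_diff[OF int] by simp
    also have "integral S (\<lambda>x. h x - m n x) \<le> integral {a..b} (\<lambda>x. h x - m n x)"
      by (rule integral_subset_le[OF D(2) integrable_diff[OF int] integrable_diff[OF h mint]])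
        (auto simp: m_def)
    also have "integral {a..b} (\<lambda>x. h x - m n x) < \<epsilon> / 2"
      using n integral_diff[OF h mint, of n] by simp
    also have "integral S (m n) = (\<Sum>K\<in>\<D>. integral K (m n))"
      by (rule integral_combine_division_topdown[OF int(2) D(1)])
    also have "\<dots> \<le> (\<Sum>K\<in>\<D>. real n * content K)"
    proof (rule sum_mono)
      fix K assume K: "K \<in> \<D>"
      note iv = division_interval[OF D(1) K]
      have "m n integrable_on {Inf K..Sup K}"
        by (rule integrable_on_subinterval[OF mint]) (use iv D(2) in auto)
      then have "integral {Inf K..Sup K} (m n) \<le> integral {Inf K..Sup K} (\<lambda>x. real n)"
        by (intro integral_le) (auto simp: m_def)
      then show "integral K (m n) \<le> real n * content K"
        using iv(1,2) by (metis content_real integral_const_real mult.commute real_scaleR_def)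
    qed
    also have "\<dots> = real n * sum content \<D>" by (simp add: sum_distrib_left)
    also have "\<dots> \<le> real n * \<delta>" using D(3) by (intro mult_left_mono) auto
    finally show ?thesis using n\<delta> by simp
  qed
  with \<open>\<delta> > 0\<close> show thesis using that by blast
qed

text \<open>The increments are integrals of \<open>g\<close> over the intervals of the division,
  bounded by those of its norm, to which \<open>integral_nonneg_small_division\<close>
  applies.\<close>

lemma ac_on_integral:
  fixes g :: "real \<Rightarrow> 'a::euclidean_space"
  assumes g: "g absolutely_integrable_on {a..b}"
  shows "ac_on a b (\<lambda>t. integral {a..t} g)"
  unfolding ac_on_def
proof (intro allI impI)
  fix \<epsilon> :: real assume "\<epsilon> > 0"
  have gi: "g integrable_on {a..b}" "(\<lambda>x. norm (g x)) integrable_on {a..b}"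
    using g by (auto simp: absolutely_integrable_on_def)
  obtain \<delta> where \<delta>: "\<delta> > 0" "\<And>\<D> S. \<D> division_of S \<Longrightarrow> S \<subseteq> {a..b} \<Longrightarrow> sum content \<D> < \<delta> \<Longrightarrow>
    (\<Sum>K\<in>\<D>. integral K (\<lambda>x. norm (g x))) < \<epsilon>"
    by (rule integral_nonneg_small_division[OF gi(2) _ \<open>\<epsilon> > 0\<close>]) auto
  have "(\<Sum>K\<in>\<D>. norm (increment (\<lambda>t. integral {a..t} g) K)) < \<epsilon>"
    if D: "\<D> division_of S" "S \<subseteq> {a..b}" "sum content \<D> < \<delta>" for \<D> S
  proof -
    have "norm (increment (\<lambda>t. integral {a..t} g) K) \<le> integral K (\<lambda>x. norm (g x))" if K: "K \<in> \<D>" for K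
    proof -
      note iv = division_interval[OF D(1) K]
      have ab: "Inf K \<in> {a..b}" "Sup K \<in> {a..b}" using iv D(2) by auto
      have gK: "g integrable_on {a..Sup K}" "g integrable_on {Inf K..Sup K}"
          "(\<lambda>x. norm (g x)) integrable_on {Inf K..Sup K}"
        using ab gi by (auto intro: integrable_on_subinterval)
      then have "integral {a..Inf K} g + integral {Inf K..Sup K} g = integral {a..Sup K} g"
        using Henstock_Kurzweil_Integration.integral_combine[of a "Inf K" "Sup K" g] iv(1) ab by simp
      then have "increment (\<lambda>t. integral {a..t} g) K = integral {Inf K..Sup K} g"
        by (simp add: increment_def algebra_simps)
      moreover have "norm (integral {Inf K..Sup K} g) \<le> integral {Inf K..Sup K} (\<lambda>x. norm (g x))"
        by (rule integral_norm_bound_integral) (use gK in auto)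
      ultimately have "norm (increment (\<lambda>t. integral {a..t} g) K) \<le> integral {Inf K..Sup K} (\<lambda>x. norm (g x))"
        by simp
      then show ?thesis using iv(2) by simp
    qed
    then have "(\<Sum>K\<in>\<D>. norm (increment (\<lambda>t. integral {a..t} g) K)) \<le> (\<Sum>K\<in>\<D>. integral K (\<lambda>x. norm (g x)))"
      by (rule sum_mono)
    also have "\<dots> < \<epsilon>" by (rule \<delta>(2)[OF D])
    finally show ?thesis .
  qed
  with \<delta>(1) show "\<exists>\<delta>>0. \<forall>\<D> S. \<D> division_of S \<and> S \<subseteq> {a..b} \<and> sum content \<D> < \<delta> \<longrightarrow>
     (\<Sum>K\<in>\<D>. norm (increment (\<lambda>t. integral {a..t} g) K)) < \<epsilon>" by blast
qed

text \<open>The indefinite integral is absolutely continuous, so it has a derivative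
  \<open>h\<close> almost everywhere, and integrating \<open>h\<close> gives it back. Thus
  \<open>h\<close> and \<open>g\<close> have the same integral over every \<open>{a..t}\<close> and
  agree almost everywhere.\<close>

lemma Lebesgue_differentiation:
  fixes g :: "real \<Rightarrow> complex"
  assumes g: "g absolutely_integrable_on {a..b}" and "a \<le> b"
  obtains N where "negligible N"
    "\<And>x. x \<in> {a..b} - N \<Longrightarrow> ((\<lambda>t. integral {a..t} g) has_vector_derivative g x) (at x within {a..b})"
proof -
  let ?F = "\<lambda>t. integral {a..t} g"
  note ac = ac_on_integral[OF g]
  obtain h N where N: "negligible N"
    and h: "\<And>x. x \<in> {a..b} - N \<Longrightarrow> (?F has_vector_derivative h x) (at x within {a..b})"
    by (rule ac_on_has_vector_derivative_AE[OF ac]) (rule that)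
  have "((\<lambda>x. h x - g x) has_integral 0) {a..t}" if t: "t \<in> {a..b}" for t
  proof -
    have "ac_on a t ?F" by (rule ac_on_subset[OF ac]) (use t in auto)
    then have hF: "(h has_integral (?F t - ?F a)) {a..t}"
    proof (rule ac_on_has_integral[OF _ _ N])
      fix x assume "x \<in> {a..t} - N"
      then have "x \<in> {a..b} - N" using t by auto
      then show "(?F has_vector_derivative h x) (at x within {a..t})"
        by (rule has_vector_derivative_within_subset[OF h]) (use t in auto)
    qed (use t in auto)
    have gF: "(g has_integral ?F t) {a..t}"
      using g t by (intro integrable_integral) (auto simp: absolutely_integrable_on_def intro: integrable_on_subinterval)
    show ?thesis using has_integral_diff[OF hF gF] by simp
  qed
  from negligible_if_integrals_zero[OF \<open>a \<le> b\<close> this]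
  have "negligible (N \<union> {x \<in> {a..b}. h x - g x \<noteq> 0})" by (rule negligible_Un[OF N])
  moreover have "(?F has_vector_derivative g x) (at x within {a..b})"
    if "x \<in> {a..b} - (N \<union> {x \<in> {a..b}. h x - g x \<noteq> 0})" for x
    using h[of x] that by auto
  ultimately show thesis using that by blast
qed

section \<open>The spaces \<open>L\<^sub>p\<close> and \<open>W\<^sub>p\<^sup>l\<close>\<close>

lemma measurable_lebesgue_on_spike:
  fixes f g :: "real \<Rightarrow> complex"
  assumes f: "f \<in> borel_measurable (lebesgue_on {a..b})" and N: "negligible N"
    and eq: "\<And>t. t \<in> {a..b} - N \<Longrightarrow> f t = g t"
  shows "g \<in> borel_measurable (lebesgue_on {a..b})"
proof -
  have "AE t in lebesgue. t \<notin> N"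
    using N by (simp add: negligible_iff_null_sets AE_not_in)
  then have ae: "AE t in lebesgue. (if t \<in> {a..b} then f t else 0) = (if t \<in> {a..b} then g t else 0)"
    by (rule eventually_mono) (use eq in auto)
  have iff: "(\<lambda>t. if t \<in> {a..b} then h t else 0) \<in> borel_measurable lebesgue \<longleftrightarrow>
      h \<in> borel_measurable (lebesgue_on {a..b})" for h :: "real \<Rightarrow> complex"
    by (rule borel_measurable_if) simp
  have "(\<lambda>t. if t \<in> {a..b} then f t else 0) \<in> borel_measurable lebesgue"
    unfolding iff by (rule f)
  from borel_measurable_AE[OF this ae] show ?thesis unfolding iff .
qed

lemma in_Lp_infinity_iff:
  "in_Lp a b \<infinity> f \<longleftrightarrow> f \<in> borel_measurable (lebesgue_on {a..b}) \<and> (\<exists>C::real. AE t in lebesgue_on {a..b}. cmod (f t) \<le> C)"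
proof -
  let ?M = "lebesgue_on {a..b}"
  have "esssup ?M (\<lambda>t. ereal (cmod (f t))) < \<infinity> \<longleftrightarrow> (\<exists>C::real. AE t in ?M. cmod (f t) \<le> C)"
    if f: "f \<in> borel_measurable ?M"
  proof
    assume "esssup ?M (\<lambda>t. ereal (cmod (f t))) < \<infinity>"
    then obtain C :: real where C: "esssup ?M (\<lambda>t. ereal (cmod (f t))) \<le> ereal C"
      by (metis less_ereal.simps(4) less_imp_le ereal_less_eq(1) ereal_dense2 less_PInf_Ex_of_nat)
    have "AE t in ?M. cmod (f t) \<le> C"
      using esssup_AE[where M = ?M and f = "\<lambda>t. ereal (cmod (f t))"] by (rule eventually_mono) (use C in \<open>force dest: order_trans\<close>)
    then show "\<exists>C::real. AE t in ?M. cmod (f t) \<le> C" by blast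
  next
    assume "\<exists>C::real. AE t in ?M. cmod (f t) \<le> C"
    then obtain C :: real where C: "AE t in ?M. cmod (f t) \<le> C" by blast
    have "esssup ?M (\<lambda>t. ereal (cmod (f t))) \<le> ereal C"
      using f C by (intro esssup_I) auto
    then show "esssup ?M (\<lambda>t. ereal (cmod (f t))) < \<infinity>" using le_less_trans by fastforce
  qed
  then show ?thesis by (auto simp: in_Lp_def)
qed

text \<open>A substitute for Minkowski's inequality where only membership matters. Two dominating
  functions cover sums, the constant covers bounded factors, and the almost everywhere bound covers
  changes on null sets.\<close>

lemma in_Lp_dominated:
  assumes p: "1 \<le> p" and f: "in_Lp a b p f1" "in_Lp a b p f2"
    and g: "g \<in> borel_measurable (lebesgue_on {a..b})" and "C \<ge> 0"
    and le: "AE t in lebesgue_on {a..b}. cmod (g t) \<le> C * (cmod (f1 t) + cmod (f2 t))"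
  shows "in_Lp a b p g"
proof (cases "p = \<infinity>")
  case True
  obtain C1 C2 :: real where "AE t in lebesgue_on {a..b}. cmod (f1 t) \<le> C1" "AE t in lebesgue_on {a..b}. cmod (f2 t) \<le> C2"
    using f unfolding True in_Lp_infinity_iff by blast
  with le have "AE t in lebesgue_on {a..b}. cmod (g t) \<le> C * (C1 + C2)"
  proof eventually_elim
    case (elim t)
    then have "C * (cmod (f1 t) + cmod (f2 t)) \<le> C * (C1 + C2)" using \<open>C \<ge> 0\<close> by (intro mult_left_mono) auto
    then show ?case using elim by simp
  qed
  then show ?thesis using g unfolding True in_Lp_infinity_iff by blast
next
  case False
  define q where "q = real_of_ereal p"
  have q: "q \<ge> 1" using p False by (cases p) (auto simp: q_def one_ereal_def)
  note [measurable] = g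
  have int: "integrable (lebesgue_on {a..b}) (\<lambda>t. cmod (f1 t) powr q)" "integrable (lebesgue_on {a..b}) (\<lambda>t. cmod (f2 t) powr q)"
    using f False by (auto simp: in_Lp_def q_def)
  have "integrable (lebesgue_on {a..b}) (\<lambda>t. (2 * C) powr q * (cmod (f1 t) powr q + cmod (f2 t) powr q))"
    by (intro integrable_mult_right Bochner_Integration.integrable_add int)
  then have "integrable (lebesgue_on {a..b}) (\<lambda>t. cmod (g t) powr q)"
  proof (rule Bochner_Integration.integrable_bound)
    show "(\<lambda>t. cmod (g t) powr q) \<in> borel_measurable (lebesgue_on {a..b})" by measurable
    from le show "AE t in lebesgue_on {a..b}. norm (cmod (g t) powr q) \<le> norm ((2 * C) powr q * (cmod (f1 t) powr q + cmod (f2 t) powr q))"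
    proof eventually_elim
      case (elim t)
      \<comment> \<open>The sum of the moduli is at most \<open>2 * ?m\<close>, and the power of
        \<open>?m\<close> is one of the two given powers; whence the factor
        \<open>(2 * C) powr q\<close>.\<close>
      let ?m = "max (cmod (f1 t)) (cmod (f2 t))"
      have "C * (cmod (f1 t) + cmod (f2 t)) \<le> C * (2 * ?m)"
        using \<open>C \<ge> 0\<close> by (intro mult_left_mono) auto
      then have "cmod (g t) \<le> (2 * C) * ?m" using elim by simp
      then have "cmod (g t) powr q \<le> ((2 * C) * ?m) powr q" using q by (intro powr_mono2) auto
      also have "\<dots> = (2 * C) powr q * ?m powr q" using \<open>C \<ge> 0\<close> by (simp add: powr_mult)
      also have "\<dots> \<le> (2 * C) powr q * (cmod (f1 t) powr q + cmod (f2 t) powr q)"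
        by (intro mult_left_mono) (auto simp: max_def)
      finally show ?case by simp
    qed
  qed
  then show ?thesis using g False by (simp add: in_Lp_def q_def)
qed

lemma in_Lp_spike:
  assumes p: "1 \<le> p" and f: "in_Lp a b p f" and N: "negligible N" and eq: "\<And>t. t \<in> {a..b} - N \<Longrightarrow> f t = g t"
  shows "in_Lp a b p g"
proof (rule in_Lp_dominated[OF p f f, where C = 1])
  show "g \<in> borel_measurable (lebesgue_on {a..b})"
    using f by (intro measurable_lebesgue_on_spike[OF _ N eq]) (auto simp: in_Lp_def)
  have "AE t in lebesgue. t \<notin> N"
    using N by (simp add: negligible_iff_null_sets AE_not_in)
  then show "AE t in lebesgue_on {a..b}. cmod (g t) \<le> 1 * (cmod (f t) + cmod (f t))"
    by (subst AE_restrict_space_iff) (auto elim!: eventually_mono simp: eq[symmetric])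
qed simp

lemma in_Lp_mult_continuous:
  assumes p: "1 \<le> p" and f: "in_Lp a b p f" and h: "continuous_on {a..b} h"
  shows "in_Lp a b p (\<lambda>t. h t * f t)"
proof -
  have "compact (h ` {a..b})" by (rule compact_continuous_image[OF h]) simp
  then obtain C where C: "C > 0" "\<And>t. t \<in> {a..b} \<Longrightarrow> cmod (h t) \<le> C"
    using compact_imp_bounded bounded_pos by (metis imageI)
  show ?thesis
  proof (rule in_Lp_dominated[OF p f f, where C = C])
    have "h \<in> borel_measurable (lebesgue_on {a..b})"
      by (rule continuous_imp_measurable_on_sets_lebesgue[OF h]) simp
    then show "(\<lambda>t. h t * f t) \<in> borel_measurable (lebesgue_on {a..b})" using f by (auto simp: in_Lp_def)
    show "AE t in lebesgue_on {a..b}. cmod (h t * f t) \<le> C * (cmod (f t) + cmod (f t))"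
    proof (rule AE_I2)
      fix t assume "t \<in> space (lebesgue_on {a..b})"
      then have "cmod (h t) * cmod (f t) \<le> C * (cmod (f t) + cmod (f t))"
        using C by (intro mult_mono) auto
      then show "cmod (h t * f t) \<le> C * (cmod (f t) + cmod (f t))" by (simp add: norm_mult)
    qed
  qed (use C in simp)
qed

lemma in_Lp_add:
  assumes p: "1 \<le> p" and f: "in_Lp a b p f" and g: "in_Lp a b p g"
  shows "in_Lp a b p (\<lambda>t. f t + g t)"
  by (rule in_Lp_dominated[OF p f g, where C = 1])
    (use f g in \<open>auto simp: in_Lp_def intro: norm_triangle_ineq\<close>)

lemma in_Lp_const:
  shows "in_Lp a b p (\<lambda>t. c)"
proof -
  have "finite_measure (lebesgue_on {a..b})" by (rule finite_measure_lebesgue_on) simp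
  moreover have "esssup (lebesgue_on {a..b}) (\<lambda>t. ereal (cmod c)) \<le> ereal (cmod c)"
    by (rule esssup_I) auto
  ultimately show ?thesis
    unfolding in_Lp_def by (auto intro: finite_measure.integrable_const le_less_trans)
qed

lemma in_Lp_continuous:
  assumes "1 \<le> p" "continuous_on {a..b} f"
  shows "in_Lp a b p f"
  using in_Lp_mult_continuous[OF assms(1) in_Lp_const assms(2), of 1] by simp

text \<open>The measure is finite: an essentially bounded function is integrable, and for a finite
  exponent \<open>q \<ge> 1\<close> the modulus is at most
  \<open>1 + cmod (f t) powr q\<close>.\<close>

lemma in_Lp_absolutely_integrable:
  assumes p: "1 \<le> p" and f: "in_Lp a b p f"
  shows "f absolutely_integrable_on {a..b}"
proof -
  have fm: "f \<in> borel_measurable (lebesgue_on {a..b})" using f by (simp add: in_Lp_def)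
  have fin: "finite_measure (lebesgue_on {a..b})" by (rule finite_measure_lebesgue_on) simp
  have "integrable (lebesgue_on {a..b}) f"
  proof (cases "p = \<infinity>")
    case True
    obtain C :: real where "AE t in lebesgue_on {a..b}. cmod (f t) \<le> C"
      using f unfolding True in_Lp_infinity_iff by blast
    then show ?thesis using finite_measure.integrable_const_bound[OF fin _ fm] by blast
  next
    case False
    define q where "q = real_of_ereal p"
    have q: "q \<ge> 1" using p False by (cases p) (auto simp: q_def one_ereal_def)
    have "integrable (lebesgue_on {a..b}) (\<lambda>t. 1 + cmod (f t) powr q)"
      using f False finite_measure.integrable_const[OF fin, of "1::real"]
      by (intro Bochner_Integration.integrable_add) (auto simp: in_Lp_def q_def)
    then show ?thesis
    proof (rule Bochner_Integration.integrable_bound[OF _ fm])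
      show "AE t in lebesgue_on {a..b}. norm (f t) \<le> norm (1 + cmod (f t) powr q)"
      proof (rule AE_I2)
        fix t
        show "norm (f t) \<le> norm (1 + cmod (f t) powr q)"
        proof (cases "cmod (f t) \<le> 1")
          case False
          then have "cmod (f t) powr 1 \<le> cmod (f t) powr q" using q by (intro powr_mono) auto
          then show ?thesis using False by simp
        qed (simp add: add_increasing2)
      qed
    qed
  qed
  then show ?thesis
    unfolding set_integrable_def by (simp add: integrable_restrict_space)
qed

section \<open>Primitives of integrable functions\<close>

text \<open>Integral form of \<open>f\<close> being absolutely continuous with derivative
  \<open>g\<close> almost everywhere. It does not mention pointwise derivatives and is insensitive
  to the values of \<open>g\<close> on a null set.\<close>

definition primitive :: "real \<Rightarrow> real \<Rightarrow> (real \<Rightarrow> complex) \<Rightarrow> (real \<Rightarrow> complex) \<Rightarrow> bool" where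
  "primitive a b f g \<longleftrightarrow> g absolutely_integrable_on {a..b} \<and> (\<forall>t\<in>{a..b}. f t = f a + integral {a..t} g)"

lemma primitiveD: "primitive a b f g \<Longrightarrow> t \<in> {a..b} \<Longrightarrow> f t = f a + integral {a..t} g"
  unfolding primitive_def by blast

lemma primitive_integrable: "primitive a b f g \<Longrightarrow> g absolutely_integrable_on {a..b}"
  unfolding primitive_def by blast

lemma ac_on_cong:
  assumes ac: "ac_on a b f" and eq: "\<And>t. t \<in> {a..b} \<Longrightarrow> g t = f t + c"
  shows "ac_on a b g"
  by (rule ac_on_dominated[OF ac ac, where C = 1]) (simp_all add: eq)

lemma primitive_ac_on:
  assumes "primitive a b f g"
  shows "ac_on a b f"
proof (rule ac_on_cong[OF ac_on_integral[OF primitive_integrable[OF assms]]])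
  show "f t = integral {a..t} g + f a" if "t \<in> {a..b}" for t
    using primitiveD[OF assms that] by simp
qed

lemma primitive_continuous_on: "primitive a b f g \<Longrightarrow> continuous_on {a..b} f"
  by (rule ac_on_imp_continuous_on[OF primitive_ac_on])

lemma primitive_derivative_AE:
  assumes fg: "primitive a b f g" and "a \<le> b"
  obtains N where "negligible N" "\<And>x. x \<in> {a..b} - N \<Longrightarrow> (f has_vector_derivative g x) (at x within {a..b})"
proof -
  obtain N where N: "negligible N"
    "\<And>x. x \<in> {a..b} - N \<Longrightarrow> ((\<lambda>t. integral {a..t} g) has_vector_derivative g x) (at x within {a..b})"
    by (rule Lebesgue_differentiation[OF primitive_integrable[OF fg] \<open>a \<le> b\<close>]) (rule that)
  have "(f has_vector_derivative g x) (at x within {a..b})" if "x \<in> {a..b} - N" for x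
  proof (rule has_vector_derivative_transform[OF _ primitiveD[OF fg]])
    show "((\<lambda>t. f a + integral {a..t} g) has_vector_derivative g x) (at x within {a..b})"
      using has_vector_derivative_add[OF has_vector_derivative_const N(2)[OF that], of "f a"] by simp
  qed (use that in auto)
  with N(1) show thesis by (rule that)
qed

lemma primitive_derivative:
  assumes fg: "primitive a b f g" and g: "continuous_on {a..b} g" and x: "x \<in> {a..b}"
  shows "(f has_vector_derivative g x) (at x within {a..b})"
proof (rule has_vector_derivative_transform[OF _ primitiveD[OF fg]])
  show "((\<lambda>t. f a + integral {a..t} g) has_vector_derivative g x) (at x within {a..b})"
    using has_vector_derivative_add[OF has_vector_derivative_const integral_has_vector_derivative[OF g x], of "f a"]
    by simp
qed (use x in auto)

lemma primitiveI_ac_on: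
  assumes ac: "ac_on a b f" and g: "g absolutely_integrable_on {a..b}" and N: "negligible N"
    and deriv: "\<And>x. x \<in> {a..b} - N \<Longrightarrow> (f has_vector_derivative g x) (at x within {a..b})"
  shows "primitive a b f g"
  unfolding primitive_def
proof (intro conjI ballI)
  fix t assume t: "t \<in> {a..b}"
  have "(g has_integral (f t - f a)) {a..t}"
  proof (rule ac_on_has_integral[OF _ _ N])
    show "ac_on a t f" by (rule ac_on_subset[OF ac]) (use t in auto)
    fix x assume "x \<in> {a..t} - N"
    then have "x \<in> {a..b} - N" using t by auto
    then show "(f has_vector_derivative g x) (at x within {a..t})"
      by (rule has_vector_derivative_within_subset[OF deriv]) (use t in auto)
  qed (use t in auto)
  then show "f t = f a + integral {a..t} g" by (simp add: integral_unique)
qed fact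

lemma primitive_add:
  assumes "primitive a b f1 g1" "primitive a b f2 g2"
  shows "primitive a b (\<lambda>t. f1 t + f2 t) (\<lambda>t. g1 t + g2 t)"
  unfolding primitive_def
proof (intro conjI ballI)
  show "(\<lambda>t. g1 t + g2 t) absolutely_integrable_on {a..b}"
    using assms by (auto simp: primitive_def intro: set_integral_add)
  fix t assume t: "t \<in> {a..b}"
  have "g1 integrable_on {a..t}" "g2 integrable_on {a..t}"
    using primitive_integrable[OF assms(1)] primitive_integrable[OF assms(2)] t
    unfolding absolutely_integrable_on_def by (auto intro: integrable_on_subinterval)
  then show "f1 t + f2 t = f1 a + f2 a + integral {a..t} (\<lambda>t. g1 t + g2 t)"
    using primitiveD[OF assms(1) t] primitiveD[OF assms(2) t]
    by (simp add: Henstock_Kurzweil_Integration.integral_add)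
qed

lemma ac_on_mult:
  fixes f g :: "real \<Rightarrow> 'a::real_normed_algebra"
  assumes f: "ac_on a b f" and g: "ac_on a b g"
  shows "ac_on a b (\<lambda>t. f t * g t)"
proof -
  have "bounded (f ` {a..b} \<union> g ` {a..b})"
    by (intro compact_imp_bounded compact_Un compact_continuous_image ac_on_imp_continuous_on f g) auto
  then obtain C where C: "C > 0" "\<And>x. x \<in> f ` {a..b} \<union> g ` {a..b} \<Longrightarrow> norm x \<le> C"
    unfolding bounded_pos by blast
  show ?thesis
  proof (rule ac_on_dominated[OF f g C(1)])
    fix x y assume xy: "x \<in> {a..b}" "y \<in> {a..b}"
    have "f x * g x - f y * g y = (f x - f y) * g x + f y * (g x - g y)" by (simp add: algebra_simps)
    also have "norm \<dots> \<le> norm (f x - f y) * norm (g x) + norm (f y) * norm (g x - g y)"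
      by (rule order_trans[OF norm_triangle_ineq add_mono[OF norm_mult_ineq norm_mult_ineq]])
    also have "\<dots> \<le> norm (f x - f y) * C + C * norm (g x - g y)"
      using C(2) xy by (intro add_mono mult_left_mono mult_right_mono) auto
    finally show "norm (f x * g x - f y * g y) \<le> C * (norm (f x - f y) + norm (g x - g y))"
      by (simp add: algebra_simps)
  qed
qed

lemma absolutely_integrable_mult_continuous:
  fixes f g :: "real \<Rightarrow> 'a::{euclidean_space,real_normed_algebra}"
  assumes f: "continuous_on {a..b} f" and g: "g absolutely_integrable_on {a..b}"
  shows "(\<lambda>t. f t * g t) absolutely_integrable_on {a..b}"
proof (rule absolutely_integrable_bounded_measurable_product[where h = "(*)", OF _ _ _ _ g])
  show "bilinear ((*) :: 'a \<Rightarrow> 'a \<Rightarrow> 'a)"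
    using bilinear_conv_bounded_bilinear bounded_bilinear_mult by metis
  show "f \<in> borel_measurable (lebesgue_on {a..b})"
    by (rule continuous_imp_measurable_on_sets_lebesgue[OF f]) simp
  show "bounded (f ` {a..b})"
    by (intro compact_imp_bounded compact_continuous_image f) simp
qed simp

text \<open>The product is absolutely continuous and obeys the product rule off the union of two
  null sets, which suffices for the fundamental theorem.\<close>

lemma primitive_mult:
  assumes f: "primitive a b f f'" and g: "primitive a b g g'" and "a \<le> b"
  shows "primitive a b (\<lambda>t. f t * g t) (\<lambda>t. f t * g' t + f' t * g t)"
proof -
  obtain N1 where N1: "negligible N1" "\<And>x. x \<in> {a..b} - N1 \<Longrightarrow> (f has_vector_derivative f' x) (at x within {a..b})"
    by (rule primitive_derivative_AE[OF f \<open>a \<le> b\<close>]) (rule that)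
  obtain N2 where N2: "negligible N2" "\<And>x. x \<in> {a..b} - N2 \<Longrightarrow> (g has_vector_derivative g' x) (at x within {a..b})"
    by (rule primitive_derivative_AE[OF g \<open>a \<le> b\<close>]) (rule that)
  show ?thesis
  proof (rule primitiveI_ac_on[OF ac_on_mult[OF primitive_ac_on[OF f] primitive_ac_on[OF g]] _ negligible_Un[OF N1(1) N2(1)]])
    have "(\<lambda>t. f t * g' t) absolutely_integrable_on {a..b}" "(\<lambda>t. g t * f' t) absolutely_integrable_on {a..b}"
      by (intro absolutely_integrable_mult_continuous primitive_integrable[OF f] primitive_integrable[OF g]
          primitive_continuous_on[OF f] primitive_continuous_on[OF g])+
    then show "(\<lambda>t. f t * g' t + f' t * g t) absolutely_integrable_on {a..b}"
      by (auto simp: mult.commute intro: set_integral_add)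
    show "((\<lambda>t. f t * g t) has_vector_derivative f x * g' x + f' x * g x) (at x within {a..b})"
      if "x \<in> {a..b} - (N1 \<union> N2)" for x
      using that by (intro has_vector_derivative_mult N1(2) N2(2)) auto
  qed
qed

section \<open>Iterated derivatives and the structure of Sobolev functions\<close>

abbreviation vderiv :: "real \<Rightarrow> real \<Rightarrow> (real \<Rightarrow> complex) \<Rightarrow> real \<Rightarrow> complex" where
  "vderiv a b f \<equiv> \<lambda>t. vector_derivative f (at t within {a..b})"

text \<open>\<open>nderiv\<close> adds derivatives on the outside, whereas inductions on the Sobolev
  order replace \<open>f\<close> by its derivative and so need them on the inside.\<close>

lemma nderiv_Suc_inner: "nderiv a b (Suc s) f = nderiv a b s (vderiv a b f)"
  by (induction s) auto

lemma vderiv_eqI: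
  assumes "a < b" "t \<in> {a..b}" "(f has_vector_derivative d) (at t within {a..b})"
  shows "vderiv a b f t = d"
  using vector_derivative_within_cbox[of a b t f d] assms by simp

lemma vderiv_cong:
  assumes "\<And>t. t \<in> {a..b} \<Longrightarrow> f t = g t" "t \<in> {a..b}"
  shows "vderiv a b f t = vderiv a b g t"
proof -
  have "(f has_vector_derivative d) (at t within {a..b}) \<longleftrightarrow> (g has_vector_derivative d) (at t within {a..b})" for d
    using has_vector_derivative_transform[of t "{a..b}" f g d] has_vector_derivative_transform[of t "{a..b}" g f d]
      assms by auto
  then show ?thesis by (simp add: vector_derivative_def)
qed

lemma nderiv_cong:
  assumes "\<And>t. t \<in> {a..b} \<Longrightarrow> f t = g t" "t \<in> {a..b}"
  shows "nderiv a b s f t = nderiv a b s g t"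
  using assms(2)
proof (induction s arbitrary: t)
  case (Suc s)
  then show ?case using vderiv_cong[of a b "nderiv a b s f" "nderiv a b s g" t] by simp
qed (use assms in auto)

lemma differentiable_on_cong:
  fixes f g :: "real \<Rightarrow> complex"
  assumes "\<And>t. t \<in> S \<Longrightarrow> f t = g t"
  shows "f differentiable_on S \<longleftrightarrow> g differentiable_on S"
proof -
  have "g differentiable_on S" if "f differentiable_on S" "\<And>t. t \<in> S \<Longrightarrow> f t = g t" for f g :: "real \<Rightarrow> complex"
    using that unfolding differentiable_on_def differentiable_def
    by (metis has_derivative_transform)
  then show ?thesis using assms by metis
qed

lemma abs_continuous_iff_ac_on: "abs_continuous a b f \<longleftrightarrow> ac_on a b f"
  using abs_continuous_imp_ac_on ac_on_imp_abs_continuous by blast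

text \<open>Functions are total and may differ outside \<open>{a..b}\<close>; all derivatives are
  taken within the interval and cannot see this.\<close>

lemma sobolev_fun_cong:
  assumes p: "1 \<le> p" and eq: "\<And>t. t \<in> {a..b} \<Longrightarrow> f t = g t"
  shows "sobolev_fun a b p l f \<longleftrightarrow> sobolev_fun a b p l g"
proof -
  have "sobolev_fun a b p l g" if f: "sobolev_fun a b p l f" and eq: "\<And>t. t \<in> {a..b} \<Longrightarrow> f t = g t" for f g
  proof -
    note nd = nderiv_cong[of a b f g, OF eq]
    have "Ck_fun a b k g" if "Ck_fun a b k f" for k
      using that differentiable_on_cong[of "{a..b}" "nderiv a b s f" "nderiv a b s g" for s]
        continuous_on_cong[OF refl, of "{a..b}" "nderiv a b k f" "nderiv a b k g"] nd
      unfolding Ck_fun_def by metis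
    moreover have "abs_continuous a b (nderiv a b k g)" if "abs_continuous a b (nderiv a b k f)" for k
      using that ac_on_cong[of a b "nderiv a b k f" "nderiv a b k g" 0] nd
      unfolding abs_continuous_iff_ac_on by simp
    moreover have "in_Lp a b p (nderiv a b l g)" if "in_Lp a b p (nderiv a b l f)"
      by (rule in_Lp_spike[OF p that negligible_empty]) (use nd in auto)
    ultimately show ?thesis using f unfolding sobolev_fun_def by blast
  qed
  then show ?thesis using eq by metis
qed

lemma sobolev_fun_Suc_Suc:
  "sobolev_fun a b p (Suc (Suc l)) f \<longleftrightarrow> f differentiable_on {a..b} \<and> sobolev_fun a b p (Suc l) (vderiv a b f)"
proof -
  have "Ck_fun a b (Suc l) f \<longleftrightarrow> f differentiable_on {a..b} \<and> Ck_fun a b l (vderiv a b f)"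
    unfolding Ck_fun_def by (auto simp: nderiv_Suc_inner less_Suc_eq_0_disj simp del: nderiv.simps(2))
  then show ?thesis
    by (auto simp: sobolev_fun_def nderiv_Suc_inner simp del: nderiv.simps(2))
qed

lemma sobolev_fun_1:
  "sobolev_fun a b p (Suc 0) f \<longleftrightarrow> ac_on a b f \<and> in_Lp a b p (vderiv a b f)"
  using ac_on_imp_continuous_on by (auto simp: sobolev_fun_def Ck_fun_def abs_continuous_iff_ac_on)

text \<open>Together with \<open>sobolev_fun_SucI\<close> this describes order \<open>l + 1\<close>
  as the primitives of functions of order \<open>l\<close>, the form suited to induction. At order 1
  the derivative exists only almost everywhere and the fundamental theorem for absolutely continuous
  functions is needed; above that it exists everywhere and is continuous.\<close>

lemma sobolev_fun_SucD:
  assumes ab: "a < b" and p: "1 \<le> p" and f: "sobolev_fun a b p (Suc l) f"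
  shows "sobolev_fun a b p l (vderiv a b f)" "primitive a b f (vderiv a b f)" "continuous_on {a..b} f"
proof -
  have "sobolev_fun a b p l (vderiv a b f) \<and> primitive a b f (vderiv a b f)"
    using f
  proof (induction l arbitrary: f)
    case 0
    then have ac: "ac_on a b f" and Lp: "in_Lp a b p (vderiv a b f)" by (auto simp: sobolev_fun_1)
    obtain g N where N: "negligible N" and g: "\<And>x. x \<in> {a..b} - N \<Longrightarrow> (f has_vector_derivative g x) (at x within {a..b})"
      by (rule ac_on_has_vector_derivative_AE[OF ac]) (rule that)
    have "primitive a b f (vderiv a b f)"
    proof (rule primitiveI_ac_on[OF ac in_Lp_absolutely_integrable[OF p Lp] N])
      fix x assume "x \<in> {a..b} - N"
      then show "(f has_vector_derivative vderiv a b f x) (at x within {a..b})"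
        using g[of x] vderiv_eqI[OF ab, of x f "g x"] by simp
    qed
    then show ?case using Lp by (simp add: sobolev_fun_def)
  next
    case (Suc l)
    then have d: "f differentiable_on {a..b}" and s: "sobolev_fun a b p (Suc l) (vderiv a b f)"
      by (auto simp: sobolev_fun_Suc_Suc)
    have deriv: "(f has_vector_derivative vderiv a b f x) (at x within {a..b})" if "x \<in> {a..b}" for x
      using d that by (simp add: differentiable_on_def vector_derivative_works)
    have "continuous_on {a..b} (vderiv a b f)"
      using Suc.IH[OF s] primitive_continuous_on by blast
    then have "vderiv a b f absolutely_integrable_on {a..b}"
      using absolutely_integrable_continuous[of a b "vderiv a b f"] by simp
    moreover have "integral {a..t} (vderiv a b f) = f t - f a" if "t \<in> {a..b}" for t
    proof (rule integral_unique, rule fundamental_theorem_of_calculus)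
      show "(f has_vector_derivative vderiv a b f x) (at x within {a..t})" if "x \<in> {a..t}" for x
        by (rule has_vector_derivative_within_subset[OF deriv]) (use that \<open>t \<in> {a..b}\<close> in auto)
    qed (use that in auto)
    ultimately have "primitive a b f (vderiv a b f)"
      by (auto simp: primitive_def)
    then show ?case using s by blast
  qed
  then show "sobolev_fun a b p l (vderiv a b f)" "primitive a b f (vderiv a b f)" "continuous_on {a..b} f"
    using primitive_continuous_on by blast+
qed

lemma primitive_vderiv:
  assumes ab: "a < b" and fg: "primitive a b f g"
  obtains N where "negligible N" "\<And>t. t \<in> {a..b} - N \<Longrightarrow> vderiv a b f t = g t"
  using primitive_derivative_AE[OF fg less_imp_le[OF ab]] vderiv_eqI[OF ab] by (metis DiffD1)

lemma primitive_vderiv_continuous: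
  assumes ab: "a < b" and fg: "primitive a b f g" and g: "continuous_on {a..b} g" and t: "t \<in> {a..b}"
  shows "vderiv a b f t = g t"
  using vderiv_eqI[OF ab t primitive_derivative[OF fg g t]] .

text \<open>For \<open>l = 0\<close> the derivative of \<open>f\<close> equals \<open>g\<close> only
  almost everywhere, which membership in L_p tolerates; for \<open>l > 0\<close> the function
  \<open>g\<close> is continuous and equality holds everywhere.\<close>

lemma sobolev_fun_SucI:
  assumes ab: "a < b" and p: "1 \<le> p" and g: "sobolev_fun a b p l g" and fg: "primitive a b f g"
  shows "sobolev_fun a b p (Suc l) f"
proof (cases l)
  case 0
  obtain N where N: "negligible N" "\<And>t. t \<in> {a..b} - N \<Longrightarrow> vderiv a b f t = g t"
    by (rule primitive_vderiv[OF ab fg]) (rule that)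
  have "in_Lp a b p g" using g 0 by (simp add: sobolev_fun_def)
  then have "in_Lp a b p (vderiv a b f)" by (rule in_Lp_spike[OF p _ N(1)]) (use N(2) in auto)
  then show ?thesis using primitive_ac_on[OF fg] 0 by (simp add: sobolev_fun_1)
next
  case (Suc k)
  have cont: "continuous_on {a..b} g" using sobolev_fun_SucD(3)[OF ab p] g Suc by blast
  have "f differentiable_on {a..b}"
    using primitive_derivative[OF fg cont]
    unfolding differentiable_on_def differentiable_def has_vector_derivative_def by blast
  moreover have "sobolev_fun a b p l (vderiv a b f)"
    using sobolev_fun_cong[OF p, of a b "vderiv a b f" g l] primitive_vderiv_continuous[OF ab fg cont] g by simp
  ultimately show ?thesis by (simp add: sobolev_fun_Suc_Suc Suc)
qed

lemma sobolev_fun_const: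
  assumes ab: "a < b" and p: "1 \<le> p"
  shows "sobolev_fun a b p l (\<lambda>t. c)"
proof (induction l arbitrary: c)
  case 0
  then show ?case using in_Lp_const by (simp add: sobolev_fun_def)
next
  case (Suc l)
  show ?case by (rule sobolev_fun_SucI[OF ab p Suc[of 0]]) (simp add: primitive_def)
qed

lemma sobolev_fun_add:
  assumes ab: "a < b" and p: "1 \<le> p" and "sobolev_fun a b p l f" "sobolev_fun a b p l g"
  shows "sobolev_fun a b p l (\<lambda>t. f t + g t)"
  using assms(3,4)
proof (induction l arbitrary: f g)
  case 0
  then show ?case using in_Lp_add[OF p] by (simp add: sobolev_fun_def)
next
  case (Suc l)
  note f = sobolev_fun_SucD[OF ab p Suc.prems(1)] and g = sobolev_fun_SucD[OF ab p Suc.prems(2)]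
  show ?case by (rule sobolev_fun_SucI[OF ab p Suc.IH[OF f(1) g(1)] primitive_add[OF f(2) g(2)]])
qed

lemma sobolev_fun_Suc_imp:
  assumes ab: "a < b" and p: "1 \<le> p" and "sobolev_fun a b p (Suc l) f"
  shows "sobolev_fun a b p l f"
  using assms(3)
proof (induction l arbitrary: f)
  case 0
  then show ?case using sobolev_fun_SucD(3)[OF ab p 0] in_Lp_continuous[OF p] by (simp add: sobolev_fun_def)
next
  case (Suc l)
  note f = sobolev_fun_SucD[OF ab p Suc.prems]
  show ?case by (rule sobolev_fun_SucI[OF ab p Suc.IH[OF f(1)] f(2)])
qed

lemma sobolev_fun_mono:
  assumes "a < b" "1 \<le> p" "sobolev_fun a b p l f" "k \<le> l"
  shows "sobolev_fun a b p k f"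
  using assms(4,3) by (induction rule: inc_induct) (use sobolev_fun_Suc_imp[OF assms(1,2)] in auto)

text \<open>L_p is in general not closed under products, so one factor has an extra degree: at the
  bottom it is continuous. In the induction step the product rule gives two terms of the same kind;
  in the term with the derivative of \<open>g\<close> the roles are exchanged and \<open>f\<close>
  is the smoother factor.\<close>

lemma sobolev_fun_mult_smoother:
  assumes ab: "a < b" and p: "1 \<le> p" and "sobolev_fun a b p l f" "sobolev_fun a b p (Suc l) g"
  shows "sobolev_fun a b p l (\<lambda>t. f t * g t)"
  using assms(3,4)
proof (induction l arbitrary: f g)
  case 0
  then show ?case
    using in_Lp_mult_continuous[OF p _ sobolev_fun_SucD(3)[OF ab p 0(2)], of f]
    by (simp add: sobolev_fun_def mult.commute)
next
  case (Suc l)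
  note f = sobolev_fun_SucD[OF ab p Suc.prems(1)] and g = sobolev_fun_SucD[OF ab p Suc.prems(2)]
  have "sobolev_fun a b p l (\<lambda>t. vderiv a b g t * f t)"
    by (rule Suc.IH[OF sobolev_fun_Suc_imp[OF ab p g(1)] Suc.prems(1)])
  moreover have "sobolev_fun a b p l (\<lambda>t. vderiv a b f t * g t)"
    by (rule Suc.IH[OF f(1) sobolev_fun_Suc_imp[OF ab p Suc.prems(2)]])
  ultimately have "sobolev_fun a b p l (\<lambda>t. f t * vderiv a b g t + vderiv a b f t * g t)"
    by (intro sobolev_fun_add[OF ab p]) (simp_all add: mult.commute)
  then show ?case
    by (rule sobolev_fun_SucI[OF ab p _ primitive_mult[OF f(2) g(2) less_imp_le[OF ab]]])
qed

text \<open>Positive order makes the space an algebra: each factor is then one degree smoother than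
  the derivative of the other.\<close>

lemma sobolev_fun_mult:
  assumes ab: "a < b" and p: "1 \<le> p" and "sobolev_fun a b p (Suc l) f" "sobolev_fun a b p (Suc l) g"
  shows "sobolev_fun a b p (Suc l) (\<lambda>t. f t * g t)"
proof -
  note f = sobolev_fun_SucD[OF ab p assms(3)] and g = sobolev_fun_SucD[OF ab p assms(4)]
  have "sobolev_fun a b p l (\<lambda>t. vderiv a b g t * f t)" "sobolev_fun a b p l (\<lambda>t. vderiv a b f t * g t)"
    using sobolev_fun_mult_smoother[OF ab p] f(1) g(1) assms(3,4) by blast+
  then have "sobolev_fun a b p l (\<lambda>t. f t * vderiv a b g t + vderiv a b f t * g t)"
    by (intro sobolev_fun_add[OF ab p]) (simp_all add: mult.commute)
  then show ?thesis
    by (rule sobolev_fun_SucI[OF ab p _ primitive_mult[OF f(2) g(2) less_imp_le[OF ab]]])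
qed

lemma sobolev_fun_cmult:
  assumes "a < b" "1 \<le> p" "sobolev_fun a b p l f"
  shows "sobolev_fun a b p l (\<lambda>t. c * f t)"
  using sobolev_fun_mult_smoother[OF assms sobolev_fun_const[OF assms(1,2)], of c] by (simp add: mult.commute)

lemma sobolev_fun_sum:
  assumes "a < b" "1 \<le> p" "\<And>i. i \<in> I \<Longrightarrow> sobolev_fun a b p l (f i)"
  shows "sobolev_fun a b p l (\<lambda>t. \<Sum>i\<in>I. f i t)"
  using assms(3)
  by (induction I rule: infinite_finite_induct)
    (auto intro!: sobolev_fun_add[OF assms(1,2)] sobolev_fun_const[OF assms(1,2)])

section \<open>Linear differential systems with integrable coefficients\<close>

lemma abs_exp_diff_le:
  fixes x y M :: real
  assumes "x \<le> M" "y \<le> M"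
  shows "\<bar>exp x - exp y\<bar> \<le> exp M * \<bar>x - y\<bar>"
proof -
  have *: "exp u - exp v \<le> exp M * (u - v)" if "v \<le> u" "u \<le> M" for u v :: real
  proof -
    have "exp u * (1 + (v - u)) \<le> exp u * exp (v - u)" by (intro mult_left_mono exp_ge_add_one_self) simp
    also have "\<dots> = exp v" by (simp add: exp_add[symmetric])
    finally have "exp u - exp v \<le> exp u * (u - v)" by (simp add: algebra_simps)
    also have "\<dots> \<le> exp M * (u - v)" using that by (intro mult_right_mono) auto
    finally show ?thesis .
  qed
  show ?thesis using *[of y x] *[of x y] assms by (cases "y \<le> x") (auto simp: abs_if)
qed

lemma ac_on_exp:
  fixes f :: "real \<Rightarrow> real"
  assumes ac: "ac_on a b f"
  shows "ac_on a b (\<lambda>t. exp (f t))"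
proof -
  have "compact (f ` {a..b})" by (intro compact_continuous_image ac_on_imp_continuous_on ac) simp
  then obtain M where M: "\<And>t. t \<in> {a..b} \<Longrightarrow> f t \<le> M"
    using compact_imp_bounded bounded_imp_bdd_above by (metis bdd_above.unfold imageI)
  show ?thesis
  proof (rule ac_on_dominated[OF ac ac exp_gt_zero[of M]])
    show "norm (exp (f x) - exp (f y)) \<le> exp M * (norm (f x - f y) + norm (f x - f y))"
      if "x \<in> {a..b}" "y \<in> {a..b}" for x y
      using abs_exp_diff_le[OF M[OF that(1)] M[OF that(2)]] by (simp add: algebra_simps add_increasing2)
  qed
qed

lemma absolutely_integrable_imp_integrable_on:
  fixes f :: "real \<Rightarrow> 'a::euclidean_space"
  assumes "f absolutely_integrable_on {a..b}" "t \<in> {a..b}"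
  shows "f integrable_on {a..t}"
  using assms by (auto simp: absolutely_integrable_on_def intro: integrable_on_subinterval)

text \<open>The weight \<open>w = exp (2 * \<integral> k)\<close> of a Bielecki norm.\<close>

lemma Bielecki_weight:
  fixes k :: "real \<Rightarrow> real"
  assumes "a \<le> b" and k: "k absolutely_integrable_on {a..b}" and k0: "\<And>t. 0 \<le> k t"
  obtains w where "continuous_on {a..b} w" "\<And>t. t \<in> {a..b} \<Longrightarrow> 1 \<le> w t"
    "\<And>t. t \<in> {a..b} \<Longrightarrow> (\<lambda>s. k s * w s) integrable_on {a..t}"
    "\<And>t. t \<in> {a..b} \<Longrightarrow> integral {a..t} (\<lambda>s. k s * w s) \<le> w t / 2"
proof -
  define K where "K t = integral {a..t} k" for t
  define w where "w t = exp (2 * K t)" for t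
  have ki: "k integrable_on {a..t}" if "t \<in> {a..b}" for t
    using k that by (auto simp: absolutely_integrable_on_def intro: integrable_on_subinterval)
  have acK: "ac_on a b K" unfolding K_def by (rule ac_on_integral[OF k])
  have acw: "ac_on a b w"
    unfolding w_def using ac_on_bounded_linear_image[OF acK bounded_linear_mult_right[of 2]]
    by (intro ac_on_exp)
  \<comment> \<open>The differentiation theorem is stated for complex functions, so \<open>k\<close>
    is embedded and the real part taken afterwards.\<close>
  let ?k = "\<lambda>t. complex_of_real (k t)"
  have kc: "?k absolutely_integrable_on {a..b}"
    using absolutely_integrable_linear[OF k bounded_linear_of_real] by (simp add: o_def)
  obtain N where N: "negligible N"
    "\<And>x. x \<in> {a..b} - N \<Longrightarrow> ((\<lambda>t. integral {a..t} ?k) has_vector_derivative ?k x) (at x within {a..b})"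
    by (rule Lebesgue_differentiation[OF kc \<open>a \<le> b\<close>]) (rule that)
  have dK: "(K has_vector_derivative k x) (at x within {a..b})" if x: "x \<in> {a..b} - N" for x
  proof (rule has_vector_derivative_transform)
    show "((\<lambda>t. Re (integral {a..t} ?k)) has_vector_derivative k x) (at x within {a..b})"
      using bounded_linear.has_vector_derivative[OF bounded_linear_Re N(2)[OF x]] by simp
    show "K t = Re (integral {a..t} ?k)" if "t \<in> {a..b}" for t
      using integral_linear[where h = complex_of_real, OF ki[OF that] bounded_linear_of_real] by (simp add: K_def o_def)
  qed (use x in auto)
  \<comment> \<open>Almost everywhere the derivative of \<open>w\<close> is
    \<open>2 * (k x * w x)\<close>, and \<open>w a = 1\<close>; hence the integral of
    \<open>k s * w s\<close> is \<open>(w t - 1) / 2\<close>, less than half of \<open>w t\<close>.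
    The factor 2 in the exponent is the origin of the contraction constant 1/2.\<close>
  have "((\<lambda>s. 2 * (k s * w s)) has_integral (w t - 1)) {a..t}" if t: "t \<in> {a..b}" for t
  proof -
    have "((\<lambda>s. 2 * (k s * w s)) has_integral (w t - w a)) {a..t}"
    proof (rule ac_on_has_integral[OF _ _ N(1)])
      show "ac_on a t w" by (rule ac_on_subset[OF acw]) (use t in auto)
      fix x assume "x \<in> {a..t} - N"
      then have "x \<in> {a..b} - N" using t by auto
      then have "(K has_real_derivative k x) (at x within {a..b})"
        using dK by (simp add: has_real_derivative_iff_has_vector_derivative)
      then have "(w has_real_derivative 2 * (k x * w x)) (at x within {a..b})"
        unfolding w_def by (auto intro!: derivative_eq_intros)
      then show "(w has_vector_derivative 2 * (k x * w x)) (at x within {a..t})"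
        unfolding has_real_derivative_iff_has_vector_derivative
        by (rule has_vector_derivative_within_subset) (use t in auto)
    qed (use t in auto)
    moreover have "w a = 1" by (simp add: w_def K_def)
    ultimately show ?thesis by simp
  qed
  then have int: "((\<lambda>s. k s * w s) has_integral ((w t - 1) / 2)) {a..t}" if "t \<in> {a..b}" for t
    using has_integral_mult_right[of "\<lambda>s. 2 * (k s * w s)" "w t - 1" "{a..t}" "1 / 2"] that by simp
  show thesis
  proof (rule that)
    show "continuous_on {a..b} w" by (rule ac_on_imp_continuous_on[OF acw])
    show "1 \<le> w t" if "t \<in> {a..b}" for t
      using integral_nonneg[OF ki[OF that]] k0 by (simp add: w_def K_def)
    show "(\<lambda>s. k s * w s) integrable_on {a..t}" if "t \<in> {a..b}" for t using int[OF that] by blast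
    show "integral {a..t} (\<lambda>s. k s * w s) \<le> w t / 2" if "t \<in> {a..b}" for t
      using integral_unique[OF int[OF that]] by simp
  qed
qed

section \<open>Volterra integral equations\<close>

text \<open>The index type is arbitrary so that pairs of a derivative order and a component can
  index the unknowns without being coded as numbers.\<close>

locale linear_system =
  fixes a b :: real and I :: "'i set" and P :: "'i \<Rightarrow> 'i \<Rightarrow> real \<Rightarrow> complex"
  assumes ab: "a < b" and finI: "finite I"
    and P: "\<And>i j. i \<in> I \<Longrightarrow> j \<in> I \<Longrightarrow> P i j absolutely_integrable_on {a..b}"
begin

definition k :: "real \<Rightarrow> real" where "k s = (\<Sum>i\<in>I. \<Sum>j\<in>I. cmod (P i j s))"

lemma k_integrable: "k absolutely_integrable_on {a..b}"
  unfolding k_def by (intro absolutely_integrable_sum finI absolutely_integrable_norm[OF P, unfolded o_def])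

lemma k_nonneg: "0 \<le> k t" unfolding k_def by (intro sum_nonneg) auto

lemma row_le_k: "i \<in> I \<Longrightarrow> (\<Sum>j\<in>I. cmod (P i j s)) \<le> k s"
  unfolding k_def by (rule member_le_sum[of i I "\<lambda>i. \<Sum>j\<in>I. cmod (P i j s)"]) (auto intro: sum_nonneg finI)

lemma row_integrable:
  assumes "i \<in> I" "\<And>j. j \<in> I \<Longrightarrow> continuous_on {a..b} (z j)"
  shows "(\<lambda>s. \<Sum>j\<in>I. P i j s * z j s) absolutely_integrable_on {a..b}"
proof (intro absolutely_integrable_sum finI)
  fix j assume "j \<in> I"
  then show "(\<lambda>s. P i j s * z j s) absolutely_integrable_on {a..b}"
    using absolutely_integrable_mult_continuous[OF assms(2) P[OF assms(1)], of j j] by (simp add: mult.commute)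
qed

text \<open>The contraction estimate: in the supremum norm of \<open>cmod (z j s) / w s\<close> the
  Volterra operator has norm at most 1/2. All components share one bound \<open>C\<close>, so only
  the row sums of the coefficients enter, and these are at most \<open>k\<close>.\<close>

lemma row_integral_le:
  assumes w: "\<And>t. t \<in> {a..b} \<Longrightarrow> (\<lambda>s. k s * w s) integrable_on {a..t}"
    "\<And>t. t \<in> {a..b} \<Longrightarrow> integral {a..t} (\<lambda>s. k s * w s) \<le> w t / 2"
    and i: "i \<in> I" and z: "\<And>j. j \<in> I \<Longrightarrow> continuous_on {a..b} (z j)"
    and le: "\<And>j s. j \<in> I \<Longrightarrow> s \<in> {a..b} \<Longrightarrow> cmod (z j s) \<le> w s * C" and "C \<ge> 0" and t: "t \<in> {a..b}"
  shows "cmod (integral {a..t} (\<lambda>s. \<Sum>j\<in>I. P i j s * z j s)) \<le> w t / 2 * C"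
proof -
  have "cmod (integral {a..t} (\<lambda>s. \<Sum>j\<in>I. P i j s * z j s)) \<le> integral {a..t} (\<lambda>s. k s * w s * C)"
  proof (rule Henstock_Kurzweil_Integration.integral_norm_bound_integral)
    show "(\<lambda>s. \<Sum>j\<in>I. P i j s * z j s) integrable_on {a..t}"
      by (rule absolutely_integrable_imp_integrable_on[OF row_integrable[where z = z, OF i z] t])
    show "(\<lambda>s. k s * w s * C) integrable_on {a..t}" using w(1)[OF t] integrable_on_mult_left by blast
    fix s assume "s \<in> {a..t}"
    then have s: "s \<in> {a..b}" using t by auto
    have "cmod (\<Sum>j\<in>I. P i j s * z j s) \<le> (\<Sum>j\<in>I. cmod (P i j s) * (w s * C))"
      by (rule order_trans[OF norm_sum sum_mono]) (auto simp: norm_mult intro!: mult_left_mono le s)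
    also have "\<dots> = (\<Sum>j\<in>I. cmod (P i j s)) * (w s * C)" by (simp add: sum_distrib_right)
    also have "\<dots> \<le> k s * (w s * C)"
      using row_le_k[OF i] order_trans[OF norm_ge_zero le[OF i s]] by (intro mult_right_mono) auto
    finally show "cmod (\<Sum>j\<in>I. P i j s * z j s) \<le> k s * w s * C" by (simp add: mult.assoc)
  qed
  also have "\<dots> = integral {a..t} (\<lambda>s. k s * w s) * C" by simp
  also have "\<dots> \<le> w t / 2 * C" using w(2)[OF t] \<open>C \<ge> 0\<close> by (intro mult_right_mono) auto
  finally show ?thesis .
qed

text \<open>The largest value \<open>M\<close> of \<open>cmod (z i t) / w t\<close>, attained by
  compactness over finitely many components, satisfies \<open>M \<le> M / 2\<close>.\<close>

lemma unique:
  assumes cont: "\<And>i. i \<in> I \<Longrightarrow> continuous_on {a..b} (z i)"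
    and eq: "\<And>i t. i \<in> I \<Longrightarrow> t \<in> {a..b} \<Longrightarrow> z i t = integral {a..t} (\<lambda>s. \<Sum>j\<in>I. P i j s * z j s)"
    and "i \<in> I" "t \<in> {a..b}"
  shows "z i t = 0"
proof -
  obtain w where w: "continuous_on {a..b} w" "\<And>t. t \<in> {a..b} \<Longrightarrow> 1 \<le> w t"
    "\<And>t. t \<in> {a..b} \<Longrightarrow> (\<lambda>s. k s * w s) integrable_on {a..t}"
    "\<And>t. t \<in> {a..b} \<Longrightarrow> integral {a..t} (\<lambda>s. k s * w s) \<le> w t / 2"
    by (rule Bielecki_weight[OF less_imp_le[OF ab] k_integrable k_nonneg]) (rule that)
  have w0: "w t > 0" if "t \<in> {a..b}" for t using w(2)[OF that] by linarith
  let ?S = "\<Union>i\<in>I. (\<lambda>t. cmod (z i t) / w t) ` {a..b}"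
  have "compact ?S"
    using finI w0 by (intro compact_UN compact_continuous_image continuous_intros cont w(1)) force+
  moreover have "?S \<noteq> {}" using assms(3,4) by blast
  ultimately obtain M where M: "M \<in> ?S" "\<And>x. x \<in> ?S \<Longrightarrow> x \<le> M"
    using compact_attains_sup by meson
  then obtain i0 t0 where i0: "i0 \<in> I" "t0 \<in> {a..b}" "M = cmod (z i0 t0) / w t0" by blast
  have le: "cmod (z j s) \<le> w s * M" if "j \<in> I" "s \<in> {a..b}" for j s
  proof -
    have "cmod (z j s) / w s \<le> M" using that by (intro M(2)) blast
    then show ?thesis using w0[OF that(2)] by (simp add: pos_divide_le_eq mult.commute)
  qed
  have "M \<ge> 0" using i0 w0[OF i0(2)] by simp
  have "cmod (z i0 t0) \<le> w t0 / 2 * M"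
    using row_integral_le[OF w(3,4) i0(1) cont le \<open>M \<ge> 0\<close> i0(2)] eq[OF i0(1,2)] by simp
  then have "M \<le> M / 2" using i0(3) w0[OF i0(2)] by (simp add: field_simps)
  then have "M = 0" using \<open>M \<ge> 0\<close> by simp
  then show ?thesis using le[OF assms(3,4)] by simp
qed

text \<open>Picard iteration from 0: consecutive differences shrink by the factor 1/2 in the
  weighted norm, so their telescoping series converges uniformly, and the same contraction estimate
  shows that \<open>V\<close> passes to the limit. The weight makes this work on all of
  \<open>{a..b}\<close> at once, however large the coefficients are.\<close>

lemma exists_solution:
  assumes h: "\<And>i. i \<in> I \<Longrightarrow> h i absolutely_integrable_on {a..b}"
  obtains z where "\<And>i. i \<in> I \<Longrightarrow> continuous_on {a..b} (z i)"
    "\<And>i t. i \<in> I \<Longrightarrow> t \<in> {a..b} \<Longrightarrow> z i t = z0 i + integral {a..t} (\<lambda>s. (\<Sum>j\<in>I. P i j s * z j s) + h i s)"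
proof -
  obtain w where w: "continuous_on {a..b} w" "\<And>t. t \<in> {a..b} \<Longrightarrow> 1 \<le> w t"
    "\<And>t. t \<in> {a..b} \<Longrightarrow> (\<lambda>s. k s * w s) integrable_on {a..t}"
    "\<And>t. t \<in> {a..b} \<Longrightarrow> integral {a..t} (\<lambda>s. k s * w s) \<le> w t / 2"
    by (rule Bielecki_weight[OF less_imp_le[OF ab] k_integrable k_nonneg]) (rule that)
  have w0: "w t > 0" if "t \<in> {a..b}" for t using w(2)[OF that] by linarith
  define V where "V z i t = z0 i + integral {a..t} (\<lambda>s. (\<Sum>j\<in>I. P i j s * z j s) + h i s)" for z i t
  define Z where "Z n = (V ^^ n) (\<lambda>_ _. 0)" for n
  have Z_Suc: "Z (Suc n) = V (Z n)" for n by (simp add: Z_def)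
  have row: "(\<lambda>s. \<Sum>j\<in>I. P i j s * z j s) absolutely_integrable_on {a..b}"
    if "i \<in> I" "\<And>j. j \<in> I \<Longrightarrow> continuous_on {a..b} (z j)" for z i
    by (rule row_integrable[where z = z, OF that])
  have V_cont: "continuous_on {a..b} (V z i)" if "i \<in> I" "\<And>j. j \<in> I \<Longrightarrow> continuous_on {a..b} (z j)" for z i
  proof -
    have "(\<lambda>s. (\<Sum>j\<in>I. P i j s * z j s) + h i s) integrable_on {a..b}"
      by (rule absolutely_integrable_imp_integrable_on[OF set_integral_add(1)[OF row[OF that] h[OF that(1)]]]) (use ab in auto)
    then show ?thesis
      unfolding V_def[abs_def] by (intro continuous_intros indefinite_integral_continuous_1)
  qed
  have Z_cont: "continuous_on {a..b} (Z n i)" if "i \<in> I" for n i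
    using that by (induction n arbitrary: i) (auto simp: Z_Suc Z_def intro!: V_cont)
  have V_diff: "V z i t - V z' i t = integral {a..t} (\<lambda>s. \<Sum>j\<in>I. P i j s * (z j s - z' j s))"
    if i: "i \<in> I" and z: "\<And>j. j \<in> I \<Longrightarrow> continuous_on {a..b} (z j)" "\<And>j. j \<in> I \<Longrightarrow> continuous_on {a..b} (z' j)"
      and t: "t \<in> {a..b}" for z z' i t
  proof -
    note int = absolutely_integrable_imp_integrable_on[OF row[where z = z, OF i z(1)] t]
      absolutely_integrable_imp_integrable_on[OF row[where z = z', OF i z(2)] t]
      absolutely_integrable_imp_integrable_on[OF h[OF i] t]
    show ?thesis
      unfolding V_def using int
      by (simp add: Henstock_Kurzweil_Integration.integral_add Henstock_Kurzweil_Integration.integral_diff[symmetric]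
          sum_subtractf[symmetric] right_diff_distrib)
  qed
  have V_contract: "cmod (V z i t - V z' i t) \<le> w t / 2 * C"
    if "i \<in> I" "\<And>j. j \<in> I \<Longrightarrow> continuous_on {a..b} (z j)" "\<And>j. j \<in> I \<Longrightarrow> continuous_on {a..b} (z' j)"
      "t \<in> {a..b}" "C \<ge> 0" "\<And>j s. j \<in> I \<Longrightarrow> s \<in> {a..b} \<Longrightarrow> cmod (z j s - z' j s) \<le> w s * C" for z z' i t C
  proof -
    have "continuous_on {a..b} (\<lambda>s. z j s - z' j s)" if "j \<in> I" for j
      by (intro continuous_intros \<open>\<And>j. j \<in> I \<Longrightarrow> continuous_on {a..b} (z j)\<close>
          \<open>\<And>j. j \<in> I \<Longrightarrow> continuous_on {a..b} (z' j)\<close> that)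
    note cont = this
    have "V z i t - V z' i t = integral {a..t} (\<lambda>s. \<Sum>j\<in>I. P i j s * (z j s - z' j s))"
      by (rule V_diff) (use that in auto)
    moreover have "cmod (integral {a..t} (\<lambda>s. \<Sum>j\<in>I. P i j s * (z j s - z' j s))) \<le> w t / 2 * C"
      by (rule row_integral_le[where z = "\<lambda>j s. z j s - z' j s"]) (use w(3,4) that cont in auto)
    ultimately show ?thesis by simp
  qed
  \<comment> \<open>\<open>C\<close> bounds the first step; as \<open>w \<ge> 1\<close>, it does so
    in the weighted norm as well.\<close>
  let ?S = "\<Union>i\<in>I. (\<lambda>t. Z 1 i t - Z 0 i t) ` {a..b}"
  have "bounded ?S"
    using finI by (intro compact_imp_bounded compact_UN compact_continuous_image continuous_intros Z_cont) auto
  then obtain C where C: "C > 0" "\<forall>x\<in>?S. cmod x \<le> C"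
    unfolding bounded_pos by blast
  have D: "cmod (Z (Suc n) i t - Z n i t) \<le> w t * (C * (1 / 2) ^ n)" if "i \<in> I" "t \<in> {a..b}" for n i t
    using that
  proof (induction n arbitrary: i t)
    case 0
    then have "cmod (Z 1 i t - Z 0 i t) \<le> C" by (intro C(2)[rule_format]) blast
    also have "\<dots> \<le> w t * C" using w(2)[OF 0(2)] C(1) by simp
    finally show ?case by simp
  next
    case (Suc n)
    have "cmod (V (Z (Suc n)) i t - V (Z n) i t) \<le> w t / 2 * (C * (1 / 2) ^ n)"
      by (rule V_contract[OF Suc.prems(1) Z_cont Z_cont Suc.prems(2) _ Suc.IH]) (use C(1) in auto)
    then show ?case by (simp add: Z_Suc)
  qed
  have "compact (w ` {a..b})" by (intro compact_continuous_image w(1)) simp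
  then obtain W where W: "\<And>t. t \<in> {a..b} \<Longrightarrow> w t \<le> W"
    using compact_imp_bounded bounded_imp_bdd_above by (metis bdd_above.unfold imageI)
  define z where "z i t = (\<Sum>n. Z (Suc n) i t - Z n i t)" for i t
  have lim: "uniform_limit {a..b} (\<lambda>n. Z n i) (z i) sequentially" if i: "i \<in> I" for i
  proof -
    have "uniform_limit {a..b} (\<lambda>n t. \<Sum>j<n. Z (Suc j) i t - Z j i t) (z i) sequentially"
      unfolding z_def
    proof (rule Weierstrass_m_test)
      show "cmod (Z (Suc n) i t - Z n i t) \<le> W * (C * (1 / 2) ^ n)" if "t \<in> {a..b}" for n t
        using D[OF i that, of n] W[OF that] C(1)
        by (meson mult_right_mono order_trans less_imp_le zero_le_mult_iff zero_le_power divide_nonneg_pos zero_le_one zero_less_numeral)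
      show "summable (\<lambda>n. W * (C * (1 / 2) ^ n))" by (intro summable_mult summable_geometric) simp
    qed
    \<comment> \<open>The telescoping sum is \<open>Z n\<close> itself because the iteration starts
      at 0.\<close>
    moreover have "(\<Sum>j<n. Z (Suc j) i t - Z j i t) = Z n i t" for n t
      using sum_lessThan_telescope[of "\<lambda>j. Z j i t" n] by (simp add: Z_def)
    ultimately show ?thesis by simp
  qed
  have z_cont: "continuous_on {a..b} (z i)" if "i \<in> I" for i
    by (rule uniform_limit_theorem[OF _ lim[OF that]]) (use Z_cont[OF that] in auto)
  show thesis
  proof (rule that[of z])
    fix i t assume i: "i \<in> I" and t: "t \<in> {a..b}"
    have "(\<lambda>n. V (Z n) i t) \<longlonglongrightarrow> V z i t"
    proof (rule tendstoI)
      fix e :: real assume "e > 0"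
      \<comment> \<open>Uniform closeness \<open>e'\<close> implies weighted closeness
        \<open>e'\<close> because \<open>w \<ge> 1\<close>; at \<open>t\<close> the contraction then
        gives \<open>w t / 2 * e'\<close>, which is \<open>e / 2\<close>.\<close>
      define e' where "e' = e / w t"
      have "e' > 0" using \<open>e > 0\<close> w0[OF t] by (simp add: e'_def)
      have "\<forall>\<^sub>F n in sequentially. \<forall>j\<in>I. \<forall>s\<in>{a..b}. dist (Z n j s) (z j s) < e'"
        using uniform_limitD[OF lim \<open>e' > 0\<close>] by (intro eventually_ball_finite finI) auto
      then show "\<forall>\<^sub>F n in sequentially. dist (V (Z n) i t) (V z i t) < e"
      proof eventually_elim
        case (elim n)
        have "cmod (Z n j s - z j s) \<le> w s * e'" if "j \<in> I" "s \<in> {a..b}" for j s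
        proof -
          have "cmod (Z n j s - z j s) \<le> 1 * e'" using elim that by (auto simp: dist_norm intro: less_imp_le)
          also have "\<dots> \<le> w s * e'" using w(2)[OF that(2)] \<open>e' > 0\<close> by (intro mult_right_mono) auto
          finally show ?thesis .
        qed
        then have "cmod (V (Z n) i t - V z i t) \<le> w t / 2 * e'"
          using V_contract[OF i Z_cont z_cont t] \<open>e' > 0\<close> by simp
        also have "\<dots> = e / 2" using w0[OF t] by (simp add: e'_def)
        finally show ?case using \<open>e > 0\<close> by (simp add: dist_norm)
      qed
    qed
    moreover have "(\<lambda>n. V (Z n) i t) \<longlonglongrightarrow> z i t"
      using LIMSEQ_Suc[OF tendsto_uniform_limitI[OF lim[OF i] t]] by (simp add: Z_Suc)
    ultimately show "z i t = z0 i + integral {a..t} (\<lambda>s. (\<Sum>j\<in>I. P i j s * z j s) + h i s)"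
      using LIMSEQ_unique unfolding V_def by blast
  qed (rule z_cont)
qed

end

section \<open>Linear combinations and chains of primitives\<close>

lemma primitive_cmult:
  assumes "primitive a b f g"
  shows "primitive a b (\<lambda>t. c * f t) (\<lambda>t. c * g t)"
  unfolding primitive_def
proof (intro conjI ballI)
  show "(\<lambda>t. c * g t) absolutely_integrable_on {a..b}"
    by (intro absolutely_integrable_mult_continuous primitive_integrable[OF assms] continuous_on_const)
  fix t assume t: "t \<in> {a..b}"
  show "c * f t = c * f a + integral {a..t} (\<lambda>t. c * g t)"
    using primitiveD[OF assms t] by (simp add: distrib_left)
qed

lemma primitive_lincomb:
  assumes "finite C" "\<And>c. c \<in> C \<Longrightarrow> primitive a b (f c) (g c)"
  shows "primitive a b (\<lambda>t. \<Sum>c\<in>C. \<alpha> c * f c t) (\<lambda>t. \<Sum>c\<in>C. \<alpha> c * g c t)"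
  using assms
proof (induction C rule: finite_induct)
  case empty
  then show ?case by (simp add: primitive_def)
next
  case (insert c C)
  have "primitive a b (\<lambda>t. \<alpha> c * f c t + (\<Sum>c\<in>C. \<alpha> c * f c t)) (\<lambda>t. \<alpha> c * g c t + (\<Sum>c\<in>C. \<alpha> c * g c t))"
    by (intro primitive_add primitive_cmult insert) auto
  then show ?case using insert(1,2) by simp
qed

lemma sobolev_fun_nderiv:
  assumes "a < b" "1 \<le> p" "sobolev_fun a b p (s + l) f"
  shows "sobolev_fun a b p l (nderiv a b s f)"
  using assms(3)
proof (induction s arbitrary: f)
  case (Suc s)
  then show ?case using sobolev_fun_SucD(1)[OF assms(1,2), of "s + l" f]
    by (simp add: nderiv_Suc_inner del: nderiv.simps(2))
qed simp

lemma primitive_nderiv: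
  assumes "a < b" "1 \<le> p" "sobolev_fun a b p (Suc s + l) f"
  shows "primitive a b (nderiv a b s f) (nderiv a b (Suc s) f)"
  using sobolev_fun_SucD(2)[OF assms(1,2) sobolev_fun_nderiv[OF assms(1,2), of s "Suc l" f]] assms(3) by simp

text \<open>Equality of two functions as elements of \<open>W\<^sub>p\<^sup>l\<close>.\<close>

definition sobolev_eq :: "real \<Rightarrow> real \<Rightarrow> nat \<Rightarrow> (real \<Rightarrow> complex) \<Rightarrow> (real \<Rightarrow> complex) \<Rightarrow> bool" where
  "sobolev_eq a b l f g \<longleftrightarrow> (\<exists>N. negligible N \<and> (l > 0 \<longrightarrow> N = {}) \<and> (\<forall>t\<in>{a..b} - N. f t = g t))"

lemma sobolev_eqI: "(\<And>t. t \<in> {a..b} \<Longrightarrow> f t = g t) \<Longrightarrow> sobolev_eq a b l f g"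
  unfolding sobolev_eq_def by (intro exI[of _ "{}"]) auto

lemma sobolev_eqE:
  assumes "sobolev_eq a b l f g"
  obtains N where "negligible N" "l > 0 \<Longrightarrow> N = {}" "\<And>t. t \<in> {a..b} - N \<Longrightarrow> f t = g t"
  using assms unfolding sobolev_eq_def by blast

lemma sobolev_eqD: "sobolev_eq a b l f g \<Longrightarrow> l > 0 \<Longrightarrow> t \<in> {a..b} \<Longrightarrow> f t = g t"
  unfolding sobolev_eq_def by auto

lemma sobolev_eq_trans:
  assumes "sobolev_eq a b l f g" "sobolev_eq a b l g h"
  shows "sobolev_eq a b l f h"
proof -
  obtain N1 where N1: "negligible N1" "l > 0 \<longrightarrow> N1 = {}" "\<And>t. t \<in> {a..b} - N1 \<Longrightarrow> f t = g t"
    using assms(1) unfolding sobolev_eq_def by blast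
  obtain N2 where N2: "negligible N2" "l > 0 \<longrightarrow> N2 = {}" "\<And>t. t \<in> {a..b} - N2 \<Longrightarrow> g t = h t"
    using assms(2) unfolding sobolev_eq_def by blast
  show ?thesis unfolding sobolev_eq_def
    by (intro exI[of _ "N1 \<union> N2"]) (use N1 N2 negligible_Un in auto)
qed

text \<open>For \<open>s > 0\<close> the order \<open>s + l\<close> is positive, so the functions
  agree everywhere and derivatives may be taken; agreement off a null set would not survive
  differentiation.\<close>

lemma nderiv_sobolev_eq:
  assumes "sobolev_eq a b (s + l) f g"
  shows "sobolev_eq a b l (nderiv a b s f) (nderiv a b s g)"
proof (cases s)
  case (Suc s')
  then have "f t = g t" if "t \<in> {a..b}" for t using assms that by (auto dest: sobolev_eqD)
  then show ?thesis by (intro sobolev_eqI nderiv_cong) auto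
qed (use assms in simp)

lemma vderiv_sobolev_eq:
  assumes ab: "a < b" and p: "1 \<le> p" and g: "sobolev_fun a b p l g" and fg: "primitive a b f g"
  shows "sobolev_eq a b l (vderiv a b f) g"
proof (cases l)
  case 0
  obtain N where "negligible N" "\<And>t. t \<in> {a..b} - N \<Longrightarrow> vderiv a b f t = g t"
    by (rule primitive_vderiv[OF ab fg]) (rule that)
  then show ?thesis unfolding sobolev_eq_def using 0 by blast
next
  case (Suc k)
  then have "continuous_on {a..b} g" using sobolev_fun_SucD(3)[OF ab p] g by blast
  then show ?thesis using primitive_vderiv_continuous[OF ab fg] by (intro sobolev_eqI) auto
qed

text \<open>A chain of successive primitives ending in \<open>z k\<close> consists of the
  derivatives of \<open>z 0\<close>. This is how the components of a first-order system are
  recognised as derivatives. The last link is determined only up to \<open>sobolev_eq\<close>, since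
  for \<open>l = 0\<close> differentiation gives \<open>z k\<close> back almost everywhere.\<close>

lemma nderiv_chain:
  assumes ab: "a < b" and p: "1 \<le> p"
    and "\<And>s. s < k \<Longrightarrow> primitive a b (z s) (z (Suc s))" "sobolev_fun a b p l (z k)"
  shows "sobolev_fun a b p (k + l) (z 0) \<and> sobolev_eq a b l (nderiv a b k (z 0)) (z k)"
  using assms(3,4)
proof (induction k arbitrary: z)
  case 0
  then show ?case by (auto intro: sobolev_eqI)
next
  case (Suc k)
  \<comment> \<open>The induction applies to the chain without its first member.\<close>
  have IH: "sobolev_fun a b p (k + l) (z (Suc 0))" "sobolev_eq a b l (nderiv a b k (z (Suc 0))) (z (Suc k))"
    using Suc.IH[of "\<lambda>s. z (Suc s)"] Suc.prems by auto
  have "primitive a b (z 0) (z (Suc 0))" using Suc.prems(1) by simp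
  note S = sobolev_fun_SucI[OF ab p IH(1) this] vderiv_sobolev_eq[OF ab p IH(1) this]
  have "sobolev_eq a b l (nderiv a b (Suc k) (z 0)) (nderiv a b k (z (Suc 0)))"
    unfolding nderiv_Suc_inner by (rule nderiv_sobolev_eq[OF S(2)])
  then show ?case using S(1) sobolev_eq_trans[OF _ IH(2)] by simp
qed

lemma nderiv_chain_below:
  assumes ab: "a < b" and p: "1 \<le> p"
    and z: "\<And>s. s < k \<Longrightarrow> primitive a b (z s) (z (Suc s))" "sobolev_fun a b p l (z k)"
    and s: "s \<le> k"
  shows "sobolev_fun a b p (k - s + l) (z s)" "s < k \<Longrightarrow> t \<in> {a..b} \<Longrightarrow> nderiv a b s (z 0) t = z s t"
proof -
  show *: "sobolev_fun a b p (k - s + l) (z s)"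
    using nderiv_chain[OF ab p, where k = "k - s" and z = "\<lambda>i. z (s + i)" and l = l] z s by simp
  show "nderiv a b s (z 0) t = z s t" if "s < k" "t \<in> {a..b}"
    using nderiv_chain[OF ab p, where k = s and z = z and l = "k - s + l"] z(1) * s that
    by (auto dest: sobolev_eqD)
qed

lemma sobolev_fun_lincomb:
  assumes "a < b" "1 \<le> p" "\<And>c. c \<in> C \<Longrightarrow> sobolev_fun a b p l (f c)"
  shows "sobolev_fun a b p l (\<lambda>t. \<Sum>c\<in>C. \<alpha> c * f c t)"
  by (intro sobolev_fun_sum sobolev_fun_cmult assms)

text \<open>Linear combinations of the derivatives again form a chain of primitives, so linearity
  comes from \<open>nderiv_chain\<close>. A pointwise rule could fail at the top order, where
  derivatives may not exist.\<close>

lemma nderiv_lincomb: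
  assumes ab: "a < b" and p: "1 \<le> p" and C: "finite C" and f: "\<And>c. c \<in> C \<Longrightarrow> sobolev_fun a b p (k + l) (f c)"
  shows "sobolev_eq a b l (nderiv a b k (\<lambda>t. \<Sum>c\<in>C. \<alpha> c * f c t)) (\<lambda>t. \<Sum>c\<in>C. \<alpha> c * nderiv a b k (f c) t)"
proof -
  have "sobolev_eq a b l (nderiv a b k (\<lambda>t. \<Sum>c\<in>C. \<alpha> c * nderiv a b 0 (f c) t)) (\<lambda>t. \<Sum>c\<in>C. \<alpha> c * nderiv a b k (f c) t)"
  proof (rule nderiv_chain[OF ab p, where z = "\<lambda>s t. \<Sum>c\<in>C. \<alpha> c * nderiv a b s (f c) t", THEN conjunct2])
    fix s assume "s < k"
    show "primitive a b (\<lambda>t. \<Sum>c\<in>C. \<alpha> c * nderiv a b s (f c) t) (\<lambda>t. \<Sum>c\<in>C. \<alpha> c * nderiv a b (Suc s) (f c) t)"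
    proof (rule primitive_lincomb[OF C])
      fix c assume "c \<in> C"
      then have "sobolev_fun a b p (Suc s + (k - Suc s + l)) (f c)" using f \<open>s < k\<close> by simp
      then show "primitive a b (nderiv a b s (f c)) (nderiv a b (Suc s) (f c))"
        by (rule primitive_nderiv[OF ab p])
    qed
  next
    show "sobolev_fun a b p l (\<lambda>t. \<Sum>c\<in>C. \<alpha> c * nderiv a b k (f c) t)"
      by (intro sobolev_fun_lincomb[OF ab p] sobolev_fun_nderiv[OF ab p] f)
  qed
  then show ?thesis by simp
qed

section \<open>The equation of order r as a first-order system\<close>

locale ode =
  fixes a b :: real and p :: ereal and n m r :: nat and A :: "nat \<Rightarrow> real \<Rightarrow> complex mat"
  assumes ab: "a < b" and m: "m \<ge> 1" and r: "r \<ge> 1" and p: "1 \<le> p"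
    and A: "\<And>s. s < r \<Longrightarrow> A s \<in> sobolev_mats a b p n m"
begin

text \<open>The \<open>k\<close>-th component of \<open>Ly\<close>, where \<open>y\<close> is given by its components.\<close>

definition L :: "(nat \<Rightarrow> real \<Rightarrow> complex) \<Rightarrow> nat \<Rightarrow> real \<Rightarrow> complex" where
  "L y k t = nderiv a b r (y k) t + (\<Sum>s<r. \<Sum>j<m. A s t $$ (k, j) * nderiv a b s (y j) t)"

lemma A_entry: "s < r \<Longrightarrow> k < m \<Longrightarrow> j < m \<Longrightarrow> sobolev_fun a b p n (\<lambda>t. A s t $$ (k, j))"
  using A by (auto simp: sobolev_mats_def)

lemma A_entry_integrable:
  "s < r \<Longrightarrow> k < m \<Longrightarrow> j < m \<Longrightarrow> (\<lambda>t. A s t $$ (k, j)) absolutely_integrable_on {a..b}"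
  using sobolev_fun_mono[OF ab p A_entry, of s k j 0] in_Lp_absolutely_integrable[OF p]
  by (simp add: sobolev_fun_def)

text \<open>The coefficients of the first-order system for \<open>z (s, k) = nderiv s (y k)\<close>.\<close>

definition comp_mat :: "nat \<times> nat \<Rightarrow> nat \<times> nat \<Rightarrow> real \<Rightarrow> complex" where
  "comp_mat = (\<lambda>(s, k) (s', j) t. if Suc s < r then (if s' = Suc s \<and> j = k then 1 else 0) else - A s' t $$ (k, j))"

sublocale sys: linear_system a b "{..<r} \<times> {..<m}" comp_mat
proof
  fix i j assume "i \<in> {..<r} \<times> {..<m}" "j \<in> {..<r} \<times> {..<m}"
  then obtain s k s' l where ij: "i = (s, k)" "j = (s', l)" "s' < r" "k < m" "l < m" by auto
  show "comp_mat i j absolutely_integrable_on {a..b}"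
  proof (cases "Suc s < r")
    case True
    then have "comp_mat i j = (\<lambda>t. if s' = Suc s \<and> l = k then 1 else 0)"
      by (simp add: ij comp_mat_def)
    then show ?thesis by (simp only: absolutely_integrable_continuous_real continuous_on_const)
  next
    case False
    then have "comp_mat i j = (\<lambda>t. - A s' t $$ (k, l))"
      by (simp add: ij comp_mat_def)
    then show ?thesis
      using absolutely_integrable_mult_continuous[OF continuous_on_const[of _ "- 1"] A_entry_integrable[OF ij(3-5)]]
      by simp
  qed
qed (use ab in auto)

text \<open>The coefficients form a block companion matrix: all blocks of rows but the last shift to
  the next derivative, the last one is the equation solved for the derivative of order
  \<open>r\<close>.\<close>

lemma comp_row:
  assumes "s < r" "k < m"
  shows "(\<Sum>j\<in>{..<r} \<times> {..<m}. comp_mat (s, k) j t * z j) =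
    (if Suc s < r then z (Suc s, k) else - (\<Sum>s<r. \<Sum>j<m. A s t $$ (k, j) * z (s, j)))"
proof (cases "Suc s < r")
  case True
  have "(\<Sum>j\<in>{..<r} \<times> {..<m}. comp_mat (s, k) j t * z j) = (\<Sum>j\<in>{..<r} \<times> {..<m}. if j = (Suc s, k) then z j else 0)"
    by (rule sum.cong) (auto simp: comp_mat_def True split: if_splits)
  also have "\<dots> = z (Suc s, k)" using True assms by simp
  finally show ?thesis using True by simp
next
  case False
  then show ?thesis
    by (simp add: sum.cartesian_product comp_mat_def case_prod_beta sum_negf)
qed

text \<open>The first-order system yields candidates for the derivatives below order
  \<open>r\<close> as continuous functions. Together with \<open>g\<close>, the value that the
  equation prescribes for the derivative of order \<open>r\<close>, they form a chain
  \<open>Z k\<close> of primitives, and \<open>nderiv_chain\<close> identifies its members as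
  derivatives.\<close>

lemma exists_solution:
  fixes f :: "nat \<Rightarrow> real \<Rightarrow> complex"
  assumes f: "\<And>k. k < m \<Longrightarrow> sobolev_fun a b p n (f k)"
  obtains y where "\<And>k. k < m \<Longrightarrow> sobolev_fun a b p (n + r) (y k)"
    "\<And>k s. k < m \<Longrightarrow> s < r \<Longrightarrow> nderiv a b s (y k) a = c s k"
    "\<And>k. k < m \<Longrightarrow> sobolev_eq a b n (L y k) (f k)"
proof -
  define h where "h = (\<lambda>(s, k). if Suc s < r then (\<lambda>_. 0) else f k)"
  have f0: "sobolev_fun a b p 0 (f k)" if "k < m" for k
    by (rule sobolev_fun_mono[OF ab p f[OF that]]) simp
  have "h i absolutely_integrable_on {a..b}" if "i \<in> {..<r} \<times> {..<m}" for i
    using that f0 in_Lp_absolutely_integrable[OF p] by (auto simp: h_def sobolev_fun_def)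
  then obtain z where z: "\<And>i. i \<in> {..<r} \<times> {..<m} \<Longrightarrow> continuous_on {a..b} (z i)"
    "\<And>i t. i \<in> {..<r} \<times> {..<m} \<Longrightarrow> t \<in> {a..b} \<Longrightarrow>
      z i t = c (fst i) (snd i) + integral {a..t} (\<lambda>s. (\<Sum>j\<in>{..<r} \<times> {..<m}. comp_mat i j s * z j s) + h i s)"
    using sys.exists_solution[of h "\<lambda>i. c (fst i) (snd i)"] by blast
  define g where "g k t = f k t - (\<Sum>s<r. \<Sum>j<m. A s t $$ (k, j) * z (s, j) t)" for k t
  define Z where "Z k s = (if s < r then z (s, k) else g k)" for k s
  \<comment> \<open>Starting level: the \<open>z (s, j)\<close> are so far only continuous, which
    keeps their products with the coefficients in L_p.\<close>
  have g0: "sobolev_fun a b p 0 (g k)" if "k < m" for k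
  proof -
    have "in_Lp a b p (\<lambda>t. A s t $$ (k, j) * z (s, j) t)" if "s < r" "j < m" for s j
    proof -
      have "in_Lp a b p (\<lambda>t. A s t $$ (k, j))"
        using sobolev_fun_mono[OF ab p A_entry[OF that(1) \<open>k < m\<close> that(2)], of 0] by (simp add: sobolev_fun_def)
      then have "in_Lp a b p (\<lambda>t. z (s, j) t * A s t $$ (k, j))"
        by (rule in_Lp_mult_continuous[OF p _ z(1)]) (use that in simp)
      moreover have "(\<lambda>t. z (s, j) t * A s t $$ (k, j)) = (\<lambda>t. A s t $$ (k, j) * z (s, j) t)"
        by (simp add: mult.commute)
      ultimately show ?thesis by simp
    qed
    then have "sobolev_fun a b p 0 (\<lambda>t. \<Sum>s<r. \<Sum>j<m. A s t $$ (k, j) * z (s, j) t)"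
      by (intro sobolev_fun_sum[OF ab p]) (simp add: sobolev_fun_def)
    from sobolev_fun_add[OF ab p f0[OF that] sobolev_fun_cmult[OF ab p this, of "- 1"]]
    show ?thesis by (simp add: g_def[abs_def])
  qed
  have init: "Z k s a = c s k" if "k < m" "s < r" for k s
    using z(2)[of "(s, k)" a] that ab by (simp add: Z_def)
  have chain: "primitive a b (Z k s) (Z k (Suc s))" if "k < m" "s < r" for k s
    unfolding primitive_def
  proof (intro conjI ballI)
    show "Z k (Suc s) absolutely_integrable_on {a..b}"
    proof (cases "Suc s < r")
      case True
      then have "continuous_on (cbox a b) (Z k (Suc s))" using z(1)[of "(Suc s, k)"] that by (simp add: Z_def)
      from absolutely_integrable_continuous[OF this] show ?thesis by simp
    next
      case False
      then show ?thesis using g0[OF that(1)] in_Lp_absolutely_integrable[OF p] by (simp add: Z_def sobolev_fun_def)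
    qed
    fix t assume t: "t \<in> {a..b}"
    have "(\<lambda>t. (\<Sum>j\<in>{..<r} \<times> {..<m}. comp_mat (s, k) j t * z j t) + h (s, k) t) = Z k (Suc s)"
      using comp_row[OF that(2,1)] by (auto simp: fun_eq_iff h_def Z_def g_def)
    then show "Z k s t = Z k s a + integral {a..t} (Z k (Suc s))"
      using z(2)[of "(s, k)" t] t that init[OF that] by (simp add: Z_def)
  qed
  \<comment> \<open>Bootstrapping: if all \<open>g k\<close> have order \<open>j\<close>, the chain
    gives \<open>z (s, i)\<close> the order \<open>r - s + j\<close>, at least \<open>j + 1\<close>
    because \<open>s < r\<close>. Products with coefficients of order \<open>n\<close> then have
    order \<open>j + 1\<close> as long as \<open>j + 1 \<le> n\<close>, and so has
    \<open>g k\<close>.\<close>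
  have reg: "sobolev_fun a b p j (g k)" if "j \<le> n" "k < m" for j k
    using that
  proof (induction j arbitrary: k)
    case (Suc j)
    have zs: "sobolev_fun a b p (Suc j) (z (s, i))" if "s < r" "i < m" for s i
    proof -
      have "sobolev_fun a b p j (Z i r)" using Suc.IH[of i] Suc.prems that by (simp add: Z_def)
      from nderiv_chain_below(1)[OF ab p chain[OF that(2)] this, of s]
      have "sobolev_fun a b p (r - s + j) (z (s, i))" using that by (simp add: Z_def)
      then show ?thesis by (rule sobolev_fun_mono[OF ab p]) (use that in auto)
    qed
    have "sobolev_fun a b p (Suc j) (\<lambda>t. A s t $$ (k, i) * z (s, i) t)" if "s < r" "i < m" for s i
      by (rule sobolev_fun_mult[OF ab p sobolev_fun_mono[OF ab p A_entry] zs]) (use that Suc.prems in auto)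
    then have "sobolev_fun a b p (Suc j) (\<lambda>t. \<Sum>s<r. \<Sum>i<m. A s t $$ (k, i) * z (s, i) t)"
      by (intro sobolev_fun_sum[OF ab p]) auto
    from sobolev_fun_add[OF ab p sobolev_fun_mono[OF ab p f[OF Suc.prems(2)] Suc.prems(1)] sobolev_fun_cmult[OF ab p this, of "- 1"]]
    show ?case by (simp add: g_def[abs_def])
  qed (use g0 in simp)
  have gn: "sobolev_fun a b p n (Z k r)" if "k < m" for k using reg[OF order_refl that] by (simp add: Z_def)
  have below: "nderiv a b s (Z k 0) t = z (s, k) t" if "k < m" "s < r" "t \<in> {a..b}" for k s t
    using nderiv_chain_below(2)[OF ab p chain[OF that(1)] gn[OF that(1)], of s t] that by (simp add: Z_def)
  have top: "sobolev_fun a b p (r + n) (Z k 0)" "sobolev_eq a b n (nderiv a b r (Z k 0)) (Z k r)" if "k < m" for k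
    using nderiv_chain[OF ab p chain[OF that] gn[OF that]] by auto
  show thesis
  proof (rule that[of "\<lambda>k. Z k 0"])
    fix k assume k: "k < m"
    show "sobolev_fun a b p (n + r) (Z k 0)" using top(1)[OF k] by (simp add: add.commute)
    show "nderiv a b s (Z k 0) a = c s k" if "s < r" for s
      using below[OF k that, of a] init[OF k that] ab that by (simp add: Z_def)
    obtain N where N: "negligible N" "n > 0 \<Longrightarrow> N = {}"
      "\<And>t. t \<in> {a..b} - N \<Longrightarrow> nderiv a b r (Z k 0) t = Z k r t"
      using sobolev_eqE[OF top(2)[OF k]] by blast
    have "L (\<lambda>k. Z k 0) k t = f k t" if "t \<in> {a..b} - N" for t
      using N(3)[OF that] below[of _ _ t] that by (simp add: L_def Z_def g_def)
    then show "sobolev_eq a b n (L (\<lambda>k. Z k 0) k) (f k)"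
      using N unfolding sobolev_eq_def by blast
  qed
qed

text \<open>The differences of the derivatives solve the homogeneous first-order system with initial
  value 0, up to a null set that integration does not see.\<close>

lemma solution_unique:
  assumes y: "\<And>k. k < m \<Longrightarrow> sobolev_fun a b p (n + r) (y k)" "\<And>k. k < m \<Longrightarrow> sobolev_fun a b p (n + r) (y' k)"
    and init: "\<And>k s. k < m \<Longrightarrow> s < r \<Longrightarrow> nderiv a b s (y k) a = nderiv a b s (y' k) a"
    and N: "negligible N" and eq: "\<And>k t. k < m \<Longrightarrow> t \<in> {a..b} - N \<Longrightarrow> L y k t = L y' k t"
    and k: "k < m" and t: "t \<in> {a..b}"
  shows "y k t = y' k t"
proof -
  define z where "z = (\<lambda>(s, k) t. nderiv a b s (y k) t - nderiv a b s (y' k) t)"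
  have prim: "primitive a b (z (s, k)) (z (Suc s, k))" if "s < r" "k < m" for s k
  proof -
    have "primitive a b (nderiv a b s (y k)) (nderiv a b (Suc s) (y k))" "primitive a b (nderiv a b s (y' k)) (nderiv a b (Suc s) (y' k))"
      using y that by (intro primitive_nderiv[OF ab p, of s "n + r - Suc s"]; simp)+
    from primitive_add[OF this(1) primitive_cmult[OF this(2), of "- 1"]]
    show ?thesis by (simp add: z_def)
  qed
  have "z (0, k) t = 0"
  proof (rule sys.unique)
    fix i assume i: "i \<in> {..<r} \<times> {..<m}"
    show "continuous_on {a..b} (z i)" using primitive_continuous_on[OF prim, of "fst i" "snd i"] i by auto
    fix t assume t: "t \<in> {a..b}"
    obtain s k where sk: "i = (s, k)" "s < r" "k < m" using i by auto
    have "z i t = integral {a..t} (z (Suc s, k))"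
      using primitiveD[OF prim[OF sk(2,3)] t] init[OF sk(3,2)] by (simp add: z_def sk(1))
    also have "\<dots> = integral {a..t} (\<lambda>t. \<Sum>j\<in>{..<r} \<times> {..<m}. comp_mat i j t * z j t)"
    proof (rule integral_spike[OF N])
      fix x assume x: "x \<in> {a..t} - N"
      show "(\<Sum>j\<in>{..<r} \<times> {..<m}. comp_mat i j x * z j x) = z (Suc s, k) x"
      proof (cases "Suc s < r")
        case True
        then show ?thesis using comp_row[OF sk(2,3), of x "\<lambda>j. z j x"] by (simp add: sk(1))
      next
        case False
        \<comment> \<open>Last block of rows: here the two equations are compared, which the
          assumption allows off \<open>N\<close> only.\<close>
        then have "Suc s = r" using sk by simp
        moreover have "L y k x = L y' k x" using eq sk x t by auto
        moreover have "(\<Sum>j\<in>{..<r} \<times> {..<m}. comp_mat i j x * z j x) = - (\<Sum>s<r. \<Sum>j<m. A s x $$ (k, j) * z (s, j) x)"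
          using comp_row[OF sk(2,3), of x "\<lambda>j. z j x"] False by (simp add: sk(1))
        ultimately show ?thesis
          by (simp add: L_def z_def right_diff_distrib sum_subtractf del: nderiv.simps(2)) (simp add: algebra_simps)
      qed
    qed
    finally show "z i t = integral {a..t} (\<lambda>t. \<Sum>j\<in>{..<r} \<times> {..<m}. comp_mat i j t * z j t)" .
  qed (use k t r in auto)
  then show ?thesis by (simp add: z_def)
qed

text \<open>Derivatives of order \<open>s < r\<close> have Sobolev order at least
  \<open>n + 1\<close>, one more than the coefficients, which is the situation of
  \<open>sobolev_fun_mult_smoother\<close>.\<close>

lemma L_sobolev:
  assumes y: "\<And>k. k < m \<Longrightarrow> sobolev_fun a b p (n + r) (y k)" and k: "k < m"
  shows "sobolev_fun a b p n (L y k)"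
proof -
  have "sobolev_fun a b p n (\<lambda>t. A s t $$ (k, j) * nderiv a b s (y j) t)" if "s < r" "j < m" for s j
  proof (rule sobolev_fun_mult_smoother[OF ab p A_entry[OF that(1) k that(2)]])
    have "sobolev_fun a b p (s + (n + r - s)) (y j)" using y that by simp
    from sobolev_fun_nderiv[OF ab p this] show "sobolev_fun a b p (Suc n) (nderiv a b s (y j))"
      by (rule sobolev_fun_mono[OF ab p]) (use that in simp)
  qed
  then have "sobolev_fun a b p n (\<lambda>t. \<Sum>s<r. \<Sum>j<m. A s t $$ (k, j) * nderiv a b s (y j) t)"
    by (intro sobolev_fun_sum[OF ab p]) auto
  moreover have "sobolev_fun a b p n (nderiv a b r (y k))"
    by (rule sobolev_fun_nderiv[OF ab p]) (use y[OF k] in \<open>simp add: add.commute\<close>)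
  ultimately show ?thesis unfolding L_def by (intro sobolev_fun_add[OF ab p])
qed

lemma L_cong:
  assumes "\<And>k t. k < m \<Longrightarrow> t \<in> {a..b} \<Longrightarrow> y k t = y' k t" "k < m" "t \<in> {a..b}"
  shows "L y k t = L y' k t"
  unfolding L_def using nderiv_cong[of a b, OF assms(1) assms(3)] assms(2) by simp

lemma nderiv_lincomb_below:
  assumes "finite C" "\<And>c. c \<in> C \<Longrightarrow> sobolev_fun a b p (n + r) (f c)" "s < r" "t \<in> {a..b}"
  shows "nderiv a b s (\<lambda>t. \<Sum>c\<in>C. \<alpha> c * f c t) t = (\<Sum>c\<in>C. \<alpha> c * nderiv a b s (f c) t)"
  using nderiv_lincomb[OF ab p assms(1), where k = s and l = "n + r - s" and f = f and \<alpha> = \<alpha>] assms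
  by (auto dest: sobolev_eqD)

text \<open>The derivatives of order below \<open>r\<close> are linear at every point of the
  interval; it is the derivative of order \<open>r\<close> that restricts the equality to
  \<open>sobolev_eq\<close>.\<close>

lemma L_lincomb:
  assumes C: "finite C" and y: "\<And>c k. c \<in> C \<Longrightarrow> k < m \<Longrightarrow> sobolev_fun a b p (n + r) (y c k)" and k: "k < m"
  shows "sobolev_eq a b n (L (\<lambda>k t. \<Sum>c\<in>C. \<alpha> c * y c k t) k) (\<lambda>t. \<Sum>c\<in>C. \<alpha> c * L (y c) k t)"
proof -
  have top: "sobolev_eq a b n (nderiv a b r (\<lambda>t. \<Sum>c\<in>C. \<alpha> c * y c k t)) (\<lambda>t. \<Sum>c\<in>C. \<alpha> c * nderiv a b r (y c k) t)"
    by (rule nderiv_lincomb[OF ab p C]) (use y k in \<open>simp add: add.commute\<close>)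
  obtain N where N: "negligible N" "n > 0 \<Longrightarrow> N = {}"
    "\<And>t. t \<in> {a..b} - N \<Longrightarrow> nderiv a b r (\<lambda>t. \<Sum>c\<in>C. \<alpha> c * y c k t) t = (\<Sum>c\<in>C. \<alpha> c * nderiv a b r (y c k) t)"
    by (rule sobolev_eqE[OF top]) (rule that)
  have "L (\<lambda>k t. \<Sum>c\<in>C. \<alpha> c * y c k t) k t = (\<Sum>c\<in>C. \<alpha> c * L (y c) k t)" if t: "t \<in> {a..b} - N" for t
  proof -
    have "(\<Sum>s<r. \<Sum>j<m. A s t $$ (k, j) * nderiv a b s (\<lambda>t. \<Sum>c\<in>C. \<alpha> c * y c j t) t)
        = (\<Sum>s<r. \<Sum>j<m. \<Sum>c\<in>C. \<alpha> c * (A s t $$ (k, j) * nderiv a b s (y c j) t))"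
    proof (intro sum.cong refl)
      fix s j assume "s \<in> {..<r}" "j \<in> {..<m}"
      then have "nderiv a b s (\<lambda>t. \<Sum>c\<in>C. \<alpha> c * y c j t) t = (\<Sum>c\<in>C. \<alpha> c * nderiv a b s (y c j) t)"
        using t by (intro nderiv_lincomb_below[OF C y]) auto
      then show "A s t $$ (k, j) * nderiv a b s (\<lambda>t. \<Sum>c\<in>C. \<alpha> c * y c j t) t =
          (\<Sum>c\<in>C. \<alpha> c * (A s t $$ (k, j) * nderiv a b s (y c j) t))"
        by (simp add: sum_distrib_left mult.left_commute)
    qed
    also have "\<dots> = (\<Sum>c\<in>C. \<alpha> c * (\<Sum>s<r. \<Sum>j<m. A s t $$ (k, j) * nderiv a b s (y c j) t))"
      by (simp add: sum_distrib_left sum.swap[of _ C])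
    finally show ?thesis using N(3)[OF t] by (simp add: L_def sum.distrib distrib_left)
  qed
  then show ?thesis unfolding sobolev_eq_def using N by blast
qed

end

section \<open>Quotient spaces and cokernels\<close>

lemma submodule_abelian_subgroup:
  assumes "module K V" "submodule K H V"
  shows "abelian_subgroup H V"
proof -
  interpret V: module K V by fact
  interpret H: submodule K H V by fact
  show ?thesis
  proof (rule abelian_subgroupI3)
    show "additive_subgroup H V"
    proof (rule additive_subgroup.intro, unfold_locales)
      show "H \<subseteq> carrier (add_monoid V)" using H.subset by simp
      show "x \<otimes>\<^bsub>add_monoid V\<^esub> y \<in> H" if "x \<in> H" "y \<in> H" for x y using that by simp
      show "\<one>\<^bsub>add_monoid V\<^esub> \<in> H" by simp
      show "inv\<^bsub>add_monoid V\<^esub> x \<in> H" if "x \<in> H" for x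
      proof -
        have "(\<ominus>\<^bsub>K\<^esub> \<one>\<^bsub>K\<^esub>) \<odot>\<^bsub>V\<^esub> x \<in> H" using that by (intro H.smult_closed) simp_all
        moreover have "x \<in> carrier V" using H.subset that by blast
        ultimately have "\<ominus>\<^bsub>V\<^esub> x \<in> H" using V.smult_minus_1[of x] by simp
        then show ?thesis by (simp add: a_inv_def)
      qed
    qed
    show "abelian_group V" by unfold_locales
  qed
qed

lemma quotient_module_simps:
  "carrier (quotient_module V H) = a_rcosets\<^bsub>V\<^esub> H" "zero (quotient_module V H) = H"
  "add (quotient_module V H) = set_add V"
  "smult (quotient_module V H) = (\<lambda>c X. \<Union>x\<in>X. a_r_coset V H (c \<odot>\<^bsub>V\<^esub> x))"
  by (simp_all add: quotient_module_def)

context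
  fixes K :: "('a, 'k) ring_scheme" and V :: "('a, 'c) module" and H :: "'c set"
  assumes vs: "vectorspace K V" and sub: "submodule K H V"
begin

interpretation V: vectorspace K V by (rule vs)
interpretation H: submodule K H V by (rule sub)
interpretation S: abelian_subgroup H V by (rule submodule_abelian_subgroup[OF V.module_axioms sub])

lemma coset_eq_iff:
  assumes "x \<in> carrier V" "y \<in> carrier V"
  shows "a_r_coset V H x = a_r_coset V H y \<longleftrightarrow> x \<ominus>\<^bsub>V\<^esub> y \<in> H"
  using S.a_repr_independence'[of x y] S.a_repr_independenceD[of x y] S.a_rcos_module[of y x] assms
  by (auto simp: a_minus_def)

text \<open>All sets in the union that defines scalar multiplication on
  \<open>quotient_module\<close> are the same coset, so the choice of representatives is
  immaterial.\<close>

lemma coset_smult: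
  assumes c: "c \<in> carrier K" and x: "x \<in> carrier V"
  shows "(\<Union>x'\<in>a_r_coset V H x. a_r_coset V H (c \<odot>\<^bsub>V\<^esub> x')) = a_r_coset V H (c \<odot>\<^bsub>V\<^esub> x)"
proof -
  have "a_r_coset V H (c \<odot>\<^bsub>V\<^esub> x') = a_r_coset V H (c \<odot>\<^bsub>V\<^esub> x)" if "x' \<in> a_r_coset V H x" for x'
  proof -
    have x': "x' \<in> carrier V" by (rule S.a_elemrcos_carrier[OF x that])
    have "x' \<ominus>\<^bsub>V\<^esub> x \<in> H" using S.a_rcos_module[OF x x'] that by (simp add: a_minus_def)
    then have "c \<odot>\<^bsub>V\<^esub> (x' \<ominus>\<^bsub>V\<^esub> x) \<in> H" using c by simp
    moreover have "c \<odot>\<^bsub>V\<^esub> (x' \<ominus>\<^bsub>V\<^esub> x) = c \<odot>\<^bsub>V\<^esub> x' \<ominus>\<^bsub>V\<^esub> c \<odot>\<^bsub>V\<^esub> x"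
      using c x x' by (simp add: a_minus_def V.smult_r_distr V.smult_r_minus)
    ultimately show ?thesis using coset_eq_iff c x x' by simp
  qed
  moreover have "x \<in> a_r_coset V H x" by (rule S.a_rcos_self[OF x])
  ultimately show ?thesis by blast
qed

lemma quotient_carrierE:
  assumes "X \<in> carrier (quotient_module V H)"
  obtains x where "x \<in> carrier V" "X = a_r_coset V H x"
  using assms by (auto simp: quotient_module_simps A_RCOSETS_def')

lemma quotient_carrierI: "x \<in> carrier V \<Longrightarrow> a_r_coset V H x \<in> carrier (quotient_module V H)"
  by (auto simp: quotient_module_simps A_RCOSETS_def')

lemma quotient_add:
  "x \<in> carrier V \<Longrightarrow> y \<in> carrier V \<Longrightarrow>
    a_r_coset V H x \<oplus>\<^bsub>quotient_module V H\<^esub> a_r_coset V H y = a_r_coset V H (x \<oplus>\<^bsub>V\<^esub> y)"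
  by (simp add: quotient_module_simps S.a_rcos_sum)

lemma quotient_smult:
  "c \<in> carrier K \<Longrightarrow> x \<in> carrier V \<Longrightarrow> c \<odot>\<^bsub>quotient_module V H\<^esub> a_r_coset V H x = a_r_coset V H (c \<odot>\<^bsub>V\<^esub> x)"
  by (simp add: quotient_module_simps coset_smult)

lemma quotient_zero: "\<zero>\<^bsub>quotient_module V H\<^esub> = a_r_coset V H \<zero>\<^bsub>V\<^esub>"
  using S.a_rcos_const[of "\<zero>\<^bsub>V\<^esub>"] by (simp add: quotient_module_simps)

lemma quotient_vectorspace: "vectorspace K (quotient_module V H)"
proof (rule vs_criteria)
  let ?Q = "quotient_module V H"
  note simps = quotient_add quotient_smult quotient_zero quotient_carrierI
  show "field K" by unfold_locales
  show "\<zero>\<^bsub>?Q\<^esub> \<in> carrier ?Q" by (simp add: simps)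
  show "\<forall>v w. v \<in> carrier ?Q \<and> w \<in> carrier ?Q \<longrightarrow> v \<oplus>\<^bsub>?Q\<^esub> w \<in> carrier ?Q"
    by (intro allI impI; elim conjE quotient_carrierE; simp add: simps)
  show "\<forall>v\<in>carrier ?Q. \<exists>neg_v\<in>carrier ?Q. v \<oplus>\<^bsub>?Q\<^esub> neg_v = \<zero>\<^bsub>?Q\<^esub>"
  proof
    fix v assume "v \<in> carrier ?Q"
    then obtain x where x: "x \<in> carrier V" "v = a_r_coset V H x" by (rule quotient_carrierE)
    then show "\<exists>neg_v\<in>carrier ?Q. v \<oplus>\<^bsub>?Q\<^esub> neg_v = \<zero>\<^bsub>?Q\<^esub>"
      by (intro bexI[of _ "a_r_coset V H (\<ominus>\<^bsub>V\<^esub> x)"]) (simp_all add: simps V.M.r_neg)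
  qed
  show "\<forall>c v. c \<in> carrier K \<and> v \<in> carrier ?Q \<longrightarrow> c \<odot>\<^bsub>?Q\<^esub> v \<in> carrier ?Q"
    by (intro allI impI; elim conjE quotient_carrierE; simp add: simps)
  show "\<forall>v w. v \<in> carrier ?Q \<and> w \<in> carrier ?Q \<longrightarrow> v \<oplus>\<^bsub>?Q\<^esub> w = w \<oplus>\<^bsub>?Q\<^esub> v"
    by (intro allI impI; elim conjE quotient_carrierE; simp add: simps V.M.a_comm)
  show "\<forall>v w x. v \<in> carrier ?Q \<and> w \<in> carrier ?Q \<and> x \<in> carrier ?Q \<longrightarrow>
      v \<oplus>\<^bsub>?Q\<^esub> w \<oplus>\<^bsub>?Q\<^esub> x = v \<oplus>\<^bsub>?Q\<^esub> (w \<oplus>\<^bsub>?Q\<^esub> x)"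
    by (intro allI impI; elim conjE quotient_carrierE; simp add: simps V.M.a_assoc)
  show "\<forall>v\<in>carrier ?Q. v \<oplus>\<^bsub>?Q\<^esub> \<zero>\<^bsub>?Q\<^esub> = v"
    by (intro ballI; elim quotient_carrierE; simp add: simps)
  show "\<forall>a b v. a \<in> carrier K \<and> b \<in> carrier K \<and> v \<in> carrier ?Q \<longrightarrow>
      (a \<otimes>\<^bsub>K\<^esub> b) \<odot>\<^bsub>?Q\<^esub> v = a \<odot>\<^bsub>?Q\<^esub> (b \<odot>\<^bsub>?Q\<^esub> v)"
    by (intro allI impI; elim conjE quotient_carrierE; simp add: simps V.smult_assoc1)
  show "\<forall>v\<in>carrier ?Q. \<one>\<^bsub>K\<^esub> \<odot>\<^bsub>?Q\<^esub> v = v"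
    by (intro ballI; elim quotient_carrierE; simp add: simps)
  show "\<forall>a b v. a \<in> carrier K \<and> b \<in> carrier K \<and> v \<in> carrier ?Q \<longrightarrow>
      (a \<oplus>\<^bsub>K\<^esub> b) \<odot>\<^bsub>?Q\<^esub> v = a \<odot>\<^bsub>?Q\<^esub> v \<oplus>\<^bsub>?Q\<^esub> b \<odot>\<^bsub>?Q\<^esub> v"
    by (intro allI impI; elim conjE quotient_carrierE; simp add: simps V.smult_l_distr)
  show "\<forall>a v w. a \<in> carrier K \<and> v \<in> carrier ?Q \<and> w \<in> carrier ?Q \<longrightarrow>
      a \<odot>\<^bsub>?Q\<^esub> (v \<oplus>\<^bsub>?Q\<^esub> w) = a \<odot>\<^bsub>?Q\<^esub> v \<oplus>\<^bsub>?Q\<^esub> a \<odot>\<^bsub>?Q\<^esub> w"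
    by (intro allI impI; elim conjE quotient_carrierE; simp add: simps V.smult_r_distr)
qed

lemma coset_linear_map: "linear_map K V (quotient_module V H) (a_r_coset V H)"
proof -
  interpret Q: vectorspace K "quotient_module V H" by (rule quotient_vectorspace)
  show ?thesis
    by unfold_locales (simp add: module_hom_def quotient_add quotient_smult quotient_carrierI)
qed

lemma coset_surj: "a_r_coset V H ` carrier V = carrier (quotient_module V H)"
  by (auto elim: quotient_carrierE intro: quotient_carrierI)

lemma coset_ker: "mod_hom.ker V (quotient_module V H) (a_r_coset V H) = H"
proof -
  interpret T: linear_map K V "quotient_module V H" "a_r_coset V H" by (rule coset_linear_map)
  have "a_r_coset V H x = a_r_coset V H \<zero>\<^bsub>V\<^esub> \<longleftrightarrow> x \<in> H" if "x \<in> carrier V" for x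
  proof -
    have "\<ominus>\<^bsub>V\<^esub> \<zero>\<^bsub>V\<^esub> = \<zero>\<^bsub>V\<^esub>" by (rule V.M.minus_equality) simp_all
    then have "x \<ominus>\<^bsub>V\<^esub> \<zero>\<^bsub>V\<^esub> = x" unfolding a_minus_def using that by (simp only: V.M.r_zero)
    then show ?thesis using coset_eq_iff[OF that, of "\<zero>\<^bsub>V\<^esub>"] by simp
  qed
  then show ?thesis
    unfolding T.ker_def quotient_zero using H.subset by auto
qed

end

section \<open>Dimension counts\<close>

text \<open>Rank and nullity are counted for \<open>T\<close> and for the projection onto the
  quotient. Both maps are onto and share domain and kernel, so the targets have equal dimension,
  without an explicit isomorphism.\<close>

lemma dim_quotient_ker:
  assumes T: "linear_map K V W T" and fd: "vectorspace.fin_dim K V" and surj: "T ` carrier V = carrier W"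
    and ker: "mod_hom.ker V W T = H"
  shows "vectorspace.fin_dim K W \<and> vectorspace.dim K W = vectorspace.dim K (quotient_module V H)"
proof -
  interpret T: linear_map K V W T by (rule T)
  have sub: "submodule K H V" using T.ker_is_submodule ker by simp
  interpret C: linear_map K V "quotient_module V H" "a_r_coset V H"
    by (rule coset_linear_map[OF T.V.vectorspace_axioms sub])
  have "vectorspace.dim K (W\<lparr>carrier := T.im\<rparr>) + vectorspace.dim K (V\<lparr>carrier := H\<rparr>) = T.V.dim"
    using T.rank_nullity[OF fd] ker by simp
  moreover have "vectorspace.dim K ((quotient_module V H)\<lparr>carrier := C.im\<rparr>) + vectorspace.dim K (V\<lparr>carrier := H\<rparr>) = T.V.dim"
    using C.rank_nullity[OF fd] coset_ker[OF T.V.vectorspace_axioms sub] by simp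
  moreover have "W\<lparr>carrier := T.im\<rparr> = W" using surj by (simp add: T.im_def)
  moreover have "(quotient_module V H)\<lparr>carrier := C.im\<rparr> = quotient_module V H"
    using coset_surj[OF T.V.vectorspace_axioms sub] by (simp add: C.im_def)
  moreover have "T.W.fin_dim" by (rule T.surj_fin_dim[OF fd surj])
  ultimately show ?thesis by simp
qed

text \<open>Independent subsets of \<open>W\<close> stay independent in the whole space, so their
  size is bounded by \<open>dim\<close>. A maximal one therefore exists and is a basis of
  \<open>W\<close>.\<close>

lemma (in vectorspace) subspace_fin_dim:
  assumes fd: "fin_dim" and W: "submodule K W V"
  shows "vectorspace.fin_dim K (vs W)"
proof -
  interpret W: vectorspace K "vs W"
    by (rule subspace_is_vs) (simp add: subspace_def W vectorspace_axioms)
  have WV: "W \<subseteq> carrier V" using W by (simp add: submodule_def)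
  have li: "W.lin_dep S = lin_dep S" if "S \<subseteq> W" for S
    using span_li_not_depend(2)[OF that W] .
  have "\<exists>S. finite S \<and> maximal S (\<lambda>S. S \<subseteq> W \<and> W.lin_indpt S)"
  proof (rule maximal_exists)
    show "finite S \<and> card S \<le> dim" if "S \<subseteq> W \<and> W.lin_indpt S" for S
      using li_le_dim[OF fd, of S] that li WV by blast
    show "{} \<subseteq> W \<and> W.lin_indpt {}" by (auto simp: W.lin_dep_def)
  qed
  then obtain S where S: "finite S" "maximal S (\<lambda>S. S \<subseteq> carrier (vs W) \<and> W.lin_indpt S)" by auto
  then have "W.basis S" by (intro W.max_li_is_basis)
  then show ?thesis using S(1) unfolding W.fin_dim_def W.basis_def by blast
qed

text \<open>If \<open>\<Psi>\<close> parametrises the kernel of the surjection \<open>y \<mapsto> L y + N\<close>, then \<open>(L, B)\<close> and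
  \<open>B \<circ> \<Psi>\<close> have isomorphic kernels and cokernels; the second isomorphism is induced by
  \<open>q \<mapsto> (0, q)\<close>.\<close>

lemma kernel_cokernel_dim:
  fixes K :: "('a, 'k) ring_scheme" and F :: "('a, 'f) module"
    and X :: "('a, 'x) module" and C :: "('a, 'c) module" and N :: "'f set"
  defines "Q \<equiv> quotient_module F N"
  defines "Z \<equiv> direct_sum Q C"
  assumes X: "vectorspace K X" and F: "vectorspace K F" and N: "submodule K N F"
    and C: "vectorspace K C" and fd: "vectorspace.fin_dim K C"
    and L: "(\<lambda>y. a_r_coset F N (L y)) \<in> LinearCombinations.module_hom K X Q"
    and B: "B \<in> LinearCombinations.module_hom K X C"
    and \<Psi>: "\<Psi> \<in> LinearCombinations.module_hom K C X" and inj: "inj_on \<Psi> (carrier C)"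
    and kerL: "\<And>y. y \<in> carrier X \<Longrightarrow> a_r_coset F N (L y) = \<zero>\<^bsub>Q\<^esub> \<longleftrightarrow> y \<in> \<Psi> ` carrier C"
    and surj: "\<And>f. f \<in> carrier F \<Longrightarrow> \<exists>y\<in>carrier X. a_r_coset F N (L y) = a_r_coset F N f"
    and M: "\<And>v. v \<in> carrier C \<Longrightarrow> M v = B (\<Psi> v)"
  defines "LB \<equiv> \<lambda>y. (a_r_coset F N (L y), B y)"
  shows "vectorspace.fin_dim K (kernel_module X Z LB) \<and>
    vectorspace.fin_dim K (cokernel_module X Z LB) \<and>
    vectorspace.dim K (kernel_module X Z LB) = vectorspace.dim K (kernel_module C C M) \<and>
    vectorspace.dim K (cokernel_module X Z LB) = vectorspace.dim K (cokernel_module C C M)"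
proof -
  define L' where "L' y = a_r_coset F N (L y)" for y
  interpret X: vectorspace K X by (rule X)
  interpret C: vectorspace K C by (rule C)
  interpret Q: vectorspace K Q unfolding Q_def by (rule quotient_vectorspace[OF F N])
  interpret Z: vectorspace K Z
    unfolding Z_def by (rule direct_sum_is_vs) unfold_locales
  have Zs: "carrier Z = carrier Q \<times> carrier C" "\<zero>\<^bsub>Z\<^esub> = (\<zero>\<^bsub>Q\<^esub>, \<zero>\<^bsub>C\<^esub>)"
    "\<And>v w. v \<oplus>\<^bsub>Z\<^esub> w = (fst v \<oplus>\<^bsub>Q\<^esub> fst w, snd v \<oplus>\<^bsub>C\<^esub> snd w)"
    "\<And>c v. c \<odot>\<^bsub>Z\<^esub> v = (c \<odot>\<^bsub>Q\<^esub> fst v, c \<odot>\<^bsub>C\<^esub> snd v)"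
    by (simp_all add: Z_def direct_sum_def)
  have L': "L' \<in> LinearCombinations.module_hom K X Q" using L by (simp add: L'_def[abs_def])
  interpret L': mod_hom K X Q L' by unfold_locales (rule L')
  interpret B: mod_hom K X C B by unfold_locales (rule B)
  interpret P: mod_hom K C X \<Psi> by unfold_locales (rule \<Psi>)
  have LB: "LB y = (L' y, B y)" for y by (simp add: LB_def L'_def)
  interpret LB: linear_map K X Z LB
    by unfold_locales (simp add: module_hom_def LB Zs Pi_iff)
  interpret M: linear_map K C C M
    by unfold_locales (simp add: module_hom_def M Pi_iff)
  have kerL': "L' y = \<zero>\<^bsub>Q\<^esub> \<longleftrightarrow> y \<in> \<Psi> ` carrier C" if "y \<in> carrier X" for y
    using kerL[OF that] by (simp add: L'_def)

  \<comment> \<open>Since \<open>\<Psi>\<close> parametrises the kernel of \<open>L'\<close>, the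
    condition that \<open>B\<close> vanish at \<open>\<Psi> v\<close> becomes
    \<open>M v = 0\<close>.\<close>
  have ker_LB: "LB.ker = \<Psi> ` M.ker"
    using kerL' by (auto simp: LB.ker_def M.ker_def LB Zs M)
  interpret KM: vectorspace K "kernel_module C C M"
    unfolding kernel_module_def by (rule C.subspace_is_vs[OF M.kerT_is_subspace])
  interpret KLB: vectorspace K "kernel_module X Z LB"
    unfolding kernel_module_def by (rule X.subspace_is_vs[OF LB.kerT_is_subspace])
  interpret PK: linear_map K "kernel_module C C M" "kernel_module X Z LB" \<Psi>
    by unfold_locales (auto simp: module_hom_def kernel_module_def ker_LB, auto simp: M.ker_def)
  have PKs: "inj_on \<Psi> (carrier (kernel_module C C M))" "\<Psi> ` carrier (kernel_module C C M) = carrier (kernel_module X Z LB)"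
    using inj by (auto simp: kernel_module_def ker_LB M.ker_def inj_on_def)
  have "KM.fin_dim"
    unfolding kernel_module_def by (rule C.subspace_fin_dim[OF fd M.ker_is_submodule])
  note ker = PK.surj_fin_dim[OF this PKs(2)] PK.dim_eq[OF this PKs]

  define \<theta> where "\<theta> q = a_r_coset Z LB.im (\<zero>\<^bsub>Q\<^esub>, q)" for q
  interpret CL: linear_map K Z "cokernel_module X Z LB" "a_r_coset Z LB.im"
    unfolding cokernel_module_def by (rule coset_linear_map[OF Z.vectorspace_axioms LB.im_is_submodule])
  note eq_iff = coset_eq_iff[OF Z.vectorspace_axioms LB.im_is_submodule]
  have \<theta>: "linear_map K C (cokernel_module X Z LB) \<theta>"
  proof unfold_locales
    have "a_r_coset Z LB.im (\<zero>\<^bsub>Q\<^esub>, q \<oplus>\<^bsub>C\<^esub> q') = \<theta> q \<oplus>\<^bsub>cokernel_module X Z LB\<^esub> \<theta> q'"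
      if "q \<in> carrier C" "q' \<in> carrier C" for q q'
      using CL.T_add[of "(\<zero>\<^bsub>Q\<^esub>, q)" "(\<zero>\<^bsub>Q\<^esub>, q')"] that by (simp add: \<theta>_def Zs)
    moreover have "a_r_coset Z LB.im (\<zero>\<^bsub>Q\<^esub>, c \<odot>\<^bsub>C\<^esub> q) = c \<odot>\<^bsub>cokernel_module X Z LB\<^esub> \<theta> q"
      if "c \<in> carrier K" "q \<in> carrier C" for c q
      using CL.T_smult[of c "(\<zero>\<^bsub>Q\<^esub>, q)"] that by (simp add: \<theta>_def Zs)
    moreover have "\<theta> q \<in> carrier (cokernel_module X Z LB)" if "q \<in> carrier C" for q
      using CL.T_im[of "(\<zero>\<^bsub>Q\<^esub>, q)"] that by (simp add: \<theta>_def Zs)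
    ultimately show "\<theta> \<in> LinearCombinations.module_hom K C (cokernel_module X Z LB)"
      by (simp add: module_hom_def \<theta>_def)
  qed
  interpret \<theta>: linear_map K C "cokernel_module X Z LB" \<theta> by (rule \<theta>)
  have sub0: "(x, q) \<ominus>\<^bsub>Z\<^esub> (x', q') = (x \<ominus>\<^bsub>Q\<^esub> x', q \<ominus>\<^bsub>C\<^esub> q')"
    if "x \<in> carrier Q" "x' \<in> carrier Q" "q \<in> carrier C" "q' \<in> carrier C" for x x' q q'
  proof -
    have "\<ominus>\<^bsub>Z\<^esub> (x', q') = (\<ominus>\<^bsub>Q\<^esub> x', \<ominus>\<^bsub>C\<^esub> q')"
      by (rule Z.M.minus_equality) (use that in \<open>simp_all add: Zs Q.M.l_neg C.M.l_neg\<close>)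
    then show ?thesis using that by (simp add: a_minus_def Zs)
  qed
  have surj_\<theta>: "\<theta> ` carrier C = carrier (cokernel_module X Z LB)"
  proof (intro Set.equalityI Set.subsetI)
    fix w assume "w \<in> carrier (cokernel_module X Z LB)"
    then obtain z where z: "z \<in> carrier Z" "w = a_r_coset Z LB.im z"
      unfolding cokernel_module_def by (rule quotient_carrierE[OF Z.vectorspace_axioms LB.im_is_submodule])
    obtain x q where xq: "z = (x, q)" "x \<in> carrier Q" "q \<in> carrier C" using z(1) by (auto simp: Zs)
    obtain f where "f \<in> carrier F" "x = a_r_coset F N f"
      using xq(2) unfolding Q_def by (rule quotient_carrierE[OF F N])
    then obtain y where y: "y \<in> carrier X" "L' y = x" using surj[of f] by (auto simp: L'_def)
    \<comment> \<open>For \<open>L' y = x\<close> the difference of \<open>(x, q)\<close> and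
      \<open>(0, q - B y)\<close> is \<open>LB y\<close>, so \<open>(x, q)\<close> has the class of
      an element with first component 0.\<close>
    have q': "q \<ominus>\<^bsub>C\<^esub> B y \<in> carrier C" using xq y by simp
    have "(x, q) \<ominus>\<^bsub>Z\<^esub> (\<zero>\<^bsub>Q\<^esub>, q \<ominus>\<^bsub>C\<^esub> B y) = (x, B y)"
    proof -
      have "q \<ominus>\<^bsub>C\<^esub> (q \<ominus>\<^bsub>C\<^esub> B y) = B y"
        using xq(3) B.f_im[OF y(1)]
        by (simp add: a_minus_def C.M.minus_add C.M.a_assoc[symmetric] C.M.r_neg)
      then show ?thesis using xq q' by (simp add: sub0) (simp add: a_minus_def)
    qed
    also have "\<dots> \<in> LB.im" using y by (force simp: LB.im_def LB)
    finally have "\<theta> (q \<ominus>\<^bsub>C\<^esub> B y) = w"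
      using eq_iff[of "(x, q)" "(\<zero>\<^bsub>Q\<^esub>, q \<ominus>\<^bsub>C\<^esub> B y)"] xq q' z by (simp add: \<theta>_def Zs)
    then show "w \<in> \<theta> ` carrier C" using q' by blast
  qed (use \<theta>.T_im in auto)
  have "\<theta>.ker = M.im"
  proof -
    have "\<theta> q = \<zero>\<^bsub>cokernel_module X Z LB\<^esub> \<longleftrightarrow> (\<zero>\<^bsub>Q\<^esub>, q) \<in> LB.im" if "q \<in> carrier C" for q
      using coset_ker[OF Z.vectorspace_axioms LB.im_is_submodule] that
      unfolding cokernel_module_def[symmetric] by (auto simp: CL.ker_def \<theta>_def Zs)
    \<comment> \<open>A preimage of \<open>(0, q)\<close> lies in the kernel of \<open>L'\<close>,
      hence has the form \<open>\<Psi> v\<close>, and then \<open>q = M v\<close>.\<close>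
    moreover have "(\<zero>\<^bsub>Q\<^esub>, q) \<in> LB.im \<longleftrightarrow> q \<in> M.im" if "q \<in> carrier C" for q
    proof
      assume "(\<zero>\<^bsub>Q\<^esub>, q) \<in> LB.im"
      then obtain y where y: "y \<in> carrier X" "L' y = \<zero>\<^bsub>Q\<^esub>" "q = B y" by (auto simp: LB.im_def LB)
      then obtain v where "v \<in> carrier C" "y = \<Psi> v" using kerL' by blast
      then show "q \<in> M.im" using y M by (auto simp: M.im_def)
    next
      assume "q \<in> M.im"
      then obtain v where v: "v \<in> carrier C" "q = B (\<Psi> v)" using M by (auto simp: M.im_def)
      then have "LB (\<Psi> v) = (\<zero>\<^bsub>Q\<^esub>, q)" using kerL'[of "\<Psi> v"] by (simp add: LB)
      then show "(\<zero>\<^bsub>Q\<^esub>, q) \<in> LB.im" using v unfolding LB.im_def by (metis P.f_im imageI)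
    qed
    moreover have "M.im \<subseteq> carrier C" by (auto simp: M.im_def)
    ultimately show ?thesis unfolding \<theta>.ker_def by blast
  qed
  note coker = dim_quotient_ker[OF \<theta> fd surj_\<theta> this]
  show ?thesis using ker coker by (simp add: cokernel_module_def)
qed

section \<open>The boundary operator and its characteristic matrix\<close>

lemma AE_lebesgue_on_iff_negligible:
  "(AE t in lebesgue_on {a..b}. P t) \<longleftrightarrow> (\<exists>N. negligible N \<and> (\<forall>t\<in>{a..b::real} - N. P t))"
proof
  assume "AE t in lebesgue_on {a..b}. P t"
  then have "AE t in lebesgue. t \<in> {a..b} \<longrightarrow> P t" by (subst (asm) AE_restrict_space_iff) auto
  then have "{t. \<not> (t \<in> {a..b} \<longrightarrow> P t)} \<in> null_sets lebesgue" by (simp add: completion.AE_iff_null_sets)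
  then show "\<exists>N. negligible N \<and> (\<forall>t\<in>{a..b} - N. P t)"
    unfolding negligible_iff_null_sets[symmetric] by blast
next
  assume "\<exists>N. negligible N \<and> (\<forall>t\<in>{a..b} - N. P t)"
  then obtain N where N: "negligible N" "\<forall>t\<in>{a..b} - N. P t" by blast
  then have "AE t in lebesgue. t \<notin> N" by (simp add: negligible_iff_null_sets AE_not_in)
  then have "AE t in lebesgue. t \<in> {a..b} \<longrightarrow> P t" by (rule eventually_mono) (use N in blast)
  then show "AE t in lebesgue_on {a..b}. P t" by (subst AE_restrict_space_iff) auto
qed

lemma sobolev_eq_AE: "sobolev_eq a b l f g \<Longrightarrow> AE t in lebesgue_on {a..b}. f t = g t"
  unfolding sobolev_eq_def AE_lebesgue_on_iff_negligible by blast

lemma sobolev_vecsD: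
  assumes "y \<in> sobolev_vecs a b p l m"
  shows "dim_vec (y t) = m" "y t \<in> carrier_vec m" "t \<notin> {a..b} \<Longrightarrow> y t = 0\<^sub>v m"
    "k < m \<Longrightarrow> sobolev_fun a b p l (\<lambda>t. y t $ k)"
  using assms by (auto simp: sobolev_vecs_def dest: carrier_vecD)

lemma smult_zero_vec_complex: "c \<cdot>\<^sub>v 0\<^sub>v m = (0\<^sub>v m :: complex vec)"
  by (intro eq_vecI) auto

lemma sobolev_vecs_add:
  assumes ab: "a < b" and p: "1 \<le> p" and "y \<in> sobolev_vecs a b p l m" "z \<in> sobolev_vecs a b p l m"
  shows "(\<lambda>t. y t + z t) \<in> sobolev_vecs a b p l m"
  unfolding sobolev_vecs_def
proof (intro CollectI conjI allI impI)
  note y = sobolev_vecsD[OF assms(3)] and z = sobolev_vecsD[OF assms(4)]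
  show "y t + z t \<in> carrier_vec m" for t using y(2) z(2) by (rule add_carrier_vec)
  show "y t + z t = 0\<^sub>v m" if "t \<notin> {a..b}" for t using y(3) z(3) that by simp
  fix k assume "k < m"
  then have "(\<lambda>t. (y t + z t) $ k) = (\<lambda>t. y t $ k + z t $ k)" using z(1) by auto
  then show "sobolev_fun a b p l (\<lambda>t. (y t + z t) $ k)"
    using sobolev_fun_add[OF ab p y(4) z(4)] \<open>k < m\<close> by simp
qed

lemma sobolev_vecs_smult:
  assumes ab: "a < b" and p: "1 \<le> p" and "y \<in> sobolev_vecs a b p l m"
  shows "(\<lambda>t. c \<cdot>\<^sub>v y t) \<in> sobolev_vecs a b p l m"
  unfolding sobolev_vecs_def
proof (intro CollectI conjI allI impI)
  note y = sobolev_vecsD[OF assms(3)]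
  show "c \<cdot>\<^sub>v y t \<in> carrier_vec m" for t using y(2) by simp
  show "c \<cdot>\<^sub>v y t = 0\<^sub>v m" if "t \<notin> {a..b}" for t using y(3)[OF that] by (simp add: smult_zero_vec_complex)
  fix k assume "k < m"
  then have "(\<lambda>t. (c \<cdot>\<^sub>v y t) $ k) = (\<lambda>t. c * y t $ k)" using y(1) by auto
  then show "sobolev_fun a b p l (\<lambda>t. (c \<cdot>\<^sub>v y t) $ k)"
    using sobolev_fun_cmult[OF ab p y(4)] \<open>k < m\<close> by simp
qed

lemma sobolev_vecs_zero:
  assumes "a < b" "1 \<le> p"
  shows "(\<lambda>t. 0\<^sub>v m) \<in> sobolev_vecs a b p l m"
  using sobolev_fun_const[OF assms, of l 0] by (simp add: sobolev_vecs_def)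

lemma sobolev_funs_simps:
  "carrier (sobolev_funs a b p l m) = sobolev_vecs a b p l m"
  "zero (sobolev_funs a b p l m) = (\<lambda>t. 0\<^sub>v m)"
  "add (sobolev_funs a b p l m) = (\<lambda>f g t. f t + g t)"
  "smult (sobolev_funs a b p l m) = (\<lambda>c f t. c \<cdot>\<^sub>v f t)"
  by (simp_all add: sobolev_funs_def)

lemma sobolev_funs_vectorspace:
  assumes ab: "a < b" and p: "1 \<le> p"
  shows "vectorspace class_ring (sobolev_funs a b p l m)"
proof -
  let ?V = "sobolev_funs a b p l m"
  note closed = sobolev_vecs_add[OF ab p] sobolev_vecs_smult[OF ab p] sobolev_vecs_zero[OF ab p]
  have car: "v t \<in> carrier_vec m" if "v \<in> carrier ?V" for v t
    using that sobolev_vecsD(2) by (simp add: sobolev_funs_simps)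
  show ?thesis
  proof (rule vs_criteria)
    show "field (class_ring :: complex ring)" by (rule class_field)
    show "\<zero>\<^bsub>?V\<^esub> \<in> carrier ?V" using closed by (simp add: sobolev_funs_simps)
    show "\<forall>v w. v \<in> carrier ?V \<and> w \<in> carrier ?V \<longrightarrow> v \<oplus>\<^bsub>?V\<^esub> w \<in> carrier ?V"
      "\<forall>c v. c \<in> carrier class_ring \<and> v \<in> carrier ?V \<longrightarrow> c \<odot>\<^bsub>?V\<^esub> v \<in> carrier ?V"
      using closed by (simp_all add: sobolev_funs_simps)
    show "\<forall>v\<in>carrier ?V. \<exists>neg_v\<in>carrier ?V. v \<oplus>\<^bsub>?V\<^esub> neg_v = \<zero>\<^bsub>?V\<^esub>"
    proof
      fix v assume v: "v \<in> carrier ?V"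
      have "v t + - 1 \<cdot>\<^sub>v v t = 0\<^sub>v m" for t
        using car[OF v, of t] by (intro eq_vecI) auto
      then show "\<exists>neg_v\<in>carrier ?V. v \<oplus>\<^bsub>?V\<^esub> neg_v = \<zero>\<^bsub>?V\<^esub>"
        using v closed(2)[of v l m "- 1"]
        by (intro bexI[of _ "\<lambda>t. - 1 \<cdot>\<^sub>v v t"]) (simp_all add: sobolev_funs_simps)
    qed
    show "\<forall>v w. v \<in> carrier ?V \<and> w \<in> carrier ?V \<longrightarrow> v \<oplus>\<^bsub>?V\<^esub> w = w \<oplus>\<^bsub>?V\<^esub> v"
      using car by (auto simp: sobolev_funs_simps(2-) intro!: ext comm_add_vec)
    show "\<forall>v w x. v \<in> carrier ?V \<and> w \<in> carrier ?V \<and> x \<in> carrier ?V \<longrightarrow>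
        v \<oplus>\<^bsub>?V\<^esub> w \<oplus>\<^bsub>?V\<^esub> x = v \<oplus>\<^bsub>?V\<^esub> (w \<oplus>\<^bsub>?V\<^esub> x)"
      using car by (auto simp: sobolev_funs_simps(2-) intro!: ext assoc_add_vec)
    show "\<forall>v\<in>carrier ?V. v \<oplus>\<^bsub>?V\<^esub> \<zero>\<^bsub>?V\<^esub> = v"
      using car by (auto simp: sobolev_funs_simps(2-) intro!: ext right_zero_vec)
    show "\<forall>a b v. a \<in> carrier class_ring \<and> b \<in> carrier class_ring \<and> v \<in> carrier ?V \<longrightarrow>
        (a \<otimes>\<^bsub>class_ring\<^esub> b) \<odot>\<^bsub>?V\<^esub> v = a \<odot>\<^bsub>?V\<^esub> (b \<odot>\<^bsub>?V\<^esub> v)"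
      by (auto simp: sobolev_funs_simps(2-) smult_smult_assoc)
    show "\<forall>v\<in>carrier ?V. \<one>\<^bsub>class_ring\<^esub> \<odot>\<^bsub>?V\<^esub> v = v"
      by (auto simp: sobolev_funs_simps(2-))
    show "\<forall>a b v. a \<in> carrier class_ring \<and> b \<in> carrier class_ring \<and> v \<in> carrier ?V \<longrightarrow>
        (a \<oplus>\<^bsub>class_ring\<^esub> b) \<odot>\<^bsub>?V\<^esub> v = a \<odot>\<^bsub>?V\<^esub> v \<oplus>\<^bsub>?V\<^esub> b \<odot>\<^bsub>?V\<^esub> v"
      by (auto simp: sobolev_funs_simps(2-) add_smult_distrib_vec)
    show "\<forall>a v w. a \<in> carrier class_ring \<and> v \<in> carrier ?V \<and> w \<in> carrier ?V \<longrightarrow>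
        a \<odot>\<^bsub>?V\<^esub> (v \<oplus>\<^bsub>?V\<^esub> w) = a \<odot>\<^bsub>?V\<^esub> v \<oplus>\<^bsub>?V\<^esub> a \<odot>\<^bsub>?V\<^esub> w"
      using car by (auto simp: sobolev_funs_simps(2-) intro!: ext smult_add_distrib_vec)
  qed
qed

lemma null_funs_submodule:
  assumes ab: "a < b" and p: "1 \<le> p"
  shows "submodule class_ring (null_funs a b p l m) (sobolev_funs a b p l m)"
proof -
  interpret vectorspace "class_ring :: complex ring" "sobolev_funs a b p l m"
    by (rule sobolev_funs_vectorspace[OF ab p])
  show ?thesis
  proof
    show "null_funs a b p l m \<subseteq> carrier (sobolev_funs a b p l m)"
      by (auto simp: null_funs_def sobolev_funs_simps)
    show "\<zero>\<^bsub>sobolev_funs a b p l m\<^esub> \<in> null_funs a b p l m"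
      using sobolev_vecs_zero[OF ab p] by (simp add: null_funs_def sobolev_funs_simps)
    fix v assume v: "v \<in> null_funs a b p l m"
    have "AE t in lebesgue_on {a..b}. v t = 0\<^sub>v m" using v by (simp add: null_funs_def)
    then have "AE t in lebesgue_on {a..b}. c \<cdot>\<^sub>v v t = 0\<^sub>v m" for c
      by (rule eventually_mono) (simp add: smult_zero_vec_complex)
    then show "c \<odot>\<^bsub>sobolev_funs a b p l m\<^esub> v \<in> null_funs a b p l m" for c
      using v sobolev_vecs_smult[OF ab p] by (simp add: null_funs_def sobolev_funs_simps)
    fix w assume w: "w \<in> null_funs a b p l m"
    have "AE t in lebesgue_on {a..b}. v t = 0\<^sub>v m" "AE t in lebesgue_on {a..b}. w t = 0\<^sub>v m"
      using v w by (simp_all add: null_funs_def)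
    then have "AE t in lebesgue_on {a..b}. v t + w t = 0\<^sub>v m" by eventually_elim simp
    then show "v \<oplus>\<^bsub>sobolev_funs a b p l m\<^esub> w \<in> null_funs a b p l m"
      using v w sobolev_vecs_add[OF ab p] by (simp add: null_funs_def sobolev_funs_simps)
  qed
qed

lemma sobolev_class_eq_iff:
  assumes ab: "a < b" and p: "1 \<le> p" and f: "f \<in> sobolev_vecs a b p l m" and g: "g \<in> sobolev_vecs a b p l m"
  shows "sobolev_class a b p l m f = sobolev_class a b p l m g \<longleftrightarrow> (AE t in lebesgue_on {a..b}. f t = g t)"
proof -
  let ?F = "sobolev_funs a b p l m"
  interpret F: vectorspace "class_ring :: complex ring" ?F by (rule sobolev_funs_vectorspace[OF ab p])
  have "\<ominus>\<^bsub>?F\<^esub> g = (\<lambda>t. - 1 \<cdot>\<^sub>v g t)"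
    using F.smult_minus_1[of g] g by (simp add: sobolev_funs_simps class_ring_simps)
  then have "f \<ominus>\<^bsub>?F\<^esub> g = (\<lambda>t. f t + - 1 \<cdot>\<^sub>v g t)" by (simp add: a_minus_def sobolev_funs_simps)
  moreover have "(\<lambda>t. f t + - 1 \<cdot>\<^sub>v g t) \<in> sobolev_vecs a b p l m"
    by (intro sobolev_vecs_add[OF ab p f] sobolev_vecs_smult[OF ab p g])
  moreover have "f t + - 1 \<cdot>\<^sub>v g t = 0\<^sub>v m \<longleftrightarrow> f t = g t" for t
    using sobolev_vecsD(1)[OF f, of t] sobolev_vecsD(1)[OF g, of t] by (auto simp: vec_eq_iff)
  ultimately show ?thesis
    using coset_eq_iff[OF F.vectorspace_axioms null_funs_submodule[OF ab p], of f g] f g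
    by (simp add: sobolev_class_def null_funs_def sobolev_funs_simps)
qed

section \<open>The matrix Cauchy problems\<close>

context ode
begin

abbreviation comps :: "(real \<Rightarrow> complex vec) \<Rightarrow> nat \<Rightarrow> real \<Rightarrow> complex" where
  "comps y \<equiv> \<lambda>k t. y t $ k"

text \<open>The order \<open>r - l\<close> of the definition is renamed \<open>s < r\<close>;
  through this the operator is handled by its components \<open>L\<close>.\<close>

lemma diff_op_index:
  assumes "t \<in> {a..b}" "k < m"
  shows "diff_op a b m r A y t $ k = L (comps y) k t"
proof -
  have "(A s t *\<^sub>v nderiv_vec a b m s y t) $ k = (\<Sum>j<m. A s t $$ (k, j) * nderiv a b s (comps y j) t)" if "s < r" for s
  proof -
    have "A s t \<in> carrier_mat m m" using A[OF that] by (simp add: sobolev_mats_def)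
    then show ?thesis using assms by (simp add: nderiv_vec_def scalar_prod_def lessThan_atLeast0)
  qed
  moreover have "(\<Sum>l=1..r. g (r - l)) = (\<Sum>s<r. g s)" for g :: "nat \<Rightarrow> complex"
    by (rule sum.reindex_bij_witness[of _ "\<lambda>s. r - s" "\<lambda>l. r - l"]) auto
  moreover have "(\<Sum>l=1..r. (A (r - l) t *\<^sub>v nderiv_vec a b m (r - l) y t) $ k) =
      (\<Sum>l=1..r. (\<lambda>s. (A s t *\<^sub>v nderiv_vec a b m s y t) $ k) (r - l))" by simp
  ultimately have "(\<Sum>l=1..r. (A (r - l) t *\<^sub>v nderiv_vec a b m (r - l) y t) $ k) =
      (\<Sum>s<r. \<Sum>j<m. A s t $$ (k, j) * nderiv a b s (comps y j) t)" by simp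
  then show ?thesis using assms by (simp add: diff_op_def L_def nderiv_vec_def)
qed

lemma diff_op_dim: "dim_vec (diff_op a b m r A y t) = m"
  by (simp add: diff_op_def)

lemma diff_op_sobolev:
  assumes y: "y \<in> sobolev_vecs a b p (n + r) m"
  shows "diff_op a b m r A y \<in> sobolev_vecs a b p n m"
  unfolding sobolev_vecs_def
proof (intro CollectI conjI allI impI)
  show "diff_op a b m r A y t \<in> carrier_vec m" for t by (simp add: diff_op_def)
  show "diff_op a b m r A y t = 0\<^sub>v m" if "t \<notin> {a..b}" for t using that by (auto simp: diff_op_def)
  fix k assume k: "k < m"
  have "sobolev_fun a b p n (\<lambda>t. diff_op a b m r A y t $ k) \<longleftrightarrow> sobolev_fun a b p n (L (comps y) k)"
    by (rule sobolev_fun_cong[OF p]) (simp add: diff_op_index k)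
  then show "sobolev_fun a b p n (\<lambda>t. diff_op a b m r A y t $ k)"
    using L_sobolev[OF sobolev_vecsD(4)[OF y] k] by simp
qed

lemma diff_op_AE_eqI:
  assumes f: "f \<in> sobolev_vecs a b p n m"
    and eq: "\<And>k. k < m \<Longrightarrow> sobolev_eq a b n (L (comps y) k) (comps f k)"
  shows "AE t in lebesgue_on {a..b}. diff_op a b m r A y t = f t"
proof -
  have "AE t in lebesgue_on {a..b}. L (comps y) k t = f t $ k" if "k < m" for k
    using sobolev_eq_AE[OF eq[OF that]] .
  then have "AE t in lebesgue_on {a..b}. \<forall>k\<in>{..<m}. L (comps y) k t = f t $ k"
    by (intro AE_finite_allI) auto
  moreover have "AE t in lebesgue_on {a..b}. t \<in> {a..b}" by (rule AE_I2) simp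
  ultimately show ?thesis
  proof eventually_elim
    case (elim t)
    show ?case
      by (rule eq_vecI) (use elim sobolev_vecsD(1)[OF f, of t] in \<open>simp_all only: diff_op_index diff_op_dim lessThan_iff\<close>)
  qed
qed

lemma exists_solution_vec:
  assumes f: "f \<in> sobolev_vecs a b p n m"
  obtains y where "y \<in> sobolev_vecs a b p (n + r) m"
    "\<And>s k. s < r \<Longrightarrow> k < m \<Longrightarrow> nderiv a b s (comps y k) a = c s k"
    "\<And>k. k < m \<Longrightarrow> sobolev_eq a b n (L (comps y) k) (comps f k)"
proof -
  obtain Y where Y: "\<And>k. k < m \<Longrightarrow> sobolev_fun a b p (n + r) (Y k)"
    "\<And>k s. k < m \<Longrightarrow> s < r \<Longrightarrow> nderiv a b s (Y k) a = c s k"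
    "\<And>k. k < m \<Longrightarrow> sobolev_eq a b n (L Y k) (comps f k)"
    using exists_solution[of "comps f" c] sobolev_vecsD(4)[OF f] by blast
  \<comment> \<open>The system determines the solution on \<open>{a..b}\<close> only; the extension
    by zero is the representative that \<open>sobolev_vecs\<close> requires.\<close>
  define y where "y t = (if t \<in> {a..b} then vec m (\<lambda>k. Y k t) else 0\<^sub>v m)" for t
  have yY: "comps y k t = Y k t" if "k < m" "t \<in> {a..b}" for k t using that by (simp add: y_def)
  show thesis
  proof (rule that[of y])
    show "y \<in> sobolev_vecs a b p (n + r) m"
      using sobolev_fun_cong[OF p, of a b "comps y k" "Y k" "n + r" for k] yY Y(1)
      by (auto simp: sobolev_vecs_def y_def)
    show "nderiv a b s (comps y k) a = c s k" if "s < r" "k < m" for s k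
      using nderiv_cong[of a b "comps y k" "Y k" a s] yY[OF that(2)] ab Y(2)[OF that(2,1)] by simp
    show "sobolev_eq a b n (L (comps y) k) (comps f k)" if "k < m" for k
      by (rule sobolev_eq_trans[OF sobolev_eqI Y(3)[OF that]]) (rule L_cong[OF yY that])
  qed
qed

lemma solution_unique_vec:
  assumes y: "y \<in> sobolev_vecs a b p (n + r) m" "y' \<in> sobolev_vecs a b p (n + r) m"
    and init: "\<And>s k. s < r \<Longrightarrow> k < m \<Longrightarrow> nderiv a b s (comps y k) a = nderiv a b s (comps y' k) a"
    and ae: "AE t in lebesgue_on {a..b}. diff_op a b m r A y t = diff_op a b m r A y' t"
  shows "y = y'"
proof
  fix t
  obtain N where N: "negligible N" "\<And>t. t \<in> {a..b} - N \<Longrightarrow> diff_op a b m r A y t = diff_op a b m r A y' t"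
    using ae unfolding AE_lebesgue_on_iff_negligible by blast
  show "y t = y' t"
  proof (cases "t \<in> {a..b}")
    case True
    have "comps y k t = comps y' k t" if "k < m" for k
    proof (rule solution_unique[OF sobolev_vecsD(4)[OF y(1)] sobolev_vecsD(4)[OF y(2)] init N(1) _ that True])
      show "L (comps y) k t = L (comps y') k t" if "k < m" "t \<in> {a..b} - N" for k t
        using N(2)[OF that(2)] diff_op_index[of t k y] diff_op_index[of t k y'] that by simp
    qed
    then show ?thesis
      using sobolev_vecsD(1)[OF y(1), of t] sobolev_vecsD(1)[OF y(2), of t] by (intro eq_vecI) auto
  qed (use sobolev_vecsD(3)[OF y(1)] sobolev_vecsD(3)[OF y(2)] in simp)
qed

text \<open>Matrix multiplication from the left acts on columns separately, so the results on the
  vector equation apply to each column \<open>q\<close>.\<close>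

lemma diff_eq_mat_iff:
  assumes Y: "\<And>u. Y u \<in> carrier_mat m m" and t: "t \<in> {a..b}"
  shows "diff_eq_mat a b m r A Y t \<longleftrightarrow> (\<forall>q<m. \<forall>k<m. L (comps (\<lambda>u. col (Y u) q)) k t = 0)"
proof -
  have col: "nderiv a b s (\<lambda>u. col (Y u) q $ k) = nderiv a b s (\<lambda>u. Y u $$ (k, q))" if "k < m" "q < m" for s k q
    using Y that by (intro arg_cong[of _ _ "nderiv a b s"] ext) (metis carrier_matD index_col)
  have "(A s t * nderiv_mat a b m s Y t) $$ (k, q) = (\<Sum>j<m. A s t $$ (k, j) * nderiv a b s (\<lambda>u. Y u $$ (j, q)) t)"
    if "s < r" "k < m" "q < m" for s k q
  proof -
    have "A s t \<in> carrier_mat m m" using A[OF that(1)] by (simp add: sobolev_mats_def)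
    then show ?thesis using that by (simp add: nderiv_mat_def scalar_prod_def lessThan_atLeast0)
  qed
  moreover have "(\<Sum>l=1..r. g (r - l)) = (\<Sum>s<r. g s)" for g :: "nat \<Rightarrow> complex"
    by (rule sum.reindex_bij_witness[of _ "\<lambda>s. r - s" "\<lambda>l. r - l"]) auto
  ultimately have "nderiv_mat a b m r Y t $$ (k, q) + (\<Sum>l=1..r. (A (r - l) t * nderiv_mat a b m (r - l) Y t) $$ (k, q)) =
      L (comps (\<lambda>u. col (Y u) q)) k t" if "k < m" "q < m" for k q
    using that by (simp add: L_def col nderiv_mat_def)
  then show ?thesis
    unfolding diff_eq_mat_def mat_eq_iff by auto
qed

lemma AE_open_interval: "(AE t in lebesgue_on {a<..<b}. P t) \<longleftrightarrow> (AE t in lebesgue_on {a..b}. P t)"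
proof -
  have "AE t in lebesgue. t \<notin> {a, b}"
    by (rule AE_not_in) (simp add: negligible_iff_null_sets[symmetric])
  then have "AE t in lebesgue. (t \<in> {a<..<b} \<longrightarrow> P t) = (t \<in> {a..b} \<longrightarrow> P t)"
    by (rule eventually_mono) (auto simp: less_le)
  from eventually_subst[OF this]
  show ?thesis by (simp add: AE_restrict_space_iff)
qed

lemma cauchy_solutionD:
  assumes Y: "cauchy_solution a b p n m r A i Y" and q: "q < m"
  defines "y \<equiv> \<lambda>t. col (Y t) q"
  shows "y \<in> sobolev_vecs a b p (n + r) m"
    "\<And>s k. s < r \<Longrightarrow> k < m \<Longrightarrow> nderiv a b s (comps y k) a = (if i = Suc s \<and> k = q then 1 else 0)"
    "AE t in lebesgue_on {a..b}. \<forall>k<m. L (comps y) k t = 0"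
proof -
  have mats: "\<And>t. Y t \<in> carrier_mat m m" "\<And>t. t \<notin> {a..b} \<Longrightarrow> Y t = 0\<^sub>m m m"
    "\<And>j k. j < m \<Longrightarrow> k < m \<Longrightarrow> sobolev_fun a b p (n + r) (\<lambda>t. Y t $$ (j, k))"
    using Y by (auto simp: cauchy_solution_def sobolev_mats_def)
  have yk: "comps y k = (\<lambda>t. Y t $$ (k, q))" if "k < m" for k
    unfolding y_def using mats(1) q that by (intro ext) (metis carrier_matD index_col)
  show "y \<in> sobolev_vecs a b p (n + r) m"
    unfolding sobolev_vecs_def
  proof (intro CollectI conjI allI impI)
    show "y t \<in> carrier_vec m" for t unfolding y_def using mats(1) by (metis carrier_matD(1) col_dim)
    show "y t = 0\<^sub>v m" if "t \<notin> {a..b}" for t unfolding y_def using mats(2)[OF that] q by simp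
    show "sobolev_fun a b p (n + r) (\<lambda>t. y t $ k)" if "k < m" for k using mats(3)[OF that q] yk[OF that] by simp
  qed
  show "nderiv a b s (comps y k) a = (if i = Suc s \<and> k = q then 1 else 0)" if "s < r" "k < m" for s k
  proof -
    \<comment> \<open>The initial conditions are numbered from 1, the derivatives from 0: condition
      \<open>Suc s\<close> prescribes the derivative of order \<open>s\<close>.\<close>
    have "nderiv_mat a b m (Suc s - 1) Y a = (if i = Suc s then 1\<^sub>m m else 0\<^sub>m m m)"
      using Y that(1) unfolding cauchy_solution_def by (metis Suc_leI atLeastAtMost_iff le_add1 plus_1_eq_Suc)
    then have "nderiv_mat a b m s Y a $$ (k, q) = (if i = Suc s \<and> k = q then 1 else 0)"
      using that(2) q by simp
    then show ?thesis using yk[OF that(2)] that(2) q by (simp add: nderiv_mat_def)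
  qed
  have "AE t in lebesgue_on {a<..<b}. diff_eq_mat a b m r A Y t"
  proof (cases "n = 0")
    case True
    then show ?thesis using Y by (simp add: cauchy_solution_def)
  next
    case False
    then have "\<forall>t\<in>{a<..<b}. diff_eq_mat a b m r A Y t" using Y by (simp add: cauchy_solution_def)
    then show ?thesis by (intro AE_I2) simp
  qed
  then have "AE t in lebesgue_on {a..b}. diff_eq_mat a b m r A Y t" by (simp add: AE_open_interval)
  moreover have "AE t in lebesgue_on {a..b}. t \<in> {a..b}" by (rule AE_I2) simp
  ultimately show "AE t in lebesgue_on {a..b}. \<forall>k<m. L (comps y) k t = 0"
    by eventually_elim (use diff_eq_mat_iff[OF mats(1)] q in \<open>auto simp: y_def\<close>)
qed

text \<open>This gives meaning to the definite description in \<open>fundamental_matrix\<close>.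
  Existence and uniqueness are reduced to columns: column \<open>q\<close> is the solution whose
  only nonzero initial datum is the derivative of order \<open>i - 1\<close> of component
  \<open>q\<close>.\<close>

lemma cauchy_solution_ex1:
  assumes i: "i \<in> {1..r}"
  shows "\<exists>!Y. cauchy_solution a b p n m r A i Y"
proof -
  have zero: "(\<lambda>t. 0\<^sub>v m) \<in> sobolev_vecs a b p n m" by (rule sobolev_vecs_zero[OF ab p])
  have "\<exists>y. y \<in> sobolev_vecs a b p (n + r) m \<and>
      (\<forall>s<r. \<forall>k<m. nderiv a b s (comps y k) a = (if i = Suc s \<and> k = q then 1 else 0)) \<and>
      (\<forall>k<m. sobolev_eq a b n (L (comps y) k) (\<lambda>t. 0\<^sub>v m $ k))" for q
    using exists_solution_vec[OF zero, of "\<lambda>s k. if i = Suc s \<and> k = q then 1 else 0"] by metis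
  then obtain y where y: "\<And>q. y q \<in> sobolev_vecs a b p (n + r) m"
      "\<And>q s k. s < r \<Longrightarrow> k < m \<Longrightarrow> nderiv a b s (comps (y q) k) a = (if i = Suc s \<and> k = q then 1 else 0)"
      "\<And>q k. k < m \<Longrightarrow> sobolev_eq a b n (L (comps (y q)) k) (\<lambda>t. 0\<^sub>v m $ k)"
    by metis
  define Y where "Y t = mat m m (\<lambda>(k, q). y q t $ k)" for t
  have Yc: "Y t \<in> carrier_mat m m" for t by (simp add: Y_def)
  have colY: "col (Y t) q = y q t" if "q < m" for t q
    using that sobolev_vecsD(1)[OF y(1), of q t] by (intro eq_vecI) (auto simp: Y_def)
  have "cauchy_solution a b p n m r A i Y"
    unfolding cauchy_solution_def
  proof (intro conjI ballI)
    show "Y \<in> sobolev_mats a b p (n + r) m"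
      using sobolev_vecsD(3,4)[OF y(1)] by (auto simp: sobolev_mats_def Y_def intro!: eq_matI)
    have L0: "AE t in lebesgue_on {a..b}. L (comps (y q)) k t = 0" if "k < m" for q k
      using sobolev_eq_AE[OF y(3)[OF that]] that by simp
    have "AE t in lebesgue_on {a..b}. \<forall>q\<in>{..<m}. \<forall>k\<in>{..<m}. L (comps (y q)) k t = 0"
      by (intro AE_finite_allI) (auto intro: L0)
    moreover have "AE t in lebesgue_on {a..b}. t \<in> {a..b}" by (rule AE_I2) simp
    ultimately have "AE t in lebesgue_on {a..b}. diff_eq_mat a b m r A Y t"
      by eventually_elim (simp add: diff_eq_mat_iff[OF Yc] colY)
    moreover have "diff_eq_mat a b m r A Y t" if "n > 0" "t \<in> {a<..<b}" for t
      using that sobolev_eqD[OF y(3), of _ t] by (simp add: diff_eq_mat_iff[OF Yc] colY)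
    ultimately show "if n = 0 then AE t in lebesgue_on {a<..<b}. diff_eq_mat a b m r A Y t
        else \<forall>t\<in>{a<..<b}. diff_eq_mat a b m r A Y t"
      by (simp add: AE_open_interval)
    fix j assume j: "j \<in> {1..r}"
    then have "j - 1 < r" "Suc (j - 1) = j" by auto
    then show "nderiv_mat a b m (j - 1) Y a = (if i = j then 1\<^sub>m m else 0\<^sub>m m m)"
      using y(2)[of "j - 1"] by (intro eq_matI) (auto simp: nderiv_mat_def Y_def)
  qed
  moreover have "Y = Y'" if "cauchy_solution a b p n m r A i Y" "cauchy_solution a b p n m r A i Y'" for Y Y'
  proof
    fix t
    have col_eq: "(\<lambda>t. col (Y t) q) = (\<lambda>t. col (Y' t) q)" if q: "q < m" for q
    proof (rule solution_unique_vec)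
      note D = cauchy_solutionD[OF \<open>cauchy_solution a b p n m r A i Y\<close> q]
      note D' = cauchy_solutionD[OF \<open>cauchy_solution a b p n m r A i Y'\<close> q]
      show "(\<lambda>t. col (Y t) q) \<in> sobolev_vecs a b p (n + r) m" "(\<lambda>t. col (Y' t) q) \<in> sobolev_vecs a b p (n + r) m"
        by (rule D D')+
      show "nderiv a b s (\<lambda>t. col (Y t) q $ k) a = nderiv a b s (\<lambda>t. col (Y' t) q $ k) a" if "s < r" "k < m" for s k
        using D(2)[OF that] D'(2)[OF that] by simp
      have "AE t in lebesgue_on {a..b}. t \<in> {a..b}" by (rule AE_I2) simp
      with D(3) D'(3) show "AE t in lebesgue_on {a..b}. diff_op a b m r A (\<lambda>t. col (Y t) q) t = diff_op a b m r A (\<lambda>t. col (Y' t) q) t"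
      proof eventually_elim
        case (elim t)
        show ?case
          by (rule eq_vecI) (use elim in \<open>simp_all add: diff_op_index diff_op_dim del: atLeastAtMost_iff\<close>)
      qed
    qed
    have "Y t \<in> carrier_mat m m" "Y' t \<in> carrier_mat m m"
      using that by (auto simp: cauchy_solution_def sobolev_mats_def)
    then show "Y t = Y' t"
      using col_eq by (intro mat_col_eqI) (auto simp: fun_eq_iff)
  qed
  ultimately show ?thesis by blast
qed

lemma fundamental_matrix_solution:
  "i \<in> {1..r} \<Longrightarrow> cauchy_solution a b p n m r A i (fundamental_matrix a b p n m r A i)"
  unfolding fundamental_matrix_def by (rule theI'[OF cauchy_solution_ex1])

section \<open>The solution space of the homogeneous equation\<close>

text \<open>Numbers the columns of all fundamental matrices consecutively: for \<open>k < m\<close>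
  and \<open>c = s * m + k\<close> it is column \<open>k\<close> of matrix
  \<open>s + 1\<close>.\<close>

definition fcol :: "nat \<Rightarrow> real \<Rightarrow> complex vec" where
  "fcol c = (\<lambda>t. col (fundamental_matrix a b p n m r A (c div m + 1) t) (c mod m))"

definition fcomb :: "nat \<Rightarrow> complex vec \<Rightarrow> real \<Rightarrow> complex vec" where
  "fcomb N v t = vec m (\<lambda>k. \<Sum>c<N. v $ c * fcol c t $ k)"

lemma fcol:
  assumes "c < r * m"
  shows "fcol c \<in> sobolev_vecs a b p (n + r) m"
    "\<And>s k. s < r \<Longrightarrow> k < m \<Longrightarrow> nderiv a b s (comps (fcol c) k) a = (if c = s * m + k then 1 else 0)"
    "AE t in lebesgue_on {a..b}. \<forall>k<m. L (comps (fcol c)) k t = 0"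
proof -
  have "c div m + 1 \<in> {1..r}" using less_mult_imp_div_less[OF assms] by simp
  note D = cauchy_solutionD[OF fundamental_matrix_solution[OF this], of "c mod m"]
  have cm: "c mod m < m" using m by simp
  show "fcol c \<in> sobolev_vecs a b p (n + r) m" unfolding fcol_def by (rule D(1)[OF cm])
  show "AE t in lebesgue_on {a..b}. \<forall>k<m. L (comps (fcol c)) k t = 0" unfolding fcol_def by (rule D(3)[OF cm])
  fix s k assume sk: "s < r" "k < m"
  have iff: "c div m + 1 = Suc s \<and> k = c mod m \<longleftrightarrow> c = s * m + k"
    using sk by (auto simp: mult.commute)
  show "nderiv a b s (comps (fcol c) k) a = (if c = s * m + k then 1 else 0)"
    unfolding fcol_def D(2)[OF cm sk] iff ..
qed

lemma fcomb_comps: "k < m \<Longrightarrow> comps (fcomb N v) k = (\<lambda>t. \<Sum>c<N. v $ c * fcol c t $ k)"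
  by (simp add: fcomb_def)

lemma fcomb:
  assumes N: "N \<le> r * m"
  shows "fcomb N v \<in> sobolev_vecs a b p (n + r) m"
    "\<And>s k. s < r \<Longrightarrow> k < m \<Longrightarrow> nderiv a b s (comps (fcomb N v) k) a = (\<Sum>c<N. v $ c * (if c = s * m + k then 1 else 0))"
    "AE t in lebesgue_on {a..b}. diff_op a b m r A (fcomb N v) t = 0\<^sub>v m"
proof -
  have S: "sobolev_fun a b p (n + r) (comps (fcol c) k)" if "c \<in> {..<N}" "k < m" for c k
    using sobolev_vecsD(4)[OF fcol(1)] that N by auto
  show "fcomb N v \<in> sobolev_vecs a b p (n + r) m"
    unfolding sobolev_vecs_def
  proof (intro CollectI conjI allI impI)
    show "fcomb N v t \<in> carrier_vec m" for t by (simp add: fcomb_def)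
    show "fcomb N v t = 0\<^sub>v m" if "t \<notin> {a..b}" for t
    proof -
      have "fcol c t = 0\<^sub>v m" if "c < N" for c
        using sobolev_vecsD(3)[OF fcol(1)] that N \<open>t \<notin> {a..b}\<close> by auto
      then show ?thesis by (intro eq_vecI) (auto simp: fcomb_def)
    qed
    show "sobolev_fun a b p (n + r) (\<lambda>t. fcomb N v t $ k)" if "k < m" for k
      unfolding fcomb_comps[OF that] by (rule sobolev_fun_lincomb[OF ab p S[OF _ that]])
  qed
  show "nderiv a b s (comps (fcomb N v) k) a = (\<Sum>c<N. v $ c * (if c = s * m + k then 1 else 0))"
    if "s < r" "k < m" for s k
  proof -
    have "nderiv a b s (comps (fcomb N v) k) a = (\<Sum>c<N. v $ c * nderiv a b s (comps (fcol c) k) a)"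
      unfolding fcomb_comps[OF that(2)]
      by (rule nderiv_lincomb_below[OF _ S[OF _ that(2)] that(1)]) (use ab in auto)
    also have "\<dots> = (\<Sum>c<N. v $ c * (if c = s * m + k then 1 else 0))"
    proof (intro sum.cong refl)
      fix c assume "c \<in> {..<N}"
      then have "c < r * m" using N by auto
      from fcol(2)[OF this that]
      show "v $ c * nderiv a b s (comps (fcol c) k) a = v $ c * (if c = s * m + k then 1 else 0)" by simp
    qed
    finally show ?thesis .
  qed
  have "AE t in lebesgue_on {a..b}. L (comps (fcomb N v)) k t = 0" if k: "k < m" for k
  proof -
    have "AE t in lebesgue_on {a..b}. \<forall>c\<in>{..<N}. L (comps (fcol c)) k t = 0"
    proof (intro AE_finite_allI)
      fix c assume "c \<in> {..<N}"
      then have "c < r * m" using N by auto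
      from fcol(3)[OF this] show "AE t in lebesgue_on {a..b}. L (comps (fcol c)) k t = 0"
        by (rule eventually_mono) (use k in blast)
    qed simp
    moreover have "AE t in lebesgue_on {a..b}. L (\<lambda>k t. \<Sum>c<N. v $ c * fcol c t $ k) k t = (\<Sum>c<N. v $ c * L (comps (fcol c)) k t)"
      by (rule sobolev_eq_AE[OF L_lincomb[OF _ S k]]) simp_all
    moreover have "AE t in lebesgue_on {a..b}. t \<in> {a..b}" by (rule AE_I2) simp
    ultimately show ?thesis
    proof eventually_elim
      case (elim t)
      have "L (comps (fcomb N v)) k t = L (\<lambda>k t. \<Sum>c<N. v $ c * fcol c t $ k) k t"
        by (rule L_cong[OF _ k elim(3)]) (simp add: fcomb_def)
      then show ?case using elim(1,2) by simp
    qed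
  qed
  then have "AE t in lebesgue_on {a..b}. \<forall>k\<in>{..<m}. L (comps (fcomb N v)) k t = 0"
    by (intro AE_finite_allI) auto
  moreover have "AE t in lebesgue_on {a..b}. t \<in> {a..b}" by (rule AE_I2) simp
  ultimately show "AE t in lebesgue_on {a..b}. diff_op a b m r A (fcomb N v) t = 0\<^sub>v m"
  proof eventually_elim
    case (elim t)
    show ?case by (rule eq_vecI) (use elim in \<open>simp_all add: diff_op_index diff_op_dim del: atLeastAtMost_iff\<close>)
  qed
qed

text \<open>Each column has exactly one nonzero initial datum, equal to 1, so the initial data of
  the combination are the entries of \<open>v\<close>. This gives injectivity of
  \<open>fcomb (r * m)\<close> and recovers a solution from its initial data.\<close>

lemma fcomb_init:
  assumes "s < r" "k < m"
  shows "nderiv a b s (comps (fcomb (r * m) v) k) a = v $ (s * m + k)"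
proof -
  define i where "i = s * m + k"
  have "i < Suc s * m" using assms(2) by (simp add: i_def)
  also have "\<dots> \<le> r * m" using assms(1) by (intro mult_le_mono1) simp
  finally have "i \<in> {..<r * m}" by simp
  have "nderiv a b s (comps (fcomb (r * m) v) k) a = (\<Sum>c<r * m. v $ c * (if c = i then 1 else 0))"
    unfolding fcomb(2)[OF order_refl assms] i_def ..
  also have "\<dots> = (\<Sum>c<r * m. if c = i then v $ c else 0)" by (intro sum.cong) auto
  also have "\<dots> = v $ i" using \<open>i \<in> {..<r * m}\<close> by (subst sum.delta) auto
  finally show ?thesis by (simp add: i_def)
qed

lemma fcomb_hom:
  "fcomb (r * m) \<in> LinearCombinations.module_hom class_ring (module_vec TYPE(complex) (r * m)) (sobolev_funs a b p (n + r) m)"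
  unfolding module_hom_def
proof (intro CollectI conjI allI impI)
  show "fcomb (r * m) \<in> carrier (module_vec TYPE(complex) (r * m)) \<rightarrow> carrier (sobolev_funs a b p (n + r) m)"
    using fcomb(1) by (simp add: sobolev_funs_simps)
  show "fcomb (r * m) (v \<oplus>\<^bsub>module_vec TYPE(complex) (r * m)\<^esub> w) =
      fcomb (r * m) v \<oplus>\<^bsub>sobolev_funs a b p (n + r) m\<^esub> fcomb (r * m) w"
    if "v \<in> carrier (module_vec TYPE(complex) (r * m)) \<and> w \<in> carrier (module_vec TYPE(complex) (r * m))" for v w
    using that by (auto simp: sobolev_funs_simps module_vec_simps fcomb_def fun_eq_iff vec_eq_iff sum.distrib distrib_right)
  show "fcomb (r * m) (c \<odot>\<^bsub>module_vec TYPE(complex) (r * m)\<^esub> v) = c \<odot>\<^bsub>sobolev_funs a b p (n + r) m\<^esub> fcomb (r * m) v"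
    if "c \<in> carrier class_ring \<and> v \<in> carrier (module_vec TYPE(complex) (r * m))" for c v
    using that by (auto simp: sobolev_funs_simps module_vec_simps fcomb_def fun_eq_iff vec_eq_iff sum_distrib_left mult.assoc)
qed

lemma fcomb_inj: "inj_on (fcomb (r * m)) (carrier_vec (r * m))"
proof (rule inj_onI)
  fix v w :: "complex vec"
  assume vw: "v \<in> carrier_vec (r * m)" "w \<in> carrier_vec (r * m)" "fcomb (r * m) v = fcomb (r * m) w"
  show "v = w"
  proof (rule eq_vecI)
    fix c assume "c < dim_vec w"
    then have "c div m < r" "c mod m < m" using vw(2) m by (auto simp: less_mult_imp_div_less)
    from fcomb_init[OF this, of v] fcomb_init[OF this, of w] show "v $ c = w $ c" using vw(3) by simp
  qed (use vw in simp)
qed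

lemma diff_op_null_iff:
  assumes y: "y \<in> sobolev_vecs a b p (n + r) m"
  shows "(AE t in lebesgue_on {a..b}. diff_op a b m r A y t = 0\<^sub>v m) \<longleftrightarrow> y \<in> fcomb (r * m) ` carrier_vec (r * m)"
proof
  assume ae: "AE t in lebesgue_on {a..b}. diff_op a b m r A y t = 0\<^sub>v m"
  \<comment> \<open>The initial data of \<open>y\<close>, listed as in \<open>fcomb_init\<close>:
    order \<open>c div m\<close>, component \<open>c mod m\<close>.\<close>
  define v where "v = vec (r * m) (\<lambda>c. nderiv a b (c div m) (comps y (c mod m)) a)"
  have "y = fcomb (r * m) v"
  proof (rule solution_unique_vec[OF y fcomb(1)[OF order_refl]])
    show "nderiv a b s (comps y k) a = nderiv a b s (comps (fcomb (r * m) v) k) a" if "s < r" "k < m" for s k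
    proof -
      have "s * m + k < Suc s * m" using that(2) by simp
      also have "\<dots> \<le> r * m" using that(1) by (intro mult_le_mono1) simp
      finally show ?thesis using that by (simp add: fcomb_init v_def)
    qed
    show "AE t in lebesgue_on {a..b}. diff_op a b m r A y t = diff_op a b m r A (fcomb (r * m) v) t"
      using ae fcomb(3)[OF order_refl, of v] by eventually_elim simp
  qed
  then show "y \<in> fcomb (r * m) ` carrier_vec (r * m)" by (auto simp: v_def)
qed (use fcomb(3)[OF order_refl] in auto)

lemma diff_op_surj:
  assumes f: "f \<in> sobolev_vecs a b p n m"
  shows "\<exists>y\<in>sobolev_vecs a b p (n + r) m. AE t in lebesgue_on {a..b}. diff_op a b m r A y t = f t"
  using exists_solution_vec[OF f] diff_op_AE_eqI[OF f] by metis

text \<open>Linearity is claimed after passing to classes: for \<open>n = 0\<close> the derivative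
  of order \<open>r\<close> has unspecified values on a null set, where \<open>diff_op\<close> need
  not be additive.\<close>

lemma diff_op_class_hom:
  "(\<lambda>y. sobolev_class a b p n m (diff_op a b m r A y)) \<in>
    LinearCombinations.module_hom class_ring (sobolev_funs a b p (n + r) m) (sobolev_space a b p n m)"
  unfolding module_hom_def
proof (intro CollectI conjI allI impI)
  let ?X = "sobolev_funs a b p (n + r) m" and ?F = "sobolev_funs a b p n m" and ?Q = "sobolev_space a b p n m"
  let ?L = "diff_op a b m r A" and ?cl = "sobolev_class a b p n m"
  note vs = sobolev_funs_vectorspace[OF ab p] null_funs_submodule[OF ab p]
  note closed = sobolev_vecs_add[OF ab p] sobolev_vecs_smult[OF ab p]
  show "(\<lambda>y. ?cl (?L y)) \<in> carrier ?X \<rightarrow> carrier ?Q"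
    using quotient_carrierI[OF vs] diff_op_sobolev
    by (auto simp: sobolev_class_def sobolev_space_def sobolev_funs_simps)
  show "?cl (?L (y \<oplus>\<^bsub>?X\<^esub> z)) = ?cl (?L y) \<oplus>\<^bsub>?Q\<^esub> ?cl (?L z)" if "y \<in> carrier ?X \<and> z \<in> carrier ?X" for y z
  proof -
    have yz: "y \<in> sobolev_vecs a b p (n + r) m" "z \<in> sobolev_vecs a b p (n + r) m" using that by (auto simp: sobolev_funs_simps)
    have sum: "(\<lambda>t. ?L y t + ?L z t) \<in> sobolev_vecs a b p n m" by (intro closed diff_op_sobolev yz)
    have "AE t in lebesgue_on {a..b}. ?L (\<lambda>t. y t + z t) t = ?L y t + ?L z t"
    proof (rule diff_op_AE_eqI[OF sum])
      fix k assume k: "k < m"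
      \<comment> \<open>The sum of two functions is written as a combination over the Boolean values
        in order to use \<open>L_lincomb\<close>.\<close>
      have "sobolev_eq a b n (L (\<lambda>k t. \<Sum>c\<in>{False, True}. 1 * comps (if c then z else y) k t) k)
          (\<lambda>t. \<Sum>c\<in>{False, True}. 1 * L (comps (if c then z else y)) k t)"
        by (rule L_lincomb[OF _ _ k]) (use sobolev_vecsD(4)[OF yz(1)] sobolev_vecsD(4)[OF yz(2)] in auto)
      then have h1: "sobolev_eq a b n (L (\<lambda>k t. y t $ k + z t $ k) k) (\<lambda>t. L (comps y) k t + L (comps z) k t)"
        by simp
      have h2: "sobolev_eq a b n (L (\<lambda>k t. (y t + z t) $ k) k) (L (\<lambda>k t. y t $ k + z t $ k) k)"
        by (rule sobolev_eqI, rule L_cong[OF _ k]) (use sobolev_vecsD(1)[OF yz(2)] in simp)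
      have h3: "sobolev_eq a b n (\<lambda>t. L (comps y) k t + L (comps z) k t) (\<lambda>t. (?L y t + ?L z t) $ k)"
        by (rule sobolev_eqI) (simp add: diff_op_index diff_op_dim k del: atLeastAtMost_iff)
      show "sobolev_eq a b n (L (\<lambda>k t. (y t + z t) $ k) k) (\<lambda>t. (?L y t + ?L z t) $ k)"
        by (rule sobolev_eq_trans[OF sobolev_eq_trans[OF h2 h1] h3])
    qed
    then have "?cl (?L (\<lambda>t. y t + z t)) = ?cl (\<lambda>t. ?L y t + ?L z t)"
      using sobolev_class_eq_iff[OF ab p diff_op_sobolev[OF closed(1)[OF yz]] sum] by simp
    also have "\<dots> = ?cl (?L y) \<oplus>\<^bsub>?Q\<^esub> ?cl (?L z)"
      using quotient_add[OF vs, where x = "?L y" and y = "?L z"] diff_op_sobolev[OF yz(1)] diff_op_sobolev[OF yz(2)]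
      by (simp add: sobolev_class_def sobolev_space_def sobolev_funs_simps)
    finally show ?thesis by (simp add: sobolev_funs_simps)
  qed
  show "?cl (?L (c \<odot>\<^bsub>?X\<^esub> y)) = c \<odot>\<^bsub>?Q\<^esub> ?cl (?L y)" if "c \<in> carrier class_ring \<and> y \<in> carrier ?X" for c y
  proof -
    have y: "y \<in> sobolev_vecs a b p (n + r) m" using that by (auto simp: sobolev_funs_simps)
    have sm: "(\<lambda>t. c \<cdot>\<^sub>v ?L y t) \<in> sobolev_vecs a b p n m" by (intro closed diff_op_sobolev y)
    have "AE t in lebesgue_on {a..b}. ?L (\<lambda>t. c \<cdot>\<^sub>v y t) t = c \<cdot>\<^sub>v ?L y t"
    proof (rule diff_op_AE_eqI[OF sm])
      fix k assume k: "k < m"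
      have "sobolev_eq a b n (L (\<lambda>k t. \<Sum>_\<in>{()}. c * comps y k t) k) (\<lambda>t. \<Sum>_\<in>{()}. c * L (comps y) k t)"
        by (rule L_lincomb[OF _ _ k]) (use sobolev_vecsD(4)[OF y] in auto)
      then have h1: "sobolev_eq a b n (L (\<lambda>k t. c * y t $ k) k) (\<lambda>t. c * L (comps y) k t)" by simp
      have h2: "sobolev_eq a b n (L (\<lambda>k t. (c \<cdot>\<^sub>v y t) $ k) k) (L (\<lambda>k t. c * y t $ k) k)"
        by (rule sobolev_eqI, rule L_cong[OF _ k]) (use sobolev_vecsD(1)[OF y] in simp)
      have h3: "sobolev_eq a b n (\<lambda>t. c * L (comps y) k t) (\<lambda>t. (c \<cdot>\<^sub>v ?L y t) $ k)"
        by (rule sobolev_eqI) (simp add: diff_op_index diff_op_dim k del: atLeastAtMost_iff)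
      show "sobolev_eq a b n (L (\<lambda>k t. (c \<cdot>\<^sub>v y t) $ k) k) (\<lambda>t. (c \<cdot>\<^sub>v ?L y t) $ k)"
        by (rule sobolev_eq_trans[OF sobolev_eq_trans[OF h2 h1] h3])
    qed
    then have "?cl (?L (\<lambda>t. c \<cdot>\<^sub>v y t)) = ?cl (\<lambda>t. c \<cdot>\<^sub>v ?L y t)"
      using sobolev_class_eq_iff[OF ab p diff_op_sobolev[OF closed(2)[OF y]] sm] by simp
    also have "\<dots> = c \<odot>\<^bsub>?Q\<^esub> ?cl (?L y)"
      using quotient_smult[OF vs, where c = c and x = "?L y"] diff_op_sobolev[OF y]
      by (simp add: sobolev_class_def sobolev_space_def sobolev_funs_simps)
    finally show ?thesis by (simp add: sobolev_funs_simps)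
  qed
qed

text \<open>\<open>B\<close> is given as a module homomorphism, so the columns are split off one at
  a time by additivity and homogeneity; the empty combination is the zero function.\<close>

lemma B_fcomb:
  assumes B: "B \<in> LinearCombinations.module_hom class_ring (sobolev_funs a b p (n + r) m) (module_vec TYPE(complex) d)"
    and N: "N \<le> r * m"
  shows "B (fcomb N v) = vec d (\<lambda>q. \<Sum>c<N. v $ c * B (fcol c) $ q)"
  using N
proof (induction N)
  interpret B: mod_hom "class_ring :: complex ring" "sobolev_funs a b p (n + r) m" "module_vec TYPE(complex) d" B
    by (intro mod_hom.intro mod_hom_axioms.intro B vec_module)
      (use sobolev_funs_vectorspace[OF ab p] in \<open>simp add: vectorspace_def\<close>)
  case 0
  have "fcomb 0 v = \<zero>\<^bsub>sobolev_funs a b p (n + r) m\<^esub>"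
    by (simp add: fcomb_def sobolev_funs_simps fun_eq_iff vec_eq_iff)
  then have "B (fcomb 0 v) = 0\<^sub>v d" using B.f0_is_0 by (simp add: module_vec_simps)
  then show ?case by (simp add: vec_eq_iff)
next
  case (Suc N)
  let ?X = "sobolev_funs a b p (n + r) m"
  have N: "N < r * m" using Suc.prems by simp
  have car: "fcomb N v \<in> carrier ?X" "fcol N \<in> carrier ?X" "v $ N \<odot>\<^bsub>?X\<^esub> fcol N \<in> carrier ?X"
    using fcomb(1)[of N v] fcol(1)[OF N] sobolev_vecs_smult[OF ab p fcol(1)[OF N]] N by (simp_all add: sobolev_funs_simps)
  have "fcomb (Suc N) v = fcomb N v \<oplus>\<^bsub>?X\<^esub> (v $ N \<odot>\<^bsub>?X\<^esub> fcol N)"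
    using sobolev_vecsD(1)[OF fcol(1)[OF N]] by (simp add: fcomb_def sobolev_funs_simps fun_eq_iff vec_eq_iff)
  then have "B (fcomb (Suc N) v) = B (fcomb N v) + v $ N \<cdot>\<^sub>v B (fcol N)"
    using module_hom_add[OF B car(1,3)] module_hom_smult[OF B _ car(2), of "v $ N"]
    by (simp add: module_vec_simps)
  moreover have "dim_vec (B (fcol N)) = d"
    using module_hom_closed[OF B] car(2) by (auto simp: module_vec_simps dest!: funcset_mem)
  ultimately show ?case using Suc.IH N by (simp add: vec_eq_iff)
qed

text \<open>The entries of column \<open>c\<close> of the characteristic matrix are the components
  of \<open>B (fcol c)\<close>, so the product with \<open>v\<close> is the combination computed in
  \<open>B_fcomb\<close>.\<close>

lemma characteristic_matrix_mult:
  assumes B: "B \<in> LinearCombinations.module_hom class_ring (sobolev_funs a b p (n + r) m) (module_vec TYPE(complex) (r * m))"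
    and v: "v \<in> carrier_vec (r * m)"
  shows "characteristic_matrix a b p n m r A B *\<^sub>v v = B (fcomb (r * m) v)"
proof -
  have "(characteristic_matrix a b p n m r A B *\<^sub>v v) $ q = (\<Sum>c<r * m. v $ c * B (fcol c) $ q)" if "q < r * m" for q
    using v that m
    by (simp add: characteristic_matrix_def apply_to_cols_def scalar_prod_def lessThan_atLeast0 fcol_def mult.commute)
  then show ?thesis
    unfolding B_fcomb[OF B order_refl] by (simp add: vec_eq_iff characteristic_matrix_def)
qed

end

theorem theorem3:
  fixes a b :: real and p :: ereal and n m r :: nat
    and A :: "nat \<Rightarrow> real \<Rightarrow> complex mat"
    and B :: "(real \<Rightarrow> complex vec) \<Rightarrow> complex vec"
  assumes "a < b" and "m \<ge> 1" and "r \<ge> 1" and "1 \<le> p"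
    and "\<And>l. l \<in> {1..r} \<Longrightarrow> A (r - l) \<in> sobolev_mats a b p n m"
    and "B \<in> LinearCombinations.module_hom class_ring
               (sobolev_funs a b p (n + r) m) (module_vec TYPE(complex) (r * m))"
    and "continuous_sobolev_op a b p (n + r) m (r * m) B"
  shows
    "let X = sobolev_funs a b p (n + r) m;
         C = module_vec TYPE(complex) (r * m);
         Z = direct_sum (sobolev_space a b p n m) C;
         LB = boundary_op a b p n m r A B;
         M = (\<lambda>v. characteristic_matrix a b p n m r A B *\<^sub>v v)
     in vectorspace.fin_dim class_ring (kernel_module X Z LB) \<and>
        vectorspace.fin_dim class_ring (cokernel_module X Z LB) \<and>
        vectorspace.dim class_ring (kernel_module X Z LB) =
          vectorspace.dim class_ring (kernel_module C C M) \<and>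
        vectorspace.dim class_ring (cokernel_module X Z LB) =
          vectorspace.dim class_ring (cokernel_module C C M)"
proof -
  interpret ode a b p n m r A
  proof
    \<comment> \<open>The coefficient of the derivative of order \<open>s\<close> is the one with
      \<open>l = r - s\<close>, which lies in \<open>{1..r}\<close>.\<close>
    show "A s \<in> sobolev_mats a b p n m" if "s < r" for s
      using assms(5)[of "r - s"] that by auto
  qed (use assms in auto)
  interpret C: vec_space "TYPE(complex)" "r * m" .
  let ?F = "sobolev_funs a b p n m" and ?N = "null_funs a b p n m"
  have LB: "boundary_op a b p n m r A B = (\<lambda>y. (a_r_coset ?F ?N (diff_op a b m r A y), B y))"
    by (simp add: fun_eq_iff boundary_op_def sobolev_class_def)
  \<comment> \<open>The kernel condition of \<open>kernel_cokernel_dim\<close> refers to the zero of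
    the quotient; as the class of the zero function it becomes vanishing almost everywhere.\<close>
  have zero: "\<zero>\<^bsub>sobolev_space a b p n m\<^esub> = sobolev_class a b p n m (\<lambda>t. 0\<^sub>v m)"
    using quotient_zero[OF sobolev_funs_vectorspace[OF ab p] null_funs_submodule[OF ab p]]
    by (simp add: sobolev_space_def sobolev_class_def sobolev_funs_simps)
  show ?thesis
    unfolding Let_def LB sobolev_space_def
  proof (rule kernel_cokernel_dim[where \<Psi> = "fcomb (r * m)"])
    show "vectorspace class_ring (sobolev_funs a b p (n + r) m)" "vectorspace class_ring ?F"
      "submodule class_ring ?N ?F" "vectorspace class_ring (module_vec TYPE(complex) (r * m))"
      by (intro sobolev_funs_vectorspace null_funs_submodule ab p vec_vs)+
    show "vectorspace.fin_dim class_ring (module_vec TYPE(complex) (r * m))" by (rule C.fin_dim)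
    show "(\<lambda>y. a_r_coset ?F ?N (diff_op a b m r A y)) \<in> LinearCombinations.module_hom class_ring (sobolev_funs a b p (n + r) m) (quotient_module ?F ?N)"
      using diff_op_class_hom unfolding sobolev_class_def sobolev_space_def .
    show "B \<in> LinearCombinations.module_hom class_ring (sobolev_funs a b p (n + r) m) (module_vec TYPE(complex) (r * m))"
      by (rule assms)
    show "inj_on (fcomb (r * m)) (carrier (module_vec TYPE(complex) (r * m)))"
      using fcomb_inj by (simp add: module_vec_simps)
    show "a_r_coset ?F ?N (diff_op a b m r A y) = \<zero>\<^bsub>quotient_module ?F ?N\<^esub> \<longleftrightarrow>
        y \<in> fcomb (r * m) ` carrier (module_vec TYPE(complex) (r * m))"
      if "y \<in> carrier (sobolev_funs a b p (n + r) m)" for y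
      using that sobolev_class_eq_iff[OF ab p diff_op_sobolev sobolev_vecs_zero[OF ab p], of y] diff_op_null_iff[of y] zero
      by (simp add: sobolev_funs_simps sobolev_class_def sobolev_space_def module_vec_simps)
    show "\<exists>y\<in>carrier (sobolev_funs a b p (n + r) m). a_r_coset ?F ?N (diff_op a b m r A y) = a_r_coset ?F ?N f"
      if f: "f \<in> carrier ?F" for f
    proof -
      have "f \<in> sobolev_vecs a b p n m" using f by (simp add: sobolev_funs_simps)
      then show ?thesis
        using diff_op_surj[of f] sobolev_class_eq_iff[OF ab p diff_op_sobolev, of _ f]
        by (auto simp: sobolev_funs_simps sobolev_class_def)
    qed
    show "characteristic_matrix a b p n m r A B *\<^sub>v v = B (fcomb (r * m) v)"
      if "v \<in> carrier (module_vec TYPE(complex) (r * m))" for v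
      using characteristic_matrix_mult[OF assms(6)] that by (simp add: module_vec_simps)
  qed (rule fcomb_hom)
qed

end
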